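(* Let $m,n\ge0$ be integers, not both zero. For $\Lambda\in\mathcal{P}^+_{m|n}$, one has $L_{m|n}(\Lambda)=K_{m|n}(\Lambda)$ (that is, the Kac module $K_{m|n}(\Lambda)$ is irreducible) if and only if $\Lambda_{-1}\ge n$.
   Context: Ground field $\mathbb{C}$. $\mathfrak{g}=\mathfrak{gl}_{m|n}$ acts on $\mathbb{C}^{m|n}$ with even basis indexed by $[-m]=\{-m,\ldots,-1\}$ and odd basis indexed by $[n]'=\{1',\ldots,n'\}$; $\mathfrak{h}$ = diagonal matrices, $\epsilon_i$ the dual basis of $\mathfrak{h}^*$. $\mathfrak{g}=\mathfrak{g}_{-1}\oplus\mathfrak{g}_0\oplus\mathfrak{g}_1$ with $\mathfrak{g}_0=\mathfrak{gl}_m\oplus\mathfrak{gl}_n$ and $\mathfrak{g}_1$ spanned by root vectors for $\epsilon_i-\epsilon_j$, $i\in[-m]$, $j\in[n]'$. $P^+_{m|n}$ is the set of $\Lambda=\sum\Lambda_i\epsilon_i$, $\Lambda_i\in\mathbb{Z}$, with $\Lambda_{-m}\ge\cdots\ge\Lambda_{-1}$ and $\Lambda_{1'}\ge\cdots\ge\Lambda_{n'}$. For $\Lambda\in P^+_{m|n}$, $L^0(\Lambda)$ is the finite-dimensional irreducible $\mathfrak{g}_0$-module of highest weight $\Lambda$ (standard upper-triangular Borel) with $\mathfrak{g}_1$ acting by $0$; $K_{m|n}(\Lambda)=U(\mathfrak{g})\otimes_{U(\mathfrak{g}_0\oplus\mathfrak{g}_1)}L^0(\Lambda)$ and $L_{m|n}(\Lambda)$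 is its unique irreducible quotient. $\mathcal{P}^+_{m|n}$ is the set of $\Lambda\in P^+_{m|n}$ with all $\Lambda_k\ge0$ and $\ell(\Lambda^{>0})\le\Lambda_{-1}$, where $\Lambda^{>0}=(\Lambda_{1'},\ldots,\Lambda_{n'})$ and $\ell$ is the number of nonzero parts. If $m=0$, conditions involving $\Lambda_{-1}$ are regarded as vacuously true. *)

theory Defs
  imports
    "Jordan_Normal_Form.Matrix"
    "HOL-Algebra.QuotRing"
    "HOL-Algebra.Free_Abelian_Groups"
begin

section \<open>The Lie superalgebra of block matrices\<close>

text \<open>
  The ordered index set \<open>-m < \<dots> < -1 < 1' < \<dots> < n'\<close> is identified with the matrix positions
  \<open>0, \<dots>, m + n - 1\<close>: the even index \<open>-i\<close> is position \<open>m - i\<close> and the odd index \<open>j'\<close> is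
  position \<open>m + j - 1\<close>.  In particular, for \<open>m > 0\<close>, the index \<open>-1\<close> is position \<open>m - 1\<close>.
\<close>

definition gl :: "nat \<Rightarrow> nat \<Rightarrow> complex mat set" where
  "gl m n = carrier_mat (m + n) (m + n)"

text \<open>Homogeneous elements; the Boolean is the parity (\<open>True\<close> is odd).\<close>

definition gl_par :: "nat \<Rightarrow> nat \<Rightarrow> bool \<Rightarrow> complex mat set" where
  "gl_par m n p = {x \<in> gl m n. \<forall>i < m + n. \<forall>j < m + n.
     x $$ (i, j) \<noteq> 0 \<longrightarrow> ((i < m) \<noteq> (j < m)) = p}"

abbreviation gl_zero :: "nat \<Rightarrow> nat \<Rightarrow> complex mat set" where
  "gl_zero m n \<equiv> gl_par m n False"

text \<open>The parabolic subalgebra \<open>g_0 + g_1\<close>: the lower left block vanishes.\<close>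

definition gl_nonneg :: "nat \<Rightarrow> nat \<Rightarrow> complex mat set" where
  "gl_nonneg m n = {x \<in> gl m n. \<forall>i < m + n. \<forall>j < m + n. m \<le> i \<and> j < m \<longrightarrow> x $$ (i, j) = 0}"

definition zero_part :: "nat \<Rightarrow> nat \<Rightarrow> complex mat \<Rightarrow> complex mat" where
  "zero_part m n x = mat (m + n) (m + n) (\<lambda>(i, j). if (i < m) = (j < m) then x $$ (i, j) else 0)"

text \<open>The superbracket of homogeneous elements \<open>x\<close>, \<open>y\<close> of parities \<open>p\<close>, \<open>q\<close>.\<close>

definition sbracket :: "bool \<Rightarrow> bool \<Rightarrow> complex mat \<Rightarrow> complex mat \<Rightarrow> complex mat" where
  "sbracket p q x y = (if p \<and> q then x * y + y * x else x * y - y * x)"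

section \<open>The universal enveloping algebra\<close>

text \<open>Words under concatenation, wrapped so that they form an instance of the class
  \<open>monoid_add\<close>; finitely supported functions on words are then noncommutative polynomials.\<close>

datatype 'a word = Word (letters: "'a list")

instantiation word :: (type) monoid_add
begin

definition zero_word :: "'a word" where
  "zero_word = Word []"

definition plus_word :: "'a word \<Rightarrow> 'a word \<Rightarrow> 'a word" where
  "plus_word v w = Word (letters v @ letters w)"

instance
  by standard (simp_all add: zero_word_def plus_word_def)

end

type_synonym 'a ncpoly = "'a word \<Rightarrow>\<^sub>0 complex"

definition ncconst :: "complex \<Rightarrow> 'a ncpoly" where
  "ncconst c = Poly_Mapping.single 0 c"

definition ncvar :: "'a \<Rightarrow> 'a ncpoly" where
  "ncvar x = Poly_Mapping.single (Word [x]) 1"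

definition free_algebra :: "'a set \<Rightarrow> 'a ncpoly ring" where
  "free_algebra X =
    \<lparr>carrier = {f. \<forall>w \<in> Poly_Mapping.keys f. set (letters w) \<subseteq> X},
     mult = (*), one = 1, ring.zero = 0, ring.add = (+)\<rparr>"

text \<open>The free algebra is taken on the underlying set of \<open>g\<close>; the first two families of relations
  cut it down to the tensor algebra of the vector space \<open>g\<close>.\<close>

definition env_rels :: "nat \<Rightarrow> nat \<Rightarrow> complex mat ncpoly set" where
  "env_rels m n =
     {ncvar (x + y) - ncvar x - ncvar y | x y. x \<in> gl m n \<and> y \<in> gl m n}
   \<union> {ncvar (c \<cdot>\<^sub>m x) - ncconst c * ncvar x | c x. x \<in> gl m n}
   \<union> {ncvar x * ncvar y - ncconst (if p \<and> q then -1 else 1) * (ncvar y * ncvar x)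
        - ncvar (sbracket p q x y) | p q x y. x \<in> gl_par m n p \<and> y \<in> gl_par m n q}"

definition env_ideal :: "nat \<Rightarrow> nat \<Rightarrow> complex mat ncpoly set" where
  "env_ideal m n = genideal (free_algebra (gl m n)) (env_rels m n)"

definition env_algebra :: "nat \<Rightarrow> nat \<Rightarrow> complex mat ncpoly set ring" where
  "env_algebra m n = free_algebra (gl m n) Quot env_ideal m n"

definition env_class :: "nat \<Rightarrow> nat \<Rightarrow> complex mat ncpoly \<Rightarrow> complex mat ncpoly set" where
  "env_class m n f = env_ideal m n +>\<^bsub>free_algebra (gl m n)\<^esub> f"

section \<open>Extension of scalars and irreducible modules\<close>

text \<open>
  For a ring \<open>R\<close>, a ring \<open>S\<close> with a homomorphism \<open>\<phi>\<close> to \<open>R\<close>, and a left \<open>S\<close>-module with underlying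
  group the type \<open>'v\<close> and action \<open>act\<close>, this is the left \<open>R\<close>-module \<open>R \<otimes>\<^sub>S 'v\<close>: the free abelian
  group on pairs modulo the biadditive \<open>S\<close>-balanced relations.  Only the set of elements of \<open>S\<close>
  enters.  The fields \<open>mult\<close> and \<open>one\<close> of the module record have no meaning for a module.
\<close>

definition tensor_rels ::
    "('r, 'b) ring_scheme \<Rightarrow> 's set \<Rightarrow> ('s \<Rightarrow> 'r) \<Rightarrow> ('s \<Rightarrow> 'v \<Rightarrow> 'v)
      \<Rightarrow> ('r \<times> 'v::ab_group_add \<Rightarrow>\<^sub>0 int) set" where
  "tensor_rels R S \<phi> act =
     {frag_of (a \<oplus>\<^bsub>R\<^esub> b, v) - frag_of (a, v) - frag_of (b, v) | a b v.
        a \<in> carrier R \<and> b \<in> carrier R}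
   \<union> {frag_of (a, v + w) - frag_of (a, v) - frag_of (a, w) | a v w. a \<in> carrier R}
   \<union> {frag_of (a \<otimes>\<^bsub>R\<^esub> \<phi> s, v) - frag_of (a, act s v) | a s v. a \<in> carrier R \<and> s \<in> S}"

definition extension_of_scalars ::
    "('r, 'b) ring_scheme \<Rightarrow> 's set \<Rightarrow> ('s \<Rightarrow> 'r) \<Rightarrow> ('s \<Rightarrow> 'v \<Rightarrow> 'v)
      \<Rightarrow> ('r, ('r \<times> 'v::ab_group_add \<Rightarrow>\<^sub>0 int) set) module" where
  "extension_of_scalars R S \<phi> act =
    (let A = free_Abelian_group (carrier R \<times> UNIV);
         N = generate A (tensor_rels R S \<phi> act);
         Q = A Mod N
     in \<lparr>carrier = carrier Q, mult = undefined, one = undefined,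
         ring.zero = \<one>\<^bsub>Q\<^esub>, ring.add = (\<otimes>\<^bsub>Q\<^esub>),
         smult = (\<lambda>a X. \<Union>x\<in>X. N #>\<^bsub>A\<^esub> frag_extend (\<lambda>(b, v). frag_of (a \<otimes>\<^bsub>R\<^esub> b, v)) x)\<rparr>)"

text \<open>Left modules over a not necessarily commutative ring; the library predicate \<open>submodule\<close>
  only uses the carrier of \<open>R\<close> and so applies.\<close>

definition irreducible_module :: "('r, 'b) ring_scheme \<Rightarrow> ('r, 'a, 'c) module_scheme \<Rightarrow> bool" where
  "irreducible_module R M \<longleftrightarrow>
     carrier M \<noteq> {\<zero>\<^bsub>M\<^esub>} \<and> (\<forall>W. submodule W R M \<longrightarrow> W = {\<zero>\<^bsub>M\<^esub>} \<or> W = carrier M)"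

section \<open>Highest weight modules and Kac modules\<close>

text \<open>A weight is an integer vector of dimension \<open>m + n\<close>, its entries being the coefficients of the
  \<open>\<epsilon>\<^sub>i\<close> in the order of the positions above.\<close>

definition dominant_weights :: "nat \<Rightarrow> nat \<Rightarrow> int vec set" where
  "dominant_weights m n = {\<Lambda> \<in> carrier_vec (m + n).
     (\<forall>i j. i \<le> j \<and> j < m \<longrightarrow> \<Lambda> $ j \<le> \<Lambda> $ i) \<and>
     (\<forall>i j. m \<le> i \<and> i \<le> j \<and> j < m + n \<longrightarrow> \<Lambda> $ j \<le> \<Lambda> $ i)}"

definition polynomial_weights :: "nat \<Rightarrow> nat \<Rightarrow> int vec set" where
  "polynomial_weights m n = {\<Lambda> \<in> dominant_weights m n.
     (\<forall>k < m + n. 0 \<le> \<Lambda> $ k) \<and>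
     (m > 0 \<longrightarrow> int (card {k. m \<le> k \<and> k < m + n \<and> \<Lambda> $ k \<noteq> 0}) \<le> \<Lambda> $ (m - 1))}"

text \<open>Models of the \<open>g_0\<close>-module \<open>L\<^sup>0(\<Lambda>)\<close>, with underlying space the type \<open>'v\<close>.\<close>

locale gl_zero_irrep = vector_space scale
  for scale :: "complex \<Rightarrow> 'v::ab_group_add \<Rightarrow> 'v" +
  fixes m n :: nat and \<Lambda> :: "int vec" and \<rho> :: "complex mat \<Rightarrow> 'v \<Rightarrow> 'v"
  assumes linear_rep: "x \<in> gl_zero m n \<Longrightarrow> Vector_Spaces.linear scale scale (\<rho> x)"
    and rep_add: "\<lbrakk>x \<in> gl_zero m n; y \<in> gl_zero m n\<rbrakk> \<Longrightarrow> \<rho> (x + y) v = \<rho> x v + \<rho> y v"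
    and rep_smult: "x \<in> gl_zero m n \<Longrightarrow> \<rho> (c \<cdot>\<^sub>m x) v = scale c (\<rho> x v)"
    and rep_bracket: "\<lbrakk>x \<in> gl_zero m n; y \<in> gl_zero m n\<rbrakk>
          \<Longrightarrow> \<rho> (x * y - y * x) v = \<rho> x (\<rho> y v) - \<rho> y (\<rho> x v)"
    and finite_dim: "\<exists>B. finite B \<and> span B = UNIV"
    and nonzero: "\<exists>v::'v. v \<noteq> 0"
    and irreducible: "\<lbrakk>subspace W; \<And>x w. \<lbrakk>x \<in> gl_zero m n; w \<in> W\<rbrakk> \<Longrightarrow> \<rho> x w \<in> W\<rbrakk>
          \<Longrightarrow> W = {0} \<or> W = UNIV"
    and highest_weight: "\<exists>v. v \<noteq> 0 \<and>
          (\<forall>x \<in> gl_zero m n. (\<forall>i < m + n. \<forall>j \<le> i. x $$ (i, j) = 0) \<longrightarrow> \<rho> x v = 0) \<and>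
          (\<forall>h \<in> gl_zero m n. diagonal_mat h \<longrightarrow>
             \<rho> h v = scale (\<Sum>i < m + n. of_int (\<Lambda> $ i) * h $$ (i, i)) v)"

text \<open>The linear extension to noncommutative polynomials of an action of the letters.\<close>

definition ncpoly_act ::
    "(complex \<Rightarrow> 'v \<Rightarrow> 'v) \<Rightarrow> ('a \<Rightarrow> 'v \<Rightarrow> 'v) \<Rightarrow> 'a ncpoly \<Rightarrow> 'v \<Rightarrow> 'v::ab_group_add" where
  "ncpoly_act scale \<rho> f v =
     (\<Sum>w \<in> Poly_Mapping.keys f. scale (Poly_Mapping.lookup f w) (foldr \<rho> (letters w) v))"

text \<open>
  \<open>U(g) \<otimes> L\<^sup>0(\<Lambda>)\<close> over \<open>U(g_0 + g_1)\<close>, where \<open>g_1\<close> acts on \<open>L\<^sup>0(\<Lambda>)\<close> by zero.  Elements of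
  \<open>U(g_0 + g_1)\<close> are represented by elements of the free algebra on \<open>g_0 + g_1\<close>, through which both
  its map to \<open>U(g)\<close> and its action on \<open>L\<^sup>0(\<Lambda>)\<close> are given; so being balanced over either is the same condition.
\<close>

definition kac_module ::
    "nat \<Rightarrow> nat \<Rightarrow> (complex \<Rightarrow> 'v \<Rightarrow> 'v) \<Rightarrow> (complex mat \<Rightarrow> 'v \<Rightarrow> 'v)
      \<Rightarrow> (complex mat ncpoly set, (complex mat ncpoly set \<times> 'v::ab_group_add \<Rightarrow>\<^sub>0 int) set) module"
  where
  "kac_module m n scale \<rho> =
     extension_of_scalars (env_algebra m n)
       (carrier (free_algebra (gl_nonneg m n))) (env_class m n)
       (ncpoly_act scale (\<lambda>x. \<rho> (zero_part m n x)))"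

end

theory Submission
  imports Defs "HOL-Library.Function_Algebras"
begin

text \<open>
  By the theorem of Poincare, Birkhoff and Witt the Kac module is \<open>\<Lambda>(g\<^bsub>-1\<^esub>) \<otimes> L\<^sup>0(\<Lambda>)\<close> as a vector
  space.  Instead of proving that theorem for the enveloping algebra, the space of families
  \<open>F S \<in> L\<^sup>0(\<Lambda>)\<close>, indexed by the sets \<open>S\<close> of negative odd roots, is given an explicit action of the
  superalgebra through creation and annihilation operators (\<open>zero_op\<close>, \<open>up_op\<close>, \<open>low_op\<close>).  An operator
  on this Fock space is determined by its values on the vacuum \<open>L\<^sup>0(\<Lambda>)\<close> and by its brackets with the
  creation operators, so that the defining relations reduce to Jacobi identities between matrices
  (\<open>gl_op_bracket\<close>).  The universal property of the tensor product gives a map from the Kac module to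
  the Fock space.  The map back sends the basis vector of \<open>S\<close> to the ordered product of the
  lowering elements in \<open>S\<close>; it is equivariant modulo the tensor relations (\<open>fock_tensor_gl_op\<close>), and
  therefore the two maps are inverse to each other (\<open>fock_tensor_to_fock\<close>, \<open>to_fock_eq_iff\<close>).

  Irreducibility is decided by one computation.  Let \<open>v\<close> be a highest weight vector, number the
  \<open>N = m n\<close> negative odd root vectors \<open>f\<^sub>0, f\<^sub>1, \<dots>\<close> suitably and let \<open>e\<^sub>k\<close> be the transpose of \<open>f\<^sub>k\<close>.
  Then \<open>e\<^sub>k f\<^sub>k f\<^bsub>k+1\<^esub> \<dots> v = c\<^sub>k f\<^bsub>k+1\<^esub> \<dots> v\<close> (\<open>raising_tail\<close>), where \<open>c\<^sub>k\<close> is the pairing of \<open>\<Lambda> + \<rho>\<close> with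
  the \<open>k\<close>-th positive odd root.  If no \<open>c\<^sub>k\<close> vanishes, then a nonzero submodule contains the top
  exterior degree, hence \<open>f\<^sub>0 f\<^sub>1 \<dots> v\<close>, hence \<open>v\<close>, hence everything (\<open>typical_irreducible\<close>).  If some
  \<open>c\<^sub>k\<close> vanishes, the product of all \<open>e\<^sub>k\<close> kills \<open>f\<^sub>0 f\<^sub>1 \<dots> v\<close>; omitting
  factors where necessary, one obtains a nonzero vector of positive degree annihilated by \<open>g\<^sub>1\<close>, and
  such a vector generates a proper submodule (\<open>atypical_reducible\<close>).

  For a polynomial weight, \<open>\<Lambda>\<^bsub>-1\<^esub> \<ge> n\<close> makes every \<open>c\<^sub>k\<close> positive.  If \<open>\<Lambda>\<^bsub>-1\<^esub> < n\<close>, the length condition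
  forces \<open>\<Lambda>\<close> to vanish at the odd index with number \<open>\<Lambda>\<^bsub>-1\<^esub> + 1\<close>, and the odd root joining this index
  to the index \<open>-1\<close> has \<open>c\<^sub>k = 0\<close> (\<open>polynomial_weight_typical_iff\<close>).
\<close>

section \<open>Fermionic Fock space\<close>

text \<open>Families of vectors are treated as vectors: pointwise unfolding of sums would break up the
  operators below, so it only happens on request.\<close>

lemmas pointwise = plus_fun_apply zero_fun_apply minus_apply uminus_apply
declare pointwise [simp del]

text \<open>The Koszul sign of moving the odd generator \<open>p\<close> to its place in the ordered product of the
  elements of \<open>S\<close>.\<close>

definition order_sign :: "nat \<Rightarrow> nat set \<Rightarrow> 'v::ab_group_add \<Rightarrow> 'v" where
  "order_sign p S v = (if even (card {q \<in> S. q < p}) then v else - v)"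

text \<open>A family \<open>F\<close> stands for the sum over \<open>S\<close> of the ordered exterior monomial of \<open>S\<close> tensored with
  \<open>F S\<close>.  In these terms, creation is multiplication by the generator \<open>p\<close> from the left and
  annihilation is contraction with it.\<close>

definition creation :: "nat \<Rightarrow> (nat set \<Rightarrow> 'v::ab_group_add) \<Rightarrow> nat set \<Rightarrow> 'v" where
  "creation p F = (\<lambda>S. if p \<in> S then order_sign p S (F (S - {p})) else 0)"

definition annihilation :: "nat \<Rightarrow> (nat set \<Rightarrow> 'v::ab_group_add) \<Rightarrow> nat set \<Rightarrow> 'v" where
  "annihilation p F = (\<lambda>S. if p \<in> S then 0 else order_sign p S (F (insert p S)))"

lemma order_sign_insert:
  assumes "q \<notin> S"
  shows "order_sign p (insert q S) v = (if q < p then - order_sign p S v else order_sign p S v)"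
proof (cases "q < p")
  case True
  then have "{r \<in> insert q S. r < p} = insert q {r \<in> S. r < p}" by auto
  with True assms show ?thesis by (simp add: order_sign_def)
next
  case False
  then have "{r \<in> insert q S. r < p} = {r \<in> S. r < p}" by auto
  with False show ?thesis by (simp add: order_sign_def)
qed

lemma order_sign_remove:
  "q \<in> S \<Longrightarrow> order_sign p (S - {q}) v = (if q < p then - order_sign p S v else order_sign p S v)"
  using order_sign_insert[of q "S - {q}" p v] by (auto simp: insert_absorb)

lemma order_sign_simps [simp]:
  "order_sign p S 0 = 0"
  "order_sign p S (- v) = - order_sign p S v"
  "order_sign p S (order_sign p S v) = v"
  "order_sign p S (v + w) = order_sign p S v + order_sign p S w"
  "order_sign p S (v - w) = order_sign p S v - order_sign p S w"
  "order_sign p S v = 0 \<longleftrightarrow> v = 0"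
  by (auto simp: order_sign_def)

lemma order_sign_commute: "order_sign p S (order_sign q T v) = order_sign q T (order_sign p S v)"
  by (simp add: order_sign_def)

lemma creation_creation: "creation p (creation q F) = - creation q (creation p F)"
proof
  fix S
  have eq: "S - {p} - {q} = S - {q} - {p}" by auto
  show "creation p (creation q F) S = (- creation q (creation p F)) S"
  proof (cases "p \<in> S \<and> q \<in> S \<and> p \<noteq> q")
    case True
    then show ?thesis
      by (auto simp: pointwise creation_def order_sign_remove order_sign_commute[of p] eq)
  qed (auto simp: pointwise creation_def)
qed

text \<open>If \<open>p = q\<close>, exactly one of the two products survives at each set, and its two signs cancel.
  Otherwise one of \<open>p\<close>, \<open>q\<close> lies below the other, so that exchanging them changes one sign.\<close>

lemma annihilation_creation:
  "annihilation p (creation q F) = (if p = q then F else 0) - creation q (annihilation p F)"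
proof
  fix S
  show "annihilation p (creation q F) S = ((if p = q then F else 0) - creation q (annihilation p F)) S"
  proof (cases "p = q")
    case True
    then show ?thesis
      by (auto simp: pointwise annihilation_def creation_def order_sign_remove order_sign_insert insert_absorb)
  next
    case False
    then have "q \<in> S \<Longrightarrow> insert p S - {q} = insert p (S - {q})" by auto
    with False show ?thesis
      by (auto simp: pointwise annihilation_def creation_def order_sign_remove order_sign_insert order_sign_commute[of p])
  qed
qed

lemma creation_additive [simp]:
  "creation p 0 = 0"
  "creation p (- F) = - creation p F"
  "creation p (F + G) = creation p F + creation p G"
  "creation p (F - G) = creation p F - creation p G"
  by (auto simp: creation_def fun_eq_iff pointwise)

lemma annihilation_additive [simp]:
  "annihilation p 0 = 0"
  "annihilation p (- F) = - annihilation p F"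
  "annihilation p (F + G) = annihilation p F + annihilation p G"
  "annihilation p (F - G) = annihilation p F - annihilation p G"
  by (auto simp: annihilation_def fun_eq_iff pointwise)

lemma creation_sum: "creation p (sum F A) = (\<Sum>a\<in>A. creation p (F a))"
  using sum_comp_morphism[of "creation p" F A] by (simp add: o_def)

lemma sum_fun_apply: "sum F A x = (\<Sum>a\<in>A. F a x :: 'v::ab_group_add)"
  using sum_comp_morphism[of "\<lambda>G. G x" F A] by (simp add: o_def pointwise)

definition fock :: "nat \<Rightarrow> (nat set \<Rightarrow> 'v::ab_group_add) set" where
  "fock N = {F. \<forall>S. \<not> S \<subseteq> {..<N} \<longrightarrow> F S = 0}"

definition basis_vec :: "nat set \<Rightarrow> 'v::ab_group_add \<Rightarrow> nat set \<Rightarrow> 'v" where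
  "basis_vec S v = (\<lambda>T. if T = S then v else 0)"

lemma basis_vec_apply [simp]: "basis_vec S v S = v" "T \<noteq> S \<Longrightarrow> basis_vec S v T = 0"
  by (auto simp: basis_vec_def)

lemma basis_vec_additive [simp]:
  "basis_vec S 0 = 0"
  "basis_vec S (- v) = - basis_vec S v"
  "basis_vec S (v + w) = basis_vec S v + basis_vec S w"
  "basis_vec S (v - w) = basis_vec S v - basis_vec S w"
  by (auto simp: basis_vec_def fun_eq_iff pointwise)

lemma basis_vec_in_fock [simp]: "S \<subseteq> {..<N} \<Longrightarrow> basis_vec S v \<in> fock N"
  by (auto simp: fock_def basis_vec_def)

lemma fock_closed [simp]:
  "0 \<in> fock N"
  "F \<in> fock N \<Longrightarrow> G \<in> fock N \<Longrightarrow> F + G \<in> fock N"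
  "F \<in> fock N \<Longrightarrow> G \<in> fock N \<Longrightarrow> F - G \<in> fock N"
  "F \<in> fock N \<Longrightarrow> - F \<in> fock N"
  by (auto simp: fock_def pointwise)

lemma fock_sum: "(\<And>a. a \<in> A \<Longrightarrow> F a \<in> fock N) \<Longrightarrow> sum F A \<in> fock N"
  by (induction A rule: infinite_finite_induct) auto

lemma creation_in_fock [simp]: "F \<in> fock N \<Longrightarrow> p < N \<Longrightarrow> creation p F \<in> fock N"
  unfolding fock_def creation_def
  by (auto, metis (no_types, lifting) DiffI lessThan_iff singletonD subsetD)

lemma annihilation_in_fock [simp]: "F \<in> fock N \<Longrightarrow> annihilation p F \<in> fock N"
  by (auto simp: fock_def annihilation_def)

lemma fock_expansion:
  assumes "F \<in> fock N"
  shows "F = (\<Sum>S\<in>Pow {..<N}. basis_vec S (F S))"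
proof
  fix T
  have "(\<Sum>S\<in>Pow {..<N}. basis_vec S (F S)) T = (\<Sum>S\<in>Pow {..<N}. if T = S then F S else 0)"
    by (simp add: sum_fun_apply basis_vec_def)
  also have "\<dots> = F T"
    using assms by (simp add: fock_def)
  finally show "F T = (\<Sum>S\<in>Pow {..<N}. basis_vec S (F S)) T" by simp
qed

lemma creation_basis_vec:
  "creation p (basis_vec S v) = (if p \<in> S then 0 else basis_vec (insert p S) (order_sign p S v))"
proof
  fix T
  have "p \<in> T \<Longrightarrow> p \<notin> S \<Longrightarrow> T - {p} = S \<longleftrightarrow> T = insert p S" by auto
  then show "creation p (basis_vec S v) T
      = (if p \<in> S then 0 else basis_vec (insert p S) (order_sign p S v)) T"
    by (auto simp: creation_def basis_vec_def order_sign_insert pointwise)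
qed

lemma annihilation_basis_vec:
  "annihilation p (basis_vec S v) = (if p \<in> S then basis_vec (S - {p}) (order_sign p S v) else 0)"
proof
  fix T
  have "p \<notin> T \<Longrightarrow> p \<in> S \<Longrightarrow> insert p T = S \<longleftrightarrow> T = S - {p}" by auto
  then show "annihilation p (basis_vec S v) T
      = (if p \<in> S then basis_vec (S - {p}) (order_sign p S v) else 0) T"
    by (auto simp: annihilation_def basis_vec_def order_sign_remove pointwise)
qed

lemma order_sign_least: "(\<And>q. q \<in> S \<Longrightarrow> p \<le> q) \<Longrightarrow> order_sign p S v = v"
  unfolding order_sign_def by (metis (no_types, lifting) Collect_empty_eq card.empty even_zero leD)

lemma creation_basis_vec_least:
  "(\<And>q. q \<in> S \<Longrightarrow> p < q) \<Longrightarrow> creation p (basis_vec S v) = basis_vec (insert p S) v"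
  by (subst creation_basis_vec) (auto simp: order_sign_least less_imp_le)

lemma fock_basis_induct [consumes 1, case_names basis add]:
  assumes F: "F \<in> fock N"
    and basis: "\<And>S v. S \<subseteq> {..<N} \<Longrightarrow> P (basis_vec S v)"
    and add: "\<And>F G. F \<in> fock N \<Longrightarrow> G \<in> fock N \<Longrightarrow> P F \<Longrightarrow> P G \<Longrightarrow> P (F + G)"
  shows "P F"
proof -
  have "P 0" using basis[of "{}" 0] by simp
  have "P (\<Sum>S\<in>A. basis_vec S (F S)) \<and> (\<Sum>S\<in>A. basis_vec S (F S)) \<in> fock N" if "finite A" "A \<subseteq> Pow {..<N}" for A
    using that
  proof (induction A rule: finite_induct)
    case empty then show ?case using \<open>P 0\<close> by (simp only: sum.empty fock_closed simp_thms)
  next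
    case (insert S A)
    then show ?case
      unfolding sum.insert[OF insert.hyps(1,2)] by (auto intro!: add basis)
  qed
  from this[of "Pow {..<N}"] show ?thesis
    using fock_expansion[OF F] by (simp flip: fock_expansion[OF F])
qed

text \<open>A generator below all elements of \<open>S\<close> is created without a sign, so the creation operators
  generate the whole space from the vacuum.  Identities between operators are proved below by this
  induction: on the vacuum they are immediate, and they propagate along brackets with creation
  operators.\<close>

lemma fock_induct [consumes 1, case_names vacuum add creation]:
  assumes F: "F \<in> fock N"
    and vac: "\<And>v. P (basis_vec {} v)"
    and add: "\<And>F G. F \<in> fock N \<Longrightarrow> G \<in> fock N \<Longrightarrow> P F \<Longrightarrow> P G \<Longrightarrow> P (F + G)"
    and cr: "\<And>p F. F \<in> fock N \<Longrightarrow> p < N \<Longrightarrow> P F \<Longrightarrow> P (creation p F)"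
  shows "P F"
proof -
  have basis: "P (basis_vec S v)" if "S \<subseteq> {..<N}" for S v
  proof -
    have "finite S" using that finite_subset by blast
    then show ?thesis using that
    proof (induction S rule: finite_linorder_min_induct)
      case empty then show ?case by (simp add: vac)
    next
      case (insert p S)
      then have "P (creation p (basis_vec S v))" by (intro cr) auto
      then show ?case using insert by (simp add: creation_basis_vec_least)
    qed
  qed
  show ?thesis
    using F by (induction rule: fock_basis_induct) (auto intro: basis add)
qed

lemma creation_square [simp]: "creation p (creation p F) = 0"
  by (auto simp: creation_def fun_eq_iff pointwise)

lemma creation_annihilation_basis:
  "p \<in> S \<Longrightarrow> creation p (annihilation p (basis_vec S v)) = basis_vec S v"
  by (auto simp: annihilation_basis_vec creation_basis_vec order_sign_remove insert_absorb)

section \<open>The grading of the matrix superalgebra\<close>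

definition gl_up :: "nat \<Rightarrow> nat \<Rightarrow> complex mat set" where
  "gl_up m n = {x \<in> gl m n. \<forall>i < m + n. \<forall>j < m + n. x $$ (i, j) \<noteq> 0 \<longrightarrow> i < m \<and> m \<le> j}"

definition gl_low :: "nat \<Rightarrow> nat \<Rightarrow> complex mat set" where
  "gl_low m n = {x \<in> gl m n. \<forall>i < m + n. \<forall>j < m + n. x $$ (i, j) \<noteq> 0 \<longrightarrow> m \<le> i \<and> j < m}"

definition up_part :: "nat \<Rightarrow> nat \<Rightarrow> complex mat \<Rightarrow> complex mat" where
  "up_part m n x = mat (m + n) (m + n) (\<lambda>(i, j). if i < m \<and> m \<le> j then x $$ (i, j) else 0)"

definition low_part :: "nat \<Rightarrow> nat \<Rightarrow> complex mat \<Rightarrow> complex mat" where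
  "low_part m n x = mat (m + n) (m + n) (\<lambda>(i, j). if m \<le> i \<and> j < m then x $$ (i, j) else 0)"

abbreviation commutator :: "complex mat \<Rightarrow> complex mat \<Rightarrow> complex mat" where
  "commutator x y \<equiv> x * y - y * x"

abbreviation anticommutator :: "complex mat \<Rightarrow> complex mat \<Rightarrow> complex mat" where
  "anticommutator x y \<equiv> x * y + y * x"

lemma glD [dest]: "x \<in> gl m n \<Longrightarrow> x \<in> carrier_mat (m + n) (m + n)"
  by (simp add: gl_def)

lemma gl_closed [simp]:
  "0\<^sub>m (m + n) (m + n) \<in> gl m n"
  "x \<in> gl m n \<Longrightarrow> c \<cdot>\<^sub>m x \<in> gl m n"
  "x \<in> gl m n \<Longrightarrow> y \<in> gl m n \<Longrightarrow> x + y \<in> gl m n"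
  "x \<in> gl m n \<Longrightarrow> y \<in> gl m n \<Longrightarrow> x - y \<in> gl m n"
  "x \<in> gl m n \<Longrightarrow> y \<in> gl m n \<Longrightarrow> x * y \<in> gl m n"
  by (simp_all add: gl_def minus_carrier_mat)

lemma gl_entry:
  assumes "x \<in> gl m n" "y \<in> gl m n" "i < m + n" "j < m + n"
  shows "(c \<cdot>\<^sub>m x) $$ (i, j) = c * x $$ (i, j)"
    and "(x + y) $$ (i, j) = x $$ (i, j) + y $$ (i, j)"
    and "(x - y) $$ (i, j) = x $$ (i, j) - y $$ (i, j)"
  using assms by (auto simp: gl_def)

lemma gl_smult_entry:
  "x \<in> gl m n \<Longrightarrow> i < m + n \<Longrightarrow> j < m + n \<Longrightarrow> (c \<cdot>\<^sub>m x) $$ (i, j) = c * x $$ (i, j)"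
  by (auto simp: gl_def)

lemma gl_mult_entry:
  assumes "x \<in> gl m n" "y \<in> gl m n" "i < m + n" "j < m + n"
  shows "(x * y) $$ (i, j) = (\<Sum>k<m+n. x $$ (i, k) * y $$ (k, j))"
  using assms by (auto simp: gl_def scalar_prod_def lessThan_atLeast0)

lemma gl_eqI:
  assumes "x \<in> gl m n" "y \<in> gl m n"
    "\<And>i j. i < m + n \<Longrightarrow> j < m + n \<Longrightarrow> x $$ (i, j) = y $$ (i, j)"
  shows "x = y"
  using assms by (intro eq_matI) (auto simp: gl_def)

lemma graded_in_gl:
  "x \<in> gl_par m n p \<Longrightarrow> x \<in> gl m n"
  "x \<in> gl_up m n \<Longrightarrow> x \<in> gl m n"
  "x \<in> gl_low m n \<Longrightarrow> x \<in> gl m n"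
  "x \<in> gl_nonneg m n \<Longrightarrow> x \<in> gl m n"
  by (auto simp: gl_par_def gl_up_def gl_low_def gl_nonneg_def)

lemma parts_in [simp]:
  "zero_part m n x \<in> gl_zero m n"
  "up_part m n x \<in> gl_up m n"
  "low_part m n x \<in> gl_low m n"
  by (auto simp: zero_part_def up_part_def low_part_def gl_par_def gl_up_def gl_low_def gl_def
      split: if_splits)

lemma parts_in_gl [simp]:
  "zero_part m n x \<in> gl m n" "up_part m n x \<in> gl m n" "low_part m n x \<in> gl m n"
  by (blast intro: graded_in_gl parts_in)+

lemma parts_entry [simp]:
  assumes "i < m + n" "j < m + n"
  shows "zero_part m n x $$ (i, j) = (if (i < m) = (j < m) then x $$ (i, j) else 0)"
    "up_part m n x $$ (i, j) = (if i < m \<and> m \<le> j then x $$ (i, j) else 0)"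
    "low_part m n x $$ (i, j) = (if m \<le> i \<and> j < m then x $$ (i, j) else 0)"
  using assms by (simp_all add: zero_part_def up_part_def low_part_def)

lemma parts_decomposition:
  assumes "x \<in> gl m n"
  shows "zero_part m n x + up_part m n x + low_part m n x = x"
  by (rule gl_eqI[where m = m and n = n]) (use assms in \<open>auto simp: gl_entry[where m = m and n = n]\<close>)

lemma parts_add:
  assumes "x \<in> gl m n" "y \<in> gl m n"
  shows "zero_part m n (x + y) = zero_part m n x + zero_part m n y"
    "up_part m n (x + y) = up_part m n x + up_part m n y"
    "low_part m n (x + y) = low_part m n x + low_part m n y"
  by (rule gl_eqI[where m = m and n = n]; use assms in \<open>simp add: gl_entry[where m = m and n = n] gl_smult_entry[where m = m and n = n]\<close>)+

lemma parts_smult: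
  assumes "x \<in> gl m n"
  shows "zero_part m n (c \<cdot>\<^sub>m x) = c \<cdot>\<^sub>m zero_part m n x"
    "up_part m n (c \<cdot>\<^sub>m x) = c \<cdot>\<^sub>m up_part m n x"
    "low_part m n (c \<cdot>\<^sub>m x) = c \<cdot>\<^sub>m low_part m n x"
  by (rule gl_eqI[where m = m and n = n]; use assms in \<open>simp add: gl_entry[where m = m and n = n] gl_smult_entry[where m = m and n = n]\<close>)+

lemma graded_entry:
  assumes "i < m + n" "j < m + n"
  shows "x \<in> gl_zero m n \<Longrightarrow> (i < m) \<noteq> (j < m) \<Longrightarrow> x $$ (i, j) = 0"
    and "x \<in> gl_par m n True \<Longrightarrow> (i < m) = (j < m) \<Longrightarrow> x $$ (i, j) = 0"
    and "x \<in> gl_up m n \<Longrightarrow> \<not> (i < m \<and> m \<le> j) \<Longrightarrow> x $$ (i, j) = 0"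
    and "x \<in> gl_low m n \<Longrightarrow> \<not> (m \<le> i \<and> j < m) \<Longrightarrow> x $$ (i, j) = 0"
    and "x \<in> gl_nonneg m n \<Longrightarrow> m \<le> i \<Longrightarrow> j < m \<Longrightarrow> x $$ (i, j) = 0"
  using assms unfolding gl_par_def gl_up_def gl_low_def gl_nonneg_def by blast+

lemma graded_memI:
  assumes "x \<in> gl m n"
  shows "(\<And>i j. i < m + n \<Longrightarrow> j < m + n \<Longrightarrow> (i < m) \<noteq> (j < m) \<Longrightarrow> x $$ (i, j) = 0) \<Longrightarrow> x \<in> gl_zero m n"
    and "(\<And>i j. i < m + n \<Longrightarrow> j < m + n \<Longrightarrow> \<not> (i < m \<and> m \<le> j) \<Longrightarrow> x $$ (i, j) = 0) \<Longrightarrow> x \<in> gl_up m n"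
    and "(\<And>i j. i < m + n \<Longrightarrow> j < m + n \<Longrightarrow> \<not> (m \<le> i \<and> j < m) \<Longrightarrow> x $$ (i, j) = 0) \<Longrightarrow> x \<in> gl_low m n"
  using assms unfolding gl_par_def gl_up_def gl_low_def by blast+

lemma zero_part_of:
  "x \<in> gl_zero m n \<Longrightarrow> zero_part m n x = x"
  "x \<in> gl_up m n \<Longrightarrow> zero_part m n x = 0\<^sub>m (m + n) (m + n)"
  "x \<in> gl_low m n \<Longrightarrow> zero_part m n x = 0\<^sub>m (m + n) (m + n)"
  "x \<in> gl_par m n True \<Longrightarrow> zero_part m n x = 0\<^sub>m (m + n) (m + n)"
  by (rule gl_eqI[where m = m and n = n]; auto simp: not_le graded_entry[where m = m and n = n] graded_in_gl gl_entry[where m = m and n = n] gl_smult_entry[where m = m and n = n])+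

lemma up_part_of:
  "x \<in> gl_zero m n \<Longrightarrow> up_part m n x = 0\<^sub>m (m + n) (m + n)"
  "x \<in> gl_up m n \<Longrightarrow> up_part m n x = x"
  "x \<in> gl_low m n \<Longrightarrow> up_part m n x = 0\<^sub>m (m + n) (m + n)"
  by (rule gl_eqI[where m = m and n = n]; simp add: graded_entry[where m = m and n = n] graded_in_gl gl_entry[where m = m and n = n] gl_smult_entry[where m = m and n = n])+

lemma low_part_of:
  "x \<in> gl_zero m n \<Longrightarrow> low_part m n x = 0\<^sub>m (m + n) (m + n)"
  "x \<in> gl_up m n \<Longrightarrow> low_part m n x = 0\<^sub>m (m + n) (m + n)"
  "x \<in> gl_low m n \<Longrightarrow> low_part m n x = x"
  "x \<in> gl_nonneg m n \<Longrightarrow> low_part m n x = 0\<^sub>m (m + n) (m + n)"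
  by (rule gl_eqI[where m = m and n = n]; simp add: graded_entry[where m = m and n = n] graded_in_gl gl_entry[where m = m and n = n] gl_smult_entry[where m = m and n = n])+

lemma odd_decomposition:
  assumes "x \<in> gl_par m n True"
  shows "x = up_part m n x + low_part m n x"
  by (rule gl_eqI[where m = m and n = n]) (use assms in \<open>auto simp: graded_entry[where m = m and n = n] graded_in_gl gl_entry[where m = m and n = n] gl_smult_entry[where m = m and n = n]\<close>)

lemma graded_closed [simp]:
  "0\<^sub>m (m + n) (m + n) \<in> gl_zero m n"
  "x \<in> gl_zero m n \<Longrightarrow> y \<in> gl_zero m n \<Longrightarrow> x + y \<in> gl_zero m n"
  "x \<in> gl_zero m n \<Longrightarrow> y \<in> gl_zero m n \<Longrightarrow> x - y \<in> gl_zero m n"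
  "x \<in> gl_zero m n \<Longrightarrow> c \<cdot>\<^sub>m x \<in> gl_zero m n"
  "x \<in> gl_up m n \<Longrightarrow> y \<in> gl_up m n \<Longrightarrow> x - y \<in> gl_up m n"
  "0\<^sub>m (m + n) (m + n) \<in> gl_low m n"
  "x \<in> gl_low m n \<Longrightarrow> y \<in> gl_low m n \<Longrightarrow> x + y \<in> gl_low m n"
  "x \<in> gl_low m n \<Longrightarrow> y \<in> gl_low m n \<Longrightarrow> x - y \<in> gl_low m n"
  "x \<in> gl_low m n \<Longrightarrow> c \<cdot>\<^sub>m x \<in> gl_low m n"
  by (rule graded_memI; simp add: graded_entry[where m = m and n = n] graded_in_gl gl_entry[where m = m and n = n] gl_smult_entry[where m = m and n = n])+

lemma graded_nonzero:
  assumes "x $$ (i, j) \<noteq> 0" "i < m + n" "j < m + n"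
  shows "x \<in> gl_zero m n \<Longrightarrow> (i < m) = (j < m)"
    and "x \<in> gl_up m n \<Longrightarrow> i < m \<and> \<not> j < m"
    and "x \<in> gl_low m n \<Longrightarrow> \<not> i < m \<and> j < m"
  using assms unfolding gl_par_def gl_up_def gl_low_def by (auto simp: not_less)

lemma mult_entry_zero:
  assumes "x \<in> gl m n" "y \<in> gl m n" "i < m + n" "j < m + n"
    and "\<And>k. k < m + n \<Longrightarrow> x $$ (i, k) = 0 \<or> y $$ (k, j) = 0"
  shows "(x * y) $$ (i, j) = 0"
  using assms by (auto simp: gl_mult_entry intro!: sum.neutral)

lemma graded_mult:
  "x \<in> gl_zero m n \<Longrightarrow> y \<in> gl_zero m n \<Longrightarrow> x * y \<in> gl_zero m n"
  "x \<in> gl_zero m n \<Longrightarrow> e \<in> gl_up m n \<Longrightarrow> x * e \<in> gl_up m n"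
  "x \<in> gl_zero m n \<Longrightarrow> e \<in> gl_up m n \<Longrightarrow> e * x \<in> gl_up m n"
  "x \<in> gl_zero m n \<Longrightarrow> f \<in> gl_low m n \<Longrightarrow> x * f \<in> gl_low m n"
  "x \<in> gl_zero m n \<Longrightarrow> f \<in> gl_low m n \<Longrightarrow> f * x \<in> gl_low m n"
  "e \<in> gl_up m n \<Longrightarrow> f \<in> gl_low m n \<Longrightarrow> e * f \<in> gl_zero m n"
  "e \<in> gl_up m n \<Longrightarrow> f \<in> gl_low m n \<Longrightarrow> f * e \<in> gl_zero m n"
  by (rule graded_memI; (rule mult_entry_zero[where m = m and n = n])?; (simp add: graded_in_gl; fail)?;
      rule ccontr; auto dest: graded_nonzero[where m = m and n = n])+

lemma up_mult_up:
  "e \<in> gl_up m n \<Longrightarrow> e' \<in> gl_up m n \<Longrightarrow> e * e' = 0\<^sub>m (m + n) (m + n)"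
proof (rule gl_eqI[where m = m and n = n])
  fix i j assume *: "i < m + n" "j < m + n" and mem: "e \<in> gl_up m n" "e' \<in> gl_up m n"
  have "(e * e') $$ (i, j) = 0"
    by (rule mult_entry_zero[where m = m and n = n])
       (use * mem in \<open>auto simp: graded_in_gl dest: graded_nonzero[where m = m and n = n]\<close>)
  then show "(e * e') $$ (i, j) = 0\<^sub>m (m + n) (m + n) $$ (i, j)" using * by simp
qed (auto simp: graded_in_gl)

lemma low_mult_low:
  "f \<in> gl_low m n \<Longrightarrow> f' \<in> gl_low m n \<Longrightarrow> f * f' = 0\<^sub>m (m + n) (m + n)"
proof (rule gl_eqI[where m = m and n = n])
  fix i j assume *: "i < m + n" "j < m + n" and mem: "f \<in> gl_low m n" "f' \<in> gl_low m n"
  have "(f * f') $$ (i, j) = 0"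
    by (rule mult_entry_zero[where m = m and n = n])
       (use * mem in \<open>auto simp: graded_in_gl dest: graded_nonzero[where m = m and n = n]\<close>)
  then show "(f * f') $$ (i, j) = 0\<^sub>m (m + n) (m + n) $$ (i, j)" using * by simp
qed (auto simp: graded_in_gl)

lemma bracket_in [simp]:
  "x \<in> gl_zero m n \<Longrightarrow> y \<in> gl_zero m n \<Longrightarrow> commutator x y \<in> gl_zero m n"
  "x \<in> gl_zero m n \<Longrightarrow> e \<in> gl_up m n \<Longrightarrow> commutator x e \<in> gl_up m n"
  "x \<in> gl_zero m n \<Longrightarrow> f \<in> gl_low m n \<Longrightarrow> commutator x f \<in> gl_low m n"
  "e \<in> gl_up m n \<Longrightarrow> f \<in> gl_low m n \<Longrightarrow> anticommutator e f \<in> gl_zero m n"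
  by (simp_all add: graded_mult)

lemma bracket_vanish [simp]:
  "e \<in> gl_up m n \<Longrightarrow> e' \<in> gl_up m n \<Longrightarrow> anticommutator e e' = 0\<^sub>m (m + n) (m + n)"
  "f \<in> gl_low m n \<Longrightarrow> f' \<in> gl_low m n \<Longrightarrow> anticommutator f f' = 0\<^sub>m (m + n) (m + n)"
  by (simp_all add: up_mult_up low_mult_low)

lemma anticommutator_commute: "x \<in> gl m n \<Longrightarrow> y \<in> gl m n \<Longrightarrow> anticommutator x y = anticommutator y x"
  by (rule comm_add_mat[where nr = "m + n" and nc = "m + n"]) (auto simp: gl_def)

lemma mult_closed:
  "a \<in> carrier_mat N N \<Longrightarrow> b \<in> carrier_mat N N \<Longrightarrow> a * b \<in> carrier_mat N N" for a b :: "complex mat"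
  by simp

context
  fixes N :: nat and x y z :: "complex mat"
  assumes carriers: "x \<in> carrier_mat N N" "y \<in> carrier_mat N N" "z \<in> carrier_mat N N"
begin

private lemmas distrib = carriers mult_closed minus_carrier_mat
  add_mult_distrib_mat[of _ N N _ _ N]
  mult_add_distrib_mat[of _ N N _ N]
  minus_mult_distrib_mat[of _ N N _ _ N]
  mult_minus_distrib_mat[of _ N N _ N]
  assoc_mult_mat[of _ N N _ N _ N]

lemma jacobi_zero_zero:
  "commutator (commutator x y) z = commutator x (commutator y z) - commutator y (commutator x z)"
  by (simp add: distrib, rule eq_matI) (use carriers in \<open>simp_all del: index_mult_mat(1)\<close>)

lemma jacobi_zero_odd:
  "anticommutator (commutator x y) z = commutator x (anticommutator y z) - anticommutator y (commutator x z)"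
  by (simp add: distrib, rule eq_matI) (use carriers in \<open>simp_all del: index_mult_mat(1)\<close>)

text \<open>Read with \<open>y\<close> of degree \<open>1\<close> and \<open>x\<close>, \<open>z\<close> of degree \<open>-1\<close>, where the right hand side vanishes, this says
  that the double bracket of \<open>y\<close> with \<open>x\<close> and \<open>z\<close> is antisymmetric; with the degrees exchanged it is
  the identity behind the anticommutation of two operators of degree \<open>1\<close>.\<close>

lemma jacobi_odd_odd:
  "commutator (anticommutator y x) z + commutator (anticommutator y z) x = commutator y (anticommutator x z)"
  by (simp add: distrib, rule eq_matI) (use carriers in \<open>simp_all del: index_mult_mat(1)\<close>)

end


lemma bracket_linear:
  assumes "x \<in> gl m n" "y \<in> gl m n" "z \<in> gl m n"
  shows "commutator (x + y) z = commutator x z + commutator y z"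
    and "commutator z (x + y) = commutator z x + commutator z y"
    and "commutator (x - y) z = commutator x z - commutator y z"
    and "anticommutator (x + y) z = anticommutator x z + anticommutator y z"
    and "anticommutator z (x + y) = anticommutator z x + anticommutator z y"
    and "commutator (c \<cdot>\<^sub>m x) z = c \<cdot>\<^sub>m commutator x z"
    and "commutator z (c \<cdot>\<^sub>m x) = c \<cdot>\<^sub>m commutator z x"
    and "anticommutator (c \<cdot>\<^sub>m x) z = c \<cdot>\<^sub>m anticommutator x z"
    and "anticommutator z (c \<cdot>\<^sub>m x) = c \<cdot>\<^sub>m anticommutator z x"
proof -
  note c = assms[THEN glD]
  note d = mult_closed[of _ "m + n"] minus_carrier_mat add_mult_distrib_mat[of _ "m + n" "m + n" _ _ "m + n"]
    mult_add_distrib_mat[of _ "m + n" "m + n" _ "m + n"]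
    minus_mult_distrib_mat[of _ "m + n" "m + n" _ _ "m + n"]
    mult_minus_distrib_mat[of _ "m + n" "m + n" _ "m + n"]
    mult_smult_distrib[of _ "m + n" "m + n" _ "m + n"]
    mult_smult_assoc_mat[of _ "m + n" "m + n" _ "m + n"]
  show "commutator (x + y) z = commutator x z + commutator y z"
    "commutator z (x + y) = commutator z x + commutator z y"
    "commutator (x - y) z = commutator x z - commutator y z"
    "anticommutator (x + y) z = anticommutator x z + anticommutator y z"
    "anticommutator z (x + y) = anticommutator z x + anticommutator z y"
    by (simp_all add: c d, (rule eq_matI, (use c in \<open>simp_all del: index_mult_mat(1)\<close>)[3])+)
  show "commutator (c \<cdot>\<^sub>m x) z = c \<cdot>\<^sub>m commutator x z"
    "commutator z (c \<cdot>\<^sub>m x) = c \<cdot>\<^sub>m commutator z x"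
    "anticommutator (c \<cdot>\<^sub>m x) z = c \<cdot>\<^sub>m anticommutator x z"
    "anticommutator z (c \<cdot>\<^sub>m x) = c \<cdot>\<^sub>m anticommutator z x"
    by (simp_all add: c d, (rule eq_matI, (use c in \<open>simp_all add: algebra_simps del: index_mult_mat(1)\<close>)[3])+)
qed

text \<open>The root vectors of degree \<open>-1\<close> are numbered column by column, and in each column from the bottom
  upwards.  In terms of the opposite, positive roots and read backwards, the numbering starts with the
  simple odd root, and every root comes after those from which it is obtained by adding a positive
  even root.\<close>

definition root_row :: "nat \<Rightarrow> nat \<Rightarrow> nat \<Rightarrow> nat" where
  "root_row m n k = m + n - 1 - k mod n"

definition root_col :: "nat \<Rightarrow> nat \<Rightarrow> nat" where
  "root_col n k = k div n"

definition lowering :: "nat \<Rightarrow> nat \<Rightarrow> nat \<Rightarrow> complex mat" where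
  "lowering m n k = mat (m + n) (m + n) (\<lambda>(i, j). if i = root_row m n k \<and> j = root_col n k then 1 else 0)"

definition raising :: "nat \<Rightarrow> nat \<Rightarrow> nat \<Rightarrow> complex mat" where
  "raising m n k = mat (m + n) (m + n) (\<lambda>(i, j). if i = root_col n k \<and> j = root_row m n k then 1 else 0)"

lemma root_bounds [simp]:
  assumes "k < m * n"
  shows "m \<le> root_row m n k" "root_row m n k < m + n" "root_col n k < m" "root_col n k < m + n"
proof -
  have n: "n > 0" using assms by (cases n) auto
  then have "k mod n < n" by simp
  then show "m \<le> root_row m n k" "root_row m n k < m + n" by (auto simp: root_row_def)
  show "root_col n k < m" using assms by (simp add: root_col_def less_mult_imp_div_less)
  then show "root_col n k < m + n" by simp
qed

lemma root_not_less [simp]: "k < m * n \<Longrightarrow> \<not> root_row m n k < m"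
  by (simp add: not_less)

lemma root_eq_iff:
  assumes "k < m * n" "l < m * n"
  shows "root_row m n k = root_row m n l \<and> root_col n k = root_col n l \<longleftrightarrow> k = l"
proof
  assume *: "root_row m n k = root_row m n l \<and> root_col n k = root_col n l"
  have n: "n > 0" using assms by (cases n) auto
  have "k mod n < n" "l mod n < n" using n by auto
  then have "k mod n = l mod n" using * unfolding root_row_def by linarith
  then show "k = l" using * by (metis root_col_def div_mult_mod_eq)
qed auto

lemma root_surj:
  assumes "m \<le> a" "a < m + n" "i < m"
  obtains k where "k < m * n" "root_row m n k = a" "root_col n k = i"
proof
  have lt: "m + n - 1 - a < n" using assms by auto
  have "i * n + (m + n - 1 - a) < i * n + n" using lt by simp
  also have "\<dots> = Suc i * n" by simp
  also have "\<dots> \<le> m * n" using assms by (intro mult_right_mono) auto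
  finally show "i * n + (m + n - 1 - a) < m * n" .
  have "(i * n + (m + n - 1 - a)) mod n = m + n - 1 - a"
    using lt by simp
  then show "root_row m n (i * n + (m + n - 1 - a)) = a"
    using assms unfolding root_row_def by linarith
  show "root_col n (i * n + (m + n - 1 - a)) = i"
    using lt unfolding root_col_def by simp
qed

lemma root_vectors_in [simp]:
  assumes "k < m * n"
  shows "lowering m n k \<in> gl_low m n" "raising m n k \<in> gl_up m n"
  using assms by (auto intro!: graded_memI simp: lowering_def raising_def gl_def split: if_splits)

lemma root_vectors_entry:
  assumes "i < m + n" "j < m + n"
  shows "lowering m n k $$ (i, j) = (if i = root_row m n k \<and> j = root_col n k then 1 else 0)"
    and "raising m n k $$ (i, j) = (if i = root_col n k \<and> j = root_row m n k then 1 else 0)"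
  using assms by (simp_all add: lowering_def raising_def)

lemma low_induct [consumes 1, case_names zero lowering add smult]:
  assumes y: "y \<in> gl_low m n"
    and zero: "P (0\<^sub>m (m + n) (m + n))"
    and low: "\<And>k. k < m * n \<Longrightarrow> P (lowering m n k)"
    and add: "\<And>x y. x \<in> gl_low m n \<Longrightarrow> y \<in> gl_low m n \<Longrightarrow> P x \<Longrightarrow> P y \<Longrightarrow> P (x + y)"
    and smult: "\<And>c x. x \<in> gl_low m n \<Longrightarrow> P x \<Longrightarrow> P (c \<cdot>\<^sub>m x)"
  shows "P y"
proof -
  \<comment> \<open>The part of \<open>y\<close> supported on the first \<open>k\<close> roots; the induction adds one root at a time.\<close>
  define trunc where "trunc k = mat (m + n) (m + n)
      (\<lambda>(i, j). if \<exists>p<k. i = root_row m n p \<and> j = root_col n p then y $$ (i, j) else 0)" for k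
  have "trunc k \<in> gl_low m n \<and> P (trunc k)" if "k \<le> m * n" for k
    using that
  proof (induction k)
    case 0
    have "trunc 0 = 0\<^sub>m (m + n) (m + n)" by (auto simp: trunc_def)
    then show ?case using zero by simp
  next
    case (Suc k)
    let ?c = "y $$ (root_row m n k, root_col n k)"
    have "trunc (Suc k) = trunc k + ?c \<cdot>\<^sub>m lowering m n k"
    proof (rule eq_matI)
      fix i j assume "i < dim_row (trunc k + ?c \<cdot>\<^sub>m lowering m n k)" "j < dim_col (trunc k + ?c \<cdot>\<^sub>m lowering m n k)"
      then have ij: "i < m + n" "j < m + n" by (auto simp: lowering_def)
      show "trunc (Suc k) $$ (i, j) = (trunc k + ?c \<cdot>\<^sub>m lowering m n k) $$ (i, j)"
      proof (cases "i = root_row m n k \<and> j = root_col n k")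
        case True
        then have "\<not> (\<exists>p<k. i = root_row m n p \<and> j = root_col n p)"
          using Suc.prems root_eq_iff[of _ m n k] by (metis Suc_le_eq less_irrefl less_trans)
        with True ij show ?thesis by (auto simp: trunc_def lowering_def)
      next
        case False
        with ij show ?thesis by (auto simp: trunc_def lowering_def less_Suc_eq)
      qed
    qed (auto simp: trunc_def lowering_def)
    then show ?case using Suc by (simp add: add smult low)
  qed
  moreover have "trunc (m * n) = y"
  proof (rule gl_eqI[where m = m and n = n])
    fix i j assume ij: "i < m + n" "j < m + n"
    show "trunc (m * n) $$ (i, j) = y $$ (i, j)"
    proof (cases "m \<le> i \<and> j < m")
      case True
      then obtain k where "k < m * n" "root_row m n k = i" "root_col n k = j"
        using root_surj ij by metis
      then show ?thesis using ij by (auto simp: trunc_def)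
    next
      case False
      then show ?thesis using ij y by (auto simp: trunc_def graded_entry[where m = m and n = n])
    qed
  qed (use y in \<open>auto simp: trunc_def gl_def dest: graded_in_gl\<close>)
  ultimately show ?thesis by auto
qed

lemma transpose_graded:
  "e \<in> gl_up m n \<Longrightarrow> transpose_mat e \<in> gl_low m n"
  "f \<in> gl_low m n \<Longrightarrow> transpose_mat f \<in> gl_up m n"
  unfolding gl_up_def gl_low_def gl_def by auto

lemma up_induct [consumes 1, case_names zero raising add smult]:
  assumes y: "y \<in> gl_up m n"
    and zero: "P (0\<^sub>m (m + n) (m + n))"
    and up: "\<And>k. k < m * n \<Longrightarrow> P (raising m n k)"
    and add: "\<And>x y. x \<in> gl_up m n \<Longrightarrow> y \<in> gl_up m n \<Longrightarrow> P x \<Longrightarrow> P y \<Longrightarrow> P (x + y)"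
    and smult: "\<And>c x. x \<in> gl_up m n \<Longrightarrow> P x \<Longrightarrow> P (c \<cdot>\<^sub>m x)"
  shows "P y"
proof -
  have "P (transpose_mat f)" if "f \<in> gl_low m n" for f
    using that
  proof (induction rule: low_induct)
    case zero
    then show ?case using assms(2) by simp
  next
    case (lowering k)
    have "transpose_mat (lowering m n k) = raising m n k"
      by (rule eq_matI) (auto simp: lowering_def raising_def)
    then show ?case using up lowering by simp
  next
    case (add x y)
    have "transpose_mat (x + y) = transpose_mat x + transpose_mat y"
      using add by (intro transpose_add[where nr = "m + n" and nc = "m + n"]) (auto simp: gl_def dest!: graded_in_gl)
    then show ?case using assms(4) add transpose_graded by simp
  next
    case (smult c x)
    have "transpose_mat (c \<cdot>\<^sub>m x) = c \<cdot>\<^sub>m transpose_mat x" by (rule eq_matI) auto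
    then show ?case using assms(5) smult transpose_graded by simp
  qed
  from this[of "transpose_mat y"] show ?thesis using y transpose_graded by simp
qed

section \<open>Creation and annihilation operators for the superalgebra\<close>

definition fock_scale :: "(complex \<Rightarrow> 'v \<Rightarrow> 'v) \<Rightarrow> complex \<Rightarrow> (nat set \<Rightarrow> 'v) \<Rightarrow> nat set \<Rightarrow> 'v" where
  "fock_scale scale c F = (\<lambda>S. scale c (F S))"

definition fock_lift :: "('v \<Rightarrow> 'v) \<Rightarrow> (nat set \<Rightarrow> 'v) \<Rightarrow> nat set \<Rightarrow> 'v" where
  "fock_lift t F = (\<lambda>S. t (F S))"

context gl_zero_irrep
begin

abbreviation "N \<equiv> m * n"
abbreviation fscale :: "complex \<Rightarrow> (nat set \<Rightarrow> 'v) \<Rightarrow> nat set \<Rightarrow> 'v" where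
  "fscale \<equiv> fock_scale scale"
abbreviation f_vec :: "nat \<Rightarrow> complex mat" where "f_vec \<equiv> lowering m n"
abbreviation e_vec :: "nat \<Rightarrow> complex mat" where "e_vec \<equiv> raising m n"

lemma fock_vector_space: "vector_space fscale"
  by standard (auto simp: fock_scale_def fun_eq_iff pointwise scale_right_distrib scale_left_distrib)

sublocale fock: vector_space "fock_scale scale"
  by (rule fock_vector_space)

definition low_op :: "complex mat \<Rightarrow> (nat set \<Rightarrow> 'v) \<Rightarrow> nat set \<Rightarrow> 'v" where
  "low_op y F = (\<Sum>p<N. fscale (y $$ (root_row m n p, root_col n p)) (creation p F))"

text \<open>A matrix of degree \<open>0\<close> acts on \<open>L\<^sup>0(\<Lambda>)\<close>, and as a derivation on the exterior algebra.\<close>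

definition zero_op :: "complex mat \<Rightarrow> (nat set \<Rightarrow> 'v) \<Rightarrow> nat set \<Rightarrow> 'v" where
  "zero_op x F = fock_lift (\<rho> x) F + (\<Sum>p<N. low_op (commutator x (f_vec p)) (annihilation p F))"

text \<open>The vacuum is annihilated by degree \<open>1\<close>, which forces the formula: passing \<open>e\<close> through the generator
  \<open>p\<close> leaves the bracket of \<open>e\<close> with \<open>f\<^sub>p\<close>, of degree \<open>0\<close>, which acts on \<open>L\<^sup>0(\<Lambda>)\<close> and as a derivation
  on the remaining generators.  The second sum runs over ordered pairs, but its summands are
  symmetric, whence the factor \<open>1/2\<close>.\<close>

definition up_op :: "complex mat \<Rightarrow> (nat set \<Rightarrow> 'v) \<Rightarrow> nat set \<Rightarrow> 'v" where
  "up_op e F = (\<Sum>p<N. fock_lift (\<rho> (anticommutator e (f_vec p))) (annihilation p F))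
     + fscale (1/2) (\<Sum>p<N. \<Sum>q<N.
         low_op (commutator (anticommutator e (f_vec q)) (f_vec p)) (annihilation p (annihilation q F)))"

lemma rep_linear:
  assumes "x \<in> gl_zero m n"
  shows "\<rho> x 0 = 0" "\<rho> x (v + w) = \<rho> x v + \<rho> x w" "\<rho> x (- v) = - \<rho> x v"
    "\<rho> x (v - w) = \<rho> x v - \<rho> x w" "\<rho> x (scale c v) = scale c (\<rho> x v)"
proof -
  interpret l: Vector_Spaces.linear scale scale "\<rho> x" by (rule linear_rep[OF assms])
  show "\<rho> x 0 = 0" "\<rho> x (v + w) = \<rho> x v + \<rho> x w" "\<rho> x (- v) = - \<rho> x v"
    "\<rho> x (v - w) = \<rho> x v - \<rho> x w" "\<rho> x (scale c v) = scale c (\<rho> x v)"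
    by (fact l.zero l.add l.neg l.diff l.scale)+
qed

lemma rep_zero: "\<rho> (0\<^sub>m (m + n) (m + n)) v = 0"
  using rep_smult[of "0\<^sub>m (m + n) (m + n)" 0 v] by (simp add: smult_zero_mat)

lemma rep_diff:
  assumes "x \<in> gl_zero m n" "y \<in> gl_zero m n"
  shows "\<rho> (x - y) v = \<rho> x v - \<rho> y v"
proof -
  have "x = (x - y) + y" 
    by (rule gl_eqI[where m = m and n = n]) (use assms in \<open>auto simp: graded_in_gl gl_entry[where m = m and n = n]\<close>)
  then have "\<rho> x v = \<rho> (x - y) v + \<rho> y v"
    using rep_add[of "x - y" y v] assms by simp
  then show ?thesis by simp
qed

lemma fock_lift_additive:
  assumes "x \<in> gl_zero m n"
  shows "fock_lift (\<rho> x) 0 = 0" "fock_lift (\<rho> x) (F + G) = fock_lift (\<rho> x) F + fock_lift (\<rho> x) G"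
    "fock_lift (\<rho> x) (- F) = - fock_lift (\<rho> x) F"
    "fock_lift (\<rho> x) (F - G) = fock_lift (\<rho> x) F - fock_lift (\<rho> x) G"
    "fock_lift (\<rho> x) (fscale c F) = fscale c (fock_lift (\<rho> x) F)"
    "fock_lift (\<rho> x) (sum H A) = (\<Sum>a\<in>A. fock_lift (\<rho> x) (H a))"
proof -
  show z: "fock_lift (\<rho> x) 0 = 0" and
   a: "fock_lift (\<rho> x) (F + G) = fock_lift (\<rho> x) F + fock_lift (\<rho> x) G" for F G
    using assms by (auto simp: fock_lift_def fun_eq_iff pointwise rep_linear)
  show "fock_lift (\<rho> x) (- F) = - fock_lift (\<rho> x) F"
    "fock_lift (\<rho> x) (F - G) = fock_lift (\<rho> x) F - fock_lift (\<rho> x) G"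
    "fock_lift (\<rho> x) (fscale c F) = fscale c (fock_lift (\<rho> x) F)"
    using assms by (auto simp: fock_lift_def fock_scale_def fun_eq_iff pointwise rep_linear)
  show "fock_lift (\<rho> x) (sum H A) = (\<Sum>a\<in>A. fock_lift (\<rho> x) (H a))"
    using sum_comp_morphism[of "fock_lift (\<rho> x)" H A] z a by (simp add: o_def)
qed

lemma fock_lift_creation:
  assumes "x \<in> gl_zero m n"
  shows "fock_lift (\<rho> x) (creation p F) = creation p (fock_lift (\<rho> x) F)"
    "fock_lift (\<rho> x) (annihilation p F) = annihilation p (fock_lift (\<rho> x) F)"
  using assms by (auto simp: fock_lift_def creation_def annihilation_def order_sign_def rep_linear)

lemma fscale_creation [simp]:
  "creation p (fscale c F) = fscale c (creation p F)"
  "annihilation p (fscale c F) = fscale c (annihilation p F)"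
  by (auto simp: fock_scale_def creation_def annihilation_def order_sign_def fun_eq_iff)

lemma fscale_in_fock [simp]: "F \<in> fock K \<Longrightarrow> fscale c F \<in> fock K"
  by (auto simp: fock_def fock_scale_def)

lemma fock_lift_in_fock [simp]: "x \<in> gl_zero m n \<Longrightarrow> F \<in> fock K \<Longrightarrow> fock_lift (\<rho> x) F \<in> fock K"
  by (auto simp: fock_def fock_lift_def rep_linear)

lemma basis_vec_lift:
  "x \<in> gl_zero m n \<Longrightarrow> fock_lift (\<rho> x) (basis_vec S v) = basis_vec S (\<rho> x v)"
  "fscale c (basis_vec S v) = basis_vec S (scale c v)"
  by (auto simp: fock_lift_def fock_scale_def basis_vec_def rep_linear)

lemma low_op_linear [simp]:
  "low_op y 0 = 0"
  "low_op y (- F) = - low_op y F"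
  "low_op y (F + G) = low_op y F + low_op y G"
  "low_op y (F - G) = low_op y F - low_op y G"
  "low_op y (fscale c F) = fscale c (low_op y F)"
  by (simp_all add: low_op_def sum.distrib sum_subtractf sum_negf fock.scale_sum_right
      fock.scale_right_distrib fock.scale_right_diff_distrib mult.commute)

lemma low_op_sum: "low_op y (sum F A) = (\<Sum>a\<in>A. low_op y (F a))"
  using sum_comp_morphism[of "low_op y" F A] by (simp add: o_def)

lemma low_op_matrix:
  assumes "x \<in> gl m n"
  shows "y \<in> gl m n \<Longrightarrow> low_op (x + y) F = low_op x F + low_op y F"
    "y \<in> gl m n \<Longrightarrow> low_op (x - y) F = low_op x F - low_op y F"
    "low_op (c \<cdot>\<^sub>m x) F = fscale c (low_op x F)"
  using assms by (simp_all add: low_op_def gl_entry[where m = m and n = n] gl_smult_entry[where m = m and n = n]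
      sum.distrib sum_subtractf fock.scale_sum_right fock.scale_left_distrib fock.scale_left_diff_distrib)

lemma low_op_zero [simp]: "low_op (0\<^sub>m (m + n) (m + n)) F = 0"
  by (simp add: low_op_def)

lemma low_op_f_vec [simp]:
  assumes "q < N"
  shows "low_op (f_vec q) F = creation q F"
proof -
  have "low_op (f_vec q) F = (\<Sum>p<N. if p = q then creation p F else 0)"
    unfolding low_op_def
    by (rule sum.cong) (use assms root_eq_iff[of _ m n q] in \<open>auto simp: root_vectors_entry\<close>)
  then show ?thesis using assms by simp
qed

lemma low_op_creation: "low_op y (creation q F) = - creation q (low_op y F)"
  unfolding low_op_def creation_sum sum_negf[symmetric]
  by (rule sum.cong) (simp_all add: creation_creation[of _ q])

lemma zero_op_linear:
  assumes "x \<in> gl_zero m n"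
  shows "zero_op x 0 = 0"
  "zero_op x (F + G) = zero_op x F + zero_op x G"
  "zero_op x (fscale c F) = fscale c (zero_op x F)"
  using assms by (simp_all add: zero_op_def fock_lift_additive sum.distrib fock.scale_sum_right
      fock.scale_right_distrib)

lemma up_op_linear:
  assumes "e \<in> gl_up m n"
  shows "up_op e 0 = 0"
  "up_op e (F + G) = up_op e F + up_op e G"
  "up_op e (fscale c F) = fscale c (up_op e F)"
proof -
  have *: "p < N \<Longrightarrow> anticommutator e (f_vec p) \<in> gl_zero m n" for p
    using assms by simp
  show "up_op e 0 = 0"
    unfolding up_op_def by (simp add: fock_lift_additive *)
  show "up_op e (F + G) = up_op e F + up_op e G"
    unfolding up_op_def by (simp add: fock_lift_additive * sum.distrib fock.scale_right_distrib)
  show "up_op e (fscale c F) = fscale c (up_op e F)"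
    unfolding up_op_def
    by (simp add: fock_lift_additive * fock.scale_right_distrib mult.commute[of c] flip: fock.scale_sum_right)
qed

lemma zero_op_matrix:
  assumes "x \<in> gl_zero m n"
  shows "y \<in> gl_zero m n \<Longrightarrow> zero_op (x + y) F = zero_op x F + zero_op y F"
    "y \<in> gl_zero m n \<Longrightarrow> zero_op (x - y) F = zero_op x F - zero_op y F"
    "zero_op (c \<cdot>\<^sub>m x) F = fscale c (zero_op x F)"
proof -
  have f: "p < N \<Longrightarrow> f_vec p \<in> gl m n" for p by (simp add: graded_in_gl)
  have R: "fock_lift (\<rho> (x + y)) F = fock_lift (\<rho> x) F + fock_lift (\<rho> y) F"
     "fock_lift (\<rho> (x - y)) F = fock_lift (\<rho> x) F - fock_lift (\<rho> y) F" if "y \<in> gl_zero m n"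
    using assms that by (auto simp: fock_lift_def fun_eq_iff pointwise rep_add rep_diff)
  have S: "fock_lift (\<rho> (c \<cdot>\<^sub>m x)) F = fscale c (fock_lift (\<rho> x) F)"
    using assms by (auto simp: fock_lift_def fock_scale_def rep_smult)
  have g: "x \<in> gl m n" "y \<in> gl_zero m n \<Longrightarrow> y \<in> gl m n" using assms by (auto simp: graded_in_gl)
  show "zero_op (x + y) F = zero_op x F + zero_op y F" if "y \<in> gl_zero m n"
    using g that f by (simp add: zero_op_def R bracket_linear[where m = m and n = n] low_op_matrix sum.distrib)
  show "zero_op (x - y) F = zero_op x F - zero_op y F" if "y \<in> gl_zero m n"
    using g that f by (simp add: zero_op_def R bracket_linear[where m = m and n = n] low_op_matrix sum_subtractf)
  show "zero_op (c \<cdot>\<^sub>m x) F = fscale c (zero_op x F)"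
    using g f by (simp add: zero_op_def S bracket_linear[where m = m and n = n] low_op_matrix fock.scale_right_distrib fock.scale_sum_right)
qed

lemma zero_op_zero [simp]: "zero_op (0\<^sub>m (m + n) (m + n)) F = 0"
  using zero_op_matrix(3)[of "0\<^sub>m (m + n) (m + n)" 0 F] by (simp add: smult_zero_mat)

lemma up_op_matrix:
  assumes "e \<in> gl_up m n"
  shows "e' \<in> gl_up m n \<Longrightarrow> up_op (e + e') F = up_op e F + up_op e' F"
    "up_op (c \<cdot>\<^sub>m e) F = fscale c (up_op e F)"
proof -
  have f: "p < N \<Longrightarrow> f_vec p \<in> gl m n" for p by (simp add: graded_in_gl)
  have g: "e \<in> gl m n" "e' \<in> gl_up m n \<Longrightarrow> e' \<in> gl m n" using assms by (auto simp: graded_in_gl)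
  have R: "fock_lift (\<rho> (x + y)) F = fock_lift (\<rho> x) F + fock_lift (\<rho> y) F"
    if "x \<in> gl_zero m n" "y \<in> gl_zero m n" for x y F
    using that by (auto simp: fock_lift_def fun_eq_iff pointwise rep_add)
  have S: "fock_lift (\<rho> (c \<cdot>\<^sub>m x)) F = fscale c (fock_lift (\<rho> x) F)" if "x \<in> gl_zero m n" for x F
    using that by (auto simp: fock_lift_def fock_scale_def rep_smult)
  show "up_op (e + e') F = up_op e F + up_op e' F" if "e' \<in> gl_up m n"
    using g that f assms
    by (simp add: up_op_def R bracket_linear[where m = m and n = n] low_op_matrix sum.distrib fock.scale_right_distrib)
  show "up_op (c \<cdot>\<^sub>m e) F = fscale c (up_op e F)"
    using g f assms
    by (simp add: up_op_def S bracket_linear(6,8)[where m = m and n = n] low_op_matrix fock.scale_right_distrib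
       mult.commute[of c] flip: fock.scale_sum_right)
qed

lemma up_op_zero [simp]: "up_op (0\<^sub>m (m + n) (m + n)) F = 0"
  using up_op_matrix(2)[of "0\<^sub>m (m + n) (m + n)" 0 F] graded_memI(2)[of "0\<^sub>m (m + n) (m + n)" m n] by (simp add: smult_zero_mat)

lemma zero_op_diff: "x \<in> gl_zero m n \<Longrightarrow> zero_op x (F - G) = zero_op x F - zero_op x G"
  by (metis add_diff_cancel diff_add_cancel zero_op_linear(2))

lemma up_op_diff: "e \<in> gl_up m n \<Longrightarrow> up_op e (F - G) = up_op e F - up_op e G"
  by (metis add_diff_cancel diff_add_cancel up_op_linear(2))

lemma low_op_in_fock [simp]: "F \<in> fock N \<Longrightarrow> low_op y F \<in> fock N"
  unfolding low_op_def by (intro fock_sum) auto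

lemma zero_op_in_fock [simp]: "x \<in> gl_zero m n \<Longrightarrow> F \<in> fock N \<Longrightarrow> zero_op x F \<in> fock N"
  unfolding zero_op_def by (intro fock_closed fock_sum) auto

lemma up_op_in_fock [simp]: "e \<in> gl_up m n \<Longrightarrow> F \<in> fock N \<Longrightarrow> up_op e F \<in> fock N"
  unfolding up_op_def by (intro fock_closed fock_sum fscale_in_fock) auto

lemma zero_op_creation:
  assumes "x \<in> gl_zero m n" "q < N"
  shows "zero_op x (creation q F) = creation q (zero_op x F) + low_op (commutator x (f_vec q)) F"
proof -
  have "(\<Sum>p<N. low_op (commutator x (f_vec p)) (annihilation p (creation q F)))
     = (\<Sum>p<N. (if p = q then low_op (commutator x (f_vec p)) F else 0)
        + creation q (low_op (commutator x (f_vec p)) (annihilation p F)))"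
    by (rule sum.cong) (auto simp: annihilation_creation low_op_creation)
  also have "\<dots> = low_op (commutator x (f_vec q)) F
      + creation q (\<Sum>p<N. low_op (commutator x (f_vec p)) (annihilation p F))"
    using assms by (simp add: sum.distrib creation_sum)
  finally show ?thesis
    using assms by (simp add: zero_op_def fock_lift_creation algebra_simps)
qed

text \<open>The \<open>f\<^sub>p\<close> anticommute, hence so do the double brackets of \<open>e\<close> with them.\<close>

lemma bracket_f_f_antisym:
  assumes "e \<in> gl_up m n" "p < N" "q < N"
  shows "low_op (commutator (anticommutator e (f_vec q)) (f_vec p)) F
    = - low_op (commutator (anticommutator e (f_vec p)) (f_vec q)) F"
proof -
  let ?B = "\<lambda>p q. commutator (anticommutator e (f_vec q)) (f_vec p)"
  have e: "e \<in> carrier_mat (m + n) (m + n)" using assms by (auto dest: graded_in_gl)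
  have f: "f_vec r \<in> carrier_mat (m + n) (m + n)" for r by (simp add: lowering_def)
  have "?B p q + ?B q p = commutator e (anticommutator (f_vec q) (f_vec p))"
    by (rule jacobi_odd_odd[where N = "m + n"]) (use e f in auto)
  also have "\<dots> = 0\<^sub>m (m + n) (m + n)"
    using assms right_mult_zero_mat[OF e, of "m + n"] left_mult_zero_mat[OF e, of "m + n"]
    by (simp add: bracket_vanish[where m = m and n = n])
  finally have "low_op (?B p q + ?B q p) F = 0" by simp
  moreover have "?B p q \<in> gl m n" "?B q p \<in> gl m n"
    using assms by (auto intro!: graded_in_gl(3) bracket_in)
  ultimately show ?thesis by (simp add: low_op_matrix eq_neg_iff_add_eq_0)
qed

text \<open>The bracket of the quadratic term with the generator \<open>q\<close> contributes twice the same sum, once for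
  either annihilation operator, because both the double brackets and the annihilation operators
  change sign under an exchange.\<close>

lemma up_op_creation:
  assumes e: "e \<in> gl_up m n" and q: "q < N"
  shows "up_op e (creation q F) = zero_op (anticommutator e (f_vec q)) F - creation q (up_op e F)"
proof -
  let ?A = "\<lambda>p. anticommutator e (f_vec p)"
  let ?B = "\<lambda>p r. commutator (anticommutator e (f_vec r)) (f_vec p)"
  have A: "p < N \<Longrightarrow> ?A p \<in> gl_zero m n" for p using e by simp
  have 1: "(\<Sum>p<N. fock_lift (\<rho> (?A p)) (annihilation p (creation q F)))
     = fock_lift (\<rho> (?A q)) F - creation q (\<Sum>p<N. fock_lift (\<rho> (?A p)) (annihilation p F))"
  proof -
    have "(\<Sum>p<N. fock_lift (\<rho> (?A p)) (annihilation p (creation q F)))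
      = (\<Sum>p<N. (if p = q then fock_lift (\<rho> (?A p)) F else 0)
           - creation q (fock_lift (\<rho> (?A p)) (annihilation p F)))"
      by (rule sum.cong) (auto simp: annihilation_creation A fock_lift_additive fock_lift_creation)
    then show ?thesis using q by (simp add: sum_subtractf creation_sum)
  qed
  let ?Z = "\<Sum>p<N. low_op (?B p q) (annihilation p F)"
  have inner: "(\<Sum>r<N. low_op (?B p r) (annihilation p (annihilation r (creation q F))))
     = low_op (?B p q) (annihilation p F)
      - (if p = q then \<Sum>r<N. low_op (?B p r) (annihilation r F) else 0)
      - creation q (\<Sum>r<N. low_op (?B p r) (annihilation p (annihilation r F)))" for p
  proof -
    have "(\<Sum>r<N. low_op (?B p r) (annihilation p (annihilation r (creation q F))))
      = (\<Sum>r<N. (if r = q then low_op (?B p r) (annihilation p F) else 0)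
         - (if p = q then low_op (?B p r) (annihilation r F) else 0)
         - creation q (low_op (?B p r) (annihilation p (annihilation r F))))"
      by (rule sum.cong) (auto simp: annihilation_creation low_op_creation)
    then show ?thesis using q by (simp add: sum_subtractf creation_sum)
  qed
  have "(\<Sum>p<N. \<Sum>r<N. low_op (?B p r) (annihilation p (annihilation r (creation q F))))
     = ?Z - (\<Sum>r<N. low_op (?B q r) (annihilation r F))
      - creation q (\<Sum>p<N. \<Sum>r<N. low_op (?B p r) (annihilation p (annihilation r F)))"
    unfolding inner using q by (simp add: sum_subtractf creation_sum)
  also have "(\<Sum>r<N. low_op (?B q r) (annihilation r F)) = - ?Z"
    unfolding sum_negf[symmetric]
    by (rule sum.cong[OF refl], rule bracket_f_f_antisym[OF e]) (use q in simp_all)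
  finally have sum2: "(\<Sum>p<N. \<Sum>r<N. low_op (?B p r) (annihilation p (annihilation r (creation q F))))
     = ?Z - (- ?Z) - creation q (\<Sum>p<N. \<Sum>r<N. low_op (?B p r) (annihilation p (annihilation r F)))" .
  \<comment> \<open>The two equal contributions cancel the factor \<open>1/2\<close>.\<close>
  have half: "fscale (1/2) (Z - (- Z) - X) = Z - fscale (1/2) X" for Z X
    using fock.scale_left_distrib[of "1/2" "1/2" Z]
    by (simp add: fock.scale_right_diff_distrib fock.scale_right_distrib)
  have 2: "fscale (1/2) (\<Sum>p<N. \<Sum>r<N. low_op (?B p r) (annihilation p (annihilation r (creation q F))))
     = ?Z - creation q (fscale (1/2) (\<Sum>p<N. \<Sum>r<N. low_op (?B p r) (annihilation p (annihilation r F))))"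
    unfolding sum2 half fscale_creation ..
  have regroup: "a - c + (Z - d) = a + Z - (c + d)" for a c Z d :: "nat set \<Rightarrow> 'v"
    by simp
  show ?thesis
    unfolding up_op_def 1 2 zero_op_def creation_additive regroup ..
qed

end

section \<open>The bracket relations\<close>

context gl_zero_irrep
begin

lemma f_vec_in [simp]: "p < N \<Longrightarrow> f_vec p \<in> gl m n"
  by (simp add: graded_in_gl)

lemma low_op_low_op: "low_op y (low_op y' F) = - low_op y' (low_op y F)"
proof -
  have "low_op y (low_op y' F) = (\<Sum>p<N. low_op y (fscale (y' $$ (root_row m n p, root_col n p)) (creation p F)))"
    unfolding low_op_def[of y'] low_op_sum ..
  also have "\<dots> = - low_op y' (low_op y F)"
    unfolding low_op_def[of y'] low_op_linear low_op_creation by (simp add: sum_negf)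
  finally show ?thesis .
qed

lemma zero_op_low_op:
  assumes x: "x \<in> gl_zero m n" and y: "y \<in> gl_low m n"
  shows "zero_op x (low_op y F) = low_op y (zero_op x F) + low_op (commutator x y) F"
  using y
proof (induction rule: low_induct)
  case zero
  have "x \<in> carrier_mat (m + n) (m + n)" using x by (auto dest: graded_in_gl)
  then have "commutator x (0\<^sub>m (m + n) (m + n)) = 0\<^sub>m (m + n) (m + n)"
    by simp
  then show ?case using x by (simp add: zero_op_linear)
next
  case (lowering k)
  then show ?case using x by (simp add: zero_op_creation)
next
  case (add y z)
  then have g: "x \<in> gl m n" "y \<in> gl m n" "z \<in> gl m n" using x by (auto intro: graded_in_gl)
  then have "commutator x y \<in> gl m n" "commutator x z \<in> gl m n" by simp_all
  then show ?case using add g x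
    by (simp add: bracket_linear(2)[where m = m and n = n] low_op_matrix(1) zero_op_linear)
next
  case (smult c y)
  then have g: "x \<in> gl m n" "y \<in> gl m n" using x by (auto intro: graded_in_gl)
  then have "commutator x y \<in> gl m n" by simp
  then show ?case using smult g x
    by (simp add: bracket_linear(7)[where m = m and n = n] low_op_matrix(3) zero_op_linear fock.scale_right_distrib)
qed

lemma up_op_low_op:
  assumes x: "e \<in> gl_up m n" and y: "y \<in> gl_low m n"
  shows "up_op e (low_op y F) = zero_op (anticommutator e y) F - low_op y (up_op e F)"
  using y
proof (induction rule: low_induct)
  case zero
  have "e \<in> carrier_mat (m + n) (m + n)" using x by (auto dest: graded_in_gl)
  then have "anticommutator e (0\<^sub>m (m + n) (m + n)) = 0\<^sub>m (m + n) (m + n)"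
    by simp
  then show ?case using x by (simp add: up_op_linear)
next
  case (lowering k)
  then show ?case using x by (simp add: up_op_creation)
next
  case (add y z)
  then have g: "e \<in> gl m n" "y \<in> gl m n" "z \<in> gl m n" using x by (auto intro: graded_in_gl)
  have "anticommutator e y \<in> gl_zero m n" "anticommutator e z \<in> gl_zero m n" using x add by simp_all
  then show ?case using add g x
    by (simp add: bracket_linear(5)[where m = m and n = n] low_op_matrix(1) zero_op_matrix(1) up_op_linear)
next
  case (smult c y)
  then have g: "e \<in> gl m n" "y \<in> gl m n" using x by (auto intro: graded_in_gl)
  have "anticommutator e y \<in> gl_zero m n" using x smult by simp
  then show ?case using smult g x
    by (simp add: bracket_linear(9)[where m = m and n = n] low_op_matrix(3) zero_op_matrix(3) up_op_linear fock.scale_right_diff_distrib)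
qed

lemma annihilation_vacuum [simp]: "annihilation p (basis_vec {} v) = 0"
  by (simp add: annihilation_basis_vec)

lemma zero_op_vacuum: "x \<in> gl_zero m n \<Longrightarrow> zero_op x (basis_vec {} v) = basis_vec {} (\<rho> x v)"
  by (simp add: zero_op_def basis_vec_lift)

lemma up_op_vacuum: "e \<in> gl_up m n \<Longrightarrow> up_op e (basis_vec {} v) = 0"
  by (simp add: up_op_def fock_lift_additive)

text \<open>Both sides agree on the vacuum, and by the Jacobi identity their brackets with every creation
  operator agree.  The two lemmas after this one are proved in the same way.\<close>

lemma zero_op_zero_op:
  assumes x: "x \<in> gl_zero m n" and y: "y \<in> gl_zero m n" and F: "F \<in> fock N"
  shows "zero_op x (zero_op y F) - zero_op y (zero_op x F) = zero_op (commutator x y) F"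
  using F
proof (induction rule: fock_induct)
  case (vacuum v)
  then show ?case using x y by (simp add: zero_op_vacuum rep_bracket flip: basis_vec_additive)
next
  case (add F G)
  then show ?case using x y by (simp add: zero_op_linear add_diff_add)
next
  case (creation p F)
  let ?f = "f_vec p"
  have c: "x \<in> carrier_mat (m + n) (m + n)" "y \<in> carrier_mat (m + n) (m + n)" "?f \<in> carrier_mat (m + n) (m + n)"
    using x y by (auto dest: graded_in_gl simp: lowering_def)
  have low: "commutator x ?f \<in> gl_low m n" "commutator y ?f \<in> gl_low m n" using x y creation by simp_all
  have "zero_op x (zero_op y (creation p F)) = creation p (zero_op x (zero_op y F)) + low_op (commutator x ?f) (zero_op y F)
     + low_op (commutator y ?f) (zero_op x F) + low_op (commutator x (commutator y ?f)) F"
    using x y creation low by (simp add: zero_op_creation zero_op_linear zero_op_low_op)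
  moreover have "zero_op y (zero_op x (creation p F)) = creation p (zero_op y (zero_op x F)) + low_op (commutator y ?f) (zero_op x F)
     + low_op (commutator x ?f) (zero_op y F) + low_op (commutator y (commutator x ?f)) F"
    using x y creation low by (simp add: zero_op_creation zero_op_linear zero_op_low_op)
  moreover have "low_op (commutator (commutator x y) ?f) F
      = low_op (commutator x (commutator y ?f)) F - low_op (commutator y (commutator x ?f)) F"
    unfolding jacobi_zero_zero[OF c] using x y low
    by (intro low_op_matrix(2)) (auto intro!: graded_in_gl(3) bracket_in)
  moreover have "zero_op (commutator x y) (creation p F) = creation p (zero_op (commutator x y) F)
      + low_op (commutator (commutator x y) ?f) F"
    using x y creation by (intro zero_op_creation) auto
  ultimately show ?case
    unfolding creation.IH[symmetric] creation_additive by (simp only:) (simp add: algebra_simps del: minus_apply)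
qed

lemma zero_op_up_op:
  assumes x: "x \<in> gl_zero m n" and e: "e \<in> gl_up m n" and F: "F \<in> fock N"
  shows "zero_op x (up_op e F) - up_op e (zero_op x F) = up_op (commutator x e) F"
  using F
proof (induction rule: fock_induct)
  case (vacuum v)
  then show ?case using x e by (simp add: zero_op_vacuum up_op_vacuum zero_op_linear)
next
  case (add F G)
  then show ?case using x e by (simp add: zero_op_linear up_op_linear add_diff_add)
next
  case (creation p F)
  let ?f = "f_vec p"
  have c: "x \<in> carrier_mat (m + n) (m + n)" "e \<in> carrier_mat (m + n) (m + n)" "?f \<in> carrier_mat (m + n) (m + n)"
    using x e by (auto dest: graded_in_gl simp: lowering_def)
  have low: "commutator x ?f \<in> gl_low m n" "anticommutator e ?f \<in> gl_zero m n"
    "anticommutator e (commutator x ?f) \<in> gl_zero m n" "commutator x (anticommutator e ?f) \<in> gl_zero m n"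
    using x e creation by simp_all
  have 1: "zero_op x (up_op e (creation p F)) = zero_op x (zero_op (anticommutator e ?f) F)
     - (creation p (zero_op x (up_op e F)) + low_op (commutator x ?f) (up_op e F))"
    using x e creation low by (simp add: zero_op_creation up_op_creation zero_op_diff)
  have 2: "up_op e (zero_op x (creation p F)) = zero_op (anticommutator e ?f) (zero_op x F)
     - creation p (up_op e (zero_op x F)) + (zero_op (anticommutator e (commutator x ?f)) F - low_op (commutator x ?f) (up_op e F))"
    using x e creation low by (simp add: zero_op_creation up_op_creation up_op_linear up_op_low_op)
  have 3: "zero_op x (zero_op (anticommutator e ?f) F) - zero_op (anticommutator e ?f) (zero_op x F)
     = zero_op (commutator x (anticommutator e ?f)) F"
    using x low creation by (intro zero_op_zero_op) auto
  have 4: "zero_op (anticommutator (commutator x e) ?f) F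
      = zero_op (commutator x (anticommutator e ?f)) F - zero_op (anticommutator e (commutator x ?f)) F"
    unfolding jacobi_zero_odd[OF c] using low by (intro zero_op_matrix(2)) auto
  have 5: "up_op (commutator x e) (creation p F) = zero_op (anticommutator (commutator x e) ?f) F
      - creation p (up_op (commutator x e) F)"
    using x e creation by (intro up_op_creation) auto
  have regroup: "P - (c + l) - (Q - d + (R - l)) = (P - Q) - R - (c - d)" for P Q R c d l :: "nat set \<Rightarrow> 'v"
    by simp
  show ?case
    unfolding 1 2 5 4 regroup 3 creation.IH[symmetric] creation_additive ..
qed

lemma up_op_up_op:
  assumes e: "e \<in> gl_up m n" and e': "e' \<in> gl_up m n" and F: "F \<in> fock N"
  shows "up_op e (up_op e' F) = - up_op e' (up_op e F)"
proof -
  have "up_op e (up_op e' F) + up_op e' (up_op e F) = 0"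
    using F
  proof (induction rule: fock_induct)
    case (vacuum v)
    then show ?case using e e' by (simp add: up_op_vacuum up_op_linear)
  next
    case (add F G)
    then have "(up_op e (up_op e' F) + up_op e' (up_op e F)) + (up_op e (up_op e' G) + up_op e' (up_op e G)) = 0"
      by simp
    then show ?case using e e' by (simp add: up_op_linear algebra_simps)
  next
    case (creation p F)
    let ?f = "f_vec p"
    have c: "e \<in> carrier_mat (m + n) (m + n)" "e' \<in> carrier_mat (m + n) (m + n)" "?f \<in> carrier_mat (m + n) (m + n)"
      using e e' by (auto dest: graded_in_gl simp: lowering_def)
    have A: "anticommutator e ?f \<in> gl_zero m n" "anticommutator e' ?f \<in> gl_zero m n"
      using e e' creation by simp_all
    have 1: "up_op e (up_op e' (creation p F)) = up_op e (zero_op (anticommutator e' ?f) F)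
        - (zero_op (anticommutator e ?f) (up_op e' F) - creation p (up_op e (up_op e' F)))"
      using e e' creation by (simp add: up_op_creation up_op_diff)
    have 2: "up_op e' (up_op e (creation p F)) = up_op e' (zero_op (anticommutator e ?f) F)
        - (zero_op (anticommutator e' ?f) (up_op e F) - creation p (up_op e' (up_op e F)))"
      using e e' creation by (simp add: up_op_creation up_op_diff)
    have 3: "zero_op (anticommutator e ?f) (up_op e' F) - up_op e' (zero_op (anticommutator e ?f) F)
       = up_op (commutator (anticommutator e ?f) e') F"
      by (rule zero_op_up_op[OF A(1) e' creation(1)])
    have 4: "zero_op (anticommutator e' ?f) (up_op e F) - up_op e (zero_op (anticommutator e' ?f) F)
       = up_op (commutator (anticommutator e' ?f) e) F"
      by (rule zero_op_up_op[OF A(2) e creation(1)])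
    have "commutator (anticommutator e ?f) e' + commutator (anticommutator e' ?f) e
       = commutator (anticommutator ?f e) e' + commutator (anticommutator ?f e') e"
      using e e' creation by (simp add: anticommutator_commute[of ?f m n] graded_in_gl)
    also have "\<dots> = commutator ?f (anticommutator e e')"
      by (rule jacobi_odd_odd[OF c(1,3,2)])
    also have "\<dots> = 0\<^sub>m (m + n) (m + n)"
      using c by (simp add: bracket_vanish(1)[OF e e'])
    finally have "up_op (commutator (anticommutator e ?f) e' + commutator (anticommutator e' ?f) e) F = 0"
      by simp
    then have 5: "up_op (commutator (anticommutator e ?f) e') F + up_op (commutator (anticommutator e' ?f) e) F = 0"
      using A e e' by (subst (asm) up_op_matrix(1)) auto
    have 6: "creation p (up_op e (up_op e' F)) + creation p (up_op e' (up_op e F)) = 0"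
      using creation.IH by (metis creation_additive(1,3))
    have regroup: "a - (b - c) + (d - (g - h)) = (c + h) - ((b - d) + (g - a))" for a b c d g h :: "nat set \<Rightarrow> 'v"
      by simp
    show ?case
      unfolding 1 2 regroup 3 4 5 6 by simp
  qed
  then show ?thesis by (simp add: eq_neg_iff_add_eq_0)
qed

text \<open>The relations hold on families supported on the subsets of \<open>{..<N}\<close>.  Composing with the
  projection to these makes them hold for arbitrary families, so that the action factors through the enveloping
  algebra without side conditions.\<close>

definition fock_restrict :: "(nat set \<Rightarrow> 'v) \<Rightarrow> nat set \<Rightarrow> 'v" where
  "fock_restrict F = (\<lambda>S. if S \<subseteq> {..<N} then F S else 0)"

definition gl_op :: "complex mat \<Rightarrow> (nat set \<Rightarrow> 'v) \<Rightarrow> nat set \<Rightarrow> 'v" where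
  "gl_op x F = zero_op (zero_part m n x) (fock_restrict F) + up_op (up_part m n x) (fock_restrict F)
     + low_op (low_part m n x) (fock_restrict F)"

lemma fock_restrict [simp]:
  "fock_restrict F \<in> fock N"
  "F \<in> fock N \<Longrightarrow> fock_restrict F = F"
  "fock_restrict (F + G) = fock_restrict F + fock_restrict G"
  "fock_restrict (fscale c F) = fscale c (fock_restrict F)"
  by (auto simp: fock_restrict_def fock_def fock_scale_def fun_eq_iff pointwise)

lemma gl_op_in_fock [simp]: "gl_op x F \<in> fock N"
  unfolding gl_op_def by (intro fock_closed zero_op_in_fock up_op_in_fock low_op_in_fock parts_in fock_restrict)

lemma gl_op_restrict: "gl_op x (fock_restrict F) = gl_op x F"
  by (simp add: gl_op_def)

lemma gl_op_linear:
  "gl_op x (F + G) = gl_op x F + gl_op x G"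
  "gl_op x (fscale c F) = fscale c (gl_op x F)"
  by (simp_all add: gl_op_def zero_op_linear up_op_linear fock.scale_right_distrib)

lemma gl_op_matrix:
  assumes "x \<in> gl m n"
  shows "y \<in> gl m n \<Longrightarrow> gl_op (x + y) F = gl_op x F + gl_op y F"
    "gl_op (c \<cdot>\<^sub>m x) F = fscale c (gl_op x F)"
  using assms by (simp_all add: gl_op_def parts_add parts_smult zero_op_matrix up_op_matrix low_op_matrix
      fock.scale_right_distrib)

lemma gl_op_homogeneous:
  assumes "F \<in> fock N"
  shows "x \<in> gl_zero m n \<Longrightarrow> gl_op x F = zero_op x F"
    "x \<in> gl_up m n \<Longrightarrow> gl_op x F = up_op x F"
    "x \<in> gl_low m n \<Longrightarrow> gl_op x F = low_op x F"
  using assms by (simp_all add: gl_op_def zero_part_of up_part_of low_part_of)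

lemma gl_op_even_odd:
  assumes x: "x \<in> gl_zero m n" and y: "y \<in> gl_par m n True" and F: "F \<in> fock N"
  shows "gl_op x (gl_op y F) - gl_op y (gl_op x F) = gl_op (commutator x y) F"
proof -
  define u where "u = up_part m n y"
  define l where "l = low_part m n y"
  have u: "u \<in> gl_up m n" and l: "l \<in> gl_low m n" by (simp_all add: u_def l_def)
  have y_eq: "y = u + l" unfolding u_def l_def by (rule odd_decomposition[OF y])
  have g: "u \<in> gl m n" "l \<in> gl m n" "x \<in> gl m n" using u l x by (auto intro: graded_in_gl)
  have sum: "gl_op y G = up_op u G + low_op l G" if "G \<in> fock N" for G
    unfolding y_eq using g u l that by (simp add: gl_op_matrix gl_op_homogeneous)
  have "gl_op (commutator x y) F = up_op (commutator x u) F + low_op (commutator x l) F"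
    unfolding y_eq bracket_linear(2)[OF g] using g u l x F
    by (simp add: gl_op_matrix gl_op_homogeneous)
  moreover have "zero_op x (up_op u F) - up_op u (zero_op x F) = up_op (commutator x u) F"
    using zero_op_up_op[OF x u F] .
  moreover have "zero_op x (low_op l F) - low_op l (zero_op x F) = low_op (commutator x l) F"
    using zero_op_low_op[OF x l] by simp
  moreover have "gl_op x (gl_op y F) - gl_op y (gl_op x F)
     = (zero_op x (up_op u F) - up_op u (zero_op x F)) + (zero_op x (low_op l F) - low_op l (zero_op x F))"
    using x u F by (simp add: sum gl_op_homogeneous zero_op_linear)
  ultimately show ?thesis by simp
qed

lemma gl_op_odd_odd:
  assumes x: "x \<in> gl_par m n True" and y: "y \<in> gl_par m n True" and F: "F \<in> fock N"
  shows "gl_op x (gl_op y F) + gl_op y (gl_op x F) = gl_op (anticommutator x y) F"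
proof -
  define u l u' l' where parts: "u = up_part m n x" "l = low_part m n x" "u' = up_part m n y" "l' = low_part m n y"
  have u: "u \<in> gl_up m n" "u' \<in> gl_up m n" and l: "l \<in> gl_low m n" "l' \<in> gl_low m n" by (simp_all add: parts)
  have x_eq: "x = u + l" unfolding parts by (rule odd_decomposition[OF x])
  have y_eq: "y = u' + l'" unfolding parts by (rule odd_decomposition[OF y])
  have g: "u \<in> gl m n" "l \<in> gl m n" "u' \<in> gl m n" "l' \<in> gl m n" using u l by (auto intro: graded_in_gl)
  have sx: "gl_op x G = up_op u G + low_op l G" if "G \<in> fock N" for G
    unfolding x_eq using g u l that by (simp add: gl_op_matrix gl_op_homogeneous)
  have sy: "gl_op y G = up_op u' G + low_op l' G" if "G \<in> fock N" for G
    unfolding y_eq using g u l that by (simp add: gl_op_matrix gl_op_homogeneous)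
  have A: "anticommutator u l' \<in> gl_zero m n" "anticommutator u' l \<in> gl_zero m n" using u l by simp_all
  have "anticommutator x y = anticommutator u l' + anticommutator u' l"
  proof -
    have "anticommutator x y = anticommutator u y + anticommutator l y"
      unfolding x_eq using g y by (intro bracket_linear(4)[where m = m and n = n]) (auto intro: graded_in_gl)
    also have "anticommutator u y = anticommutator u u' + anticommutator u l'"
      unfolding y_eq using g by (intro bracket_linear(5)[where m = m and n = n]) auto
    also have "anticommutator l y = anticommutator l u' + anticommutator l l'"
      unfolding y_eq using g by (intro bracket_linear(5)[where m = m and n = n]) auto
    also have "anticommutator l u' = anticommutator u' l"
      using g by (intro anticommutator_commute[where m = m and n = n]) auto
    finally show ?thesis
      using A[THEN graded_in_gl(1)] unfolding bracket_vanish(1)[OF u] bracket_vanish(2)[OF l]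
      by (simp add: gl_def left_add_zero_mat right_add_zero_mat)
  qed
  then have "gl_op (anticommutator x y) F = zero_op (anticommutator u l') F + zero_op (anticommutator u' l) F"
    using A F by (simp add: gl_op_homogeneous zero_op_matrix)
  moreover have "up_op u (up_op u' F) + up_op u' (up_op u F) = 0"
    using up_op_up_op[OF u F] by simp
  moreover have "low_op l (low_op l' F) + low_op l' (low_op l F) = 0"
    using low_op_low_op[of l l' F] by simp
  moreover have "up_op u (low_op l' F) + low_op l' (up_op u F) = zero_op (anticommutator u l') F"
    "up_op u' (low_op l F) + low_op l (up_op u' F) = zero_op (anticommutator u' l) F"
    using up_op_low_op u l by simp_all
  moreover have "gl_op x (gl_op y F) + gl_op y (gl_op x F)
     = (up_op u (up_op u' F) + up_op u' (up_op u F)) + (low_op l (low_op l' F) + low_op l' (low_op l F))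
       + ((up_op u (low_op l' F) + low_op l' (up_op u F)) + (up_op u' (low_op l F) + low_op l (up_op u' F)))"
    using u F by (simp add: sx sy up_op_linear)
  ultimately show ?thesis by (simp only: add_0_left add_0)
qed

theorem gl_op_bracket:
  assumes x: "x \<in> gl_par m n p" and y: "y \<in> gl_par m n q"
  shows "gl_op x (gl_op y F) - fscale (if p \<and> q then -1 else 1) (gl_op y (gl_op x F)) = gl_op (sbracket p q x y) F"
proof -
  define G where "G = fock_restrict F"
  have G: "G \<in> fock N" by (simp add: G_def)
  have "gl_op x (gl_op y G) - fscale (if p \<and> q then -1 else 1) (gl_op y (gl_op x G)) = gl_op (sbracket p q x y) G"
  proof (cases p; cases q)
    assume "p" "q"
    then show ?thesis using gl_op_odd_odd[OF _ _ G] x y by (simp add: sbracket_def)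
  next
    assume "\<not> p" "q"
    then show ?thesis using gl_op_even_odd[OF _ _ G] x y by (simp add: sbracket_def)
  next
    assume pq: "p" "\<not> q"
    have g: "x \<in> gl m n" "y \<in> gl m n" using x y by (auto intro: graded_in_gl)
    have "commutator x y = (-1) \<cdot>\<^sub>m commutator y x"
      by (rule eq_matI) (use g in \<open>auto simp: gl_def simp del: index_mult_mat(1)\<close>)
    then have "gl_op (commutator x y) G = - gl_op (commutator y x) G"
      using g by (simp add: gl_op_matrix)
    moreover have "gl_op (commutator y x) G = gl_op y (gl_op x G) - gl_op x (gl_op y G)"
      using gl_op_even_odd[OF _ _ G, of y x] x y pq by simp
    ultimately show ?thesis using pq by (simp add: sbracket_def)
  next
    assume "\<not> p" "\<not> q"
    then show ?thesis using zero_op_zero_op[OF _ _ G] x y G by (simp add: sbracket_def gl_op_homogeneous)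
  qed
  then show ?thesis by (simp add: G_def gl_op_restrict)
qed

end

section \<open>Noncommutative polynomials acting on vector spaces\<close>

lemma free_algebra_simps:
  "f \<in> carrier (free_algebra X) \<longleftrightarrow> (\<forall>w \<in> Poly_Mapping.keys f. set (letters w) \<subseteq> X)"
  "f \<otimes>\<^bsub>free_algebra X\<^esub> g = f * g"
  "f \<oplus>\<^bsub>free_algebra X\<^esub> g = f + g"
  "\<one>\<^bsub>free_algebra X\<^esub> = 1"
  "\<zero>\<^bsub>free_algebra X\<^esub> = 0"
  by (simp_all add: free_algebra_def)

lemma free_algebra_closed [simp]:
  "0 \<in> carrier (free_algebra X)"
  "1 \<in> carrier (free_algebra X)"
  "f \<in> carrier (free_algebra X) \<Longrightarrow> g \<in> carrier (free_algebra X) \<Longrightarrow> f + g \<in> carrier (free_algebra X)"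
  "f \<in> carrier (free_algebra X) \<Longrightarrow> - f \<in> carrier (free_algebra X)"
  "f \<in> carrier (free_algebra X) \<Longrightarrow> g \<in> carrier (free_algebra X) \<Longrightarrow> f - g \<in> carrier (free_algebra X)"
  "f \<in> carrier (free_algebra X) \<Longrightarrow> g \<in> carrier (free_algebra X) \<Longrightarrow> f * g \<in> carrier (free_algebra X)"
  "ncconst c \<in> carrier (free_algebra X)"
  "x \<in> X \<Longrightarrow> ncvar x \<in> carrier (free_algebra X)"
  "set L \<subseteq> X \<Longrightarrow> Poly_Mapping.single (Word L) c \<in> carrier (free_algebra X)"
proof -
  show neg: "f \<in> carrier (free_algebra X) \<Longrightarrow> - f \<in> carrier (free_algebra X)" for f
    by (simp add: free_algebra_simps in_keys_iff)
  show plus: "f \<in> carrier (free_algebra X) \<Longrightarrow> g \<in> carrier (free_algebra X) \<Longrightarrow> f + g \<in> carrier (free_algebra X)" for f g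
    using keys_add[of f g] by (auto simp: free_algebra_simps(1))
  show "f \<in> carrier (free_algebra X) \<Longrightarrow> g \<in> carrier (free_algebra X) \<Longrightarrow> f - g \<in> carrier (free_algebra X)"
    using plus[of f "- g"] neg[of g] by simp
  show "f \<in> carrier (free_algebra X) \<Longrightarrow> g \<in> carrier (free_algebra X) \<Longrightarrow> f * g \<in> carrier (free_algebra X)"
    using keys_mult[of f g] by (fastforce simp: free_algebra_simps(1) plus_word_def)
qed (auto simp: free_algebra_simps ncconst_def ncvar_def zero_word_def)

lemma ring_free_algebra: "ring (free_algebra X)"
proof (rule ringI)
  show "abelian_group (free_algebra X)"
  proof (rule abelian_groupI; unfold free_algebra_simps(3,5))
    fix f g h assume f: "f \<in> carrier (free_algebra X)" and g: "g \<in> carrier (free_algebra X)"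
    show "f + g \<in> carrier (free_algebra X)" using f g by (rule free_algebra_closed(3))
    show "f + g = g + f" by (rule add.commute)
    show "f + g + h = f + (g + h)" by (rule add.assoc)
  next
    fix f assume f: "f \<in> carrier (free_algebra X)"
    show "0 + f = f" by (rule add_0_left)
    show "\<exists>g\<in>carrier (free_algebra X). g + f = 0"
      using left_minus free_algebra_closed(4)[OF f] by (rule bexI)
  qed (rule free_algebra_closed(1))
  show "monoid (free_algebra X)"
  proof (rule monoidI; unfold free_algebra_simps(2,4))
    fix f g h assume f: "f \<in> carrier (free_algebra X)" and g: "g \<in> carrier (free_algebra X)"
    show "f * g \<in> carrier (free_algebra X)" using f g by (rule free_algebra_closed(6))
    show "f * g * h = f * (g * h)" by (rule mult.assoc)
  next
    fix f assume f: "f \<in> carrier (free_algebra X)"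
    show "1 * f = f" "f * 1 = f" by (rule mult_1_left mult_1_right)+
  qed (rule free_algebra_closed(2))
qed (unfold free_algebra_simps(2,3), (rule distrib_right distrib_left)+)

lemma ncpoly_expansion:
  "f = (\<Sum>w\<in>Poly_Mapping.keys f. Poly_Mapping.single w (Poly_Mapping.lookup f w))" (is "f = ?g")
proof (rule poly_mapping_eqI)
  fix w
  have "Poly_Mapping.lookup ?g w = (\<Sum>v\<in>Poly_Mapping.keys f. if v = w then Poly_Mapping.lookup f v else 0)"
    unfolding lookup_sum by (rule sum.cong) (auto simp: lookup_single)
  also have "\<dots> = Poly_Mapping.lookup f w" by (simp add: in_keys_iff)
  finally show "Poly_Mapping.lookup f w = Poly_Mapping.lookup ?g w" ..
qed

lemma ncpoly_induct [consumes 1, case_names monomial add]: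
  assumes f: "f \<in> carrier (free_algebra X)"
    and monomial: "\<And>L c. set L \<subseteq> X \<Longrightarrow> P (Poly_Mapping.single (Word L) c)"
    and add: "\<And>f g. f \<in> carrier (free_algebra X) \<Longrightarrow> g \<in> carrier (free_algebra X) \<Longrightarrow> P f \<Longrightarrow> P g \<Longrightarrow> P (f + g)"
  shows "P f"
proof -
  have "P 0" using monomial[of "[]" 0] by simp
  have single: "P (Poly_Mapping.single w c)" "Poly_Mapping.single w c \<in> carrier (free_algebra X)"
    if "w \<in> Poly_Mapping.keys f" for w c
    using that f monomial[of "letters w" c] free_algebra_closed(9)[of "letters w" X c] by (auto simp: free_algebra_simps(1))
  have "P (\<Sum>w\<in>A. Poly_Mapping.single w (Poly_Mapping.lookup f w)) \<and>
      (\<Sum>w\<in>A. Poly_Mapping.single w (Poly_Mapping.lookup f w)) \<in> carrier (free_algebra X)"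
    if "A \<subseteq> Poly_Mapping.keys f" for A
    using finite_subset[OF that finite_keys] that
  proof (induction A rule: finite_induct)
    case empty
    then show ?case using \<open>P 0\<close> by simp
  next
    case (insert w A)
    then show ?case
      unfolding sum.insert[OF insert.hyps(1,2)] by (auto intro!: add single free_algebra_closed(3))
  qed
  from this[OF order_refl] show ?thesis
    by (simp flip: ncpoly_expansion)
qed

text \<open>This is applied to the superalgebra acting on the Fock space and to \<open>g\<^sub>0 + g\<^sub>1\<close> acting on \<open>L\<^sup>0(\<Lambda>)\<close>.\<close>

locale letter_action = vector_space scale
  for scale :: "complex \<Rightarrow> 'w::ab_group_add \<Rightarrow> 'w" +
  fixes X :: "'a set" and act :: "'a \<Rightarrow> 'w \<Rightarrow> 'w"
  assumes act_add: "x \<in> X \<Longrightarrow> act x (v + w) = act x v + act x w"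
    and act_scale: "x \<in> X \<Longrightarrow> act x (scale c v) = scale c (act x v)"
begin

abbreviation poly_act :: "'a ncpoly \<Rightarrow> 'w \<Rightarrow> 'w" where
  "poly_act \<equiv> ncpoly_act scale act"

lemma word_act_linear:
  assumes "set L \<subseteq> X"
  shows "foldr act L (v + w) = foldr act L v + foldr act L w"
    "foldr act L (scale c v) = scale c (foldr act L v)"
  using assms by (induction L) (auto simp: act_add act_scale)

lemma poly_act_superset:
  assumes "finite A" "Poly_Mapping.keys f \<subseteq> A"
  shows "poly_act f v = (\<Sum>w\<in>A. scale (Poly_Mapping.lookup f w) (foldr act (letters w) v))"
  unfolding ncpoly_act_def
  by (rule sum.mono_neutral_left) (use assms in \<open>auto simp: in_keys_iff\<close>)

lemma poly_act_single [simp]: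
  "poly_act (Poly_Mapping.single w c) v = scale c (foldr act (letters w) v)"
  by (simp add: poly_act_superset[of "{w}"])

lemma poly_act_zero [simp]: "poly_act 0 v = 0"
  by (simp add: ncpoly_act_def)

lemma poly_act_add: "poly_act (f + g) v = poly_act f v + poly_act g v"
  by (simp add: poly_act_superset[of "Poly_Mapping.keys f \<union> Poly_Mapping.keys g"] keys_add lookup_add
      scale_left_distrib sum.distrib)

lemma poly_act_diff: "poly_act (f - g) v = poly_act f v - poly_act g v"
  using poly_act_add[of "f - g" g v] by simp

lemma poly_act_simps [simp]:
  "poly_act (ncconst c) v = scale c v"
  "poly_act (ncvar x) v = act x v"
  "poly_act 1 v = v"
proof -
  show "poly_act (ncconst c) v = scale c v" for c by (simp add: ncconst_def zero_word_def)
  from this[of 1] show "poly_act 1 v = v" by (simp add: ncconst_def)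
  show "poly_act (ncvar x) v = act x v" by (simp add: ncvar_def)
qed

lemma poly_act_linear:
  assumes "f \<in> carrier (free_algebra X)"
  shows "poly_act f (v + w) = poly_act f v + poly_act f w" "poly_act f (scale c v) = scale c (poly_act f v)"
proof -
  have "poly_act f (v + w) = poly_act f v + poly_act f w \<and> poly_act f (scale c v) = scale c (poly_act f v)"
    using assms
  proof (induction rule: ncpoly_induct)
    case (monomial L d)
    then show ?case by (simp add: word_act_linear scale_right_distrib mult.commute)
  next
    case (add f g)
    then show ?case by (simp add: poly_act_add scale_right_distrib)
  qed
  then show "poly_act f (v + w) = poly_act f v + poly_act f w" "poly_act f (scale c v) = scale c (poly_act f v)"
    by auto
qed

lemma poly_act_zero_right [simp]: "f \<in> carrier (free_algebra X) \<Longrightarrow> poly_act f 0 = 0"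
  using poly_act_linear(2)[of f 0 0] by simp

lemma poly_act_mult:
  assumes f: "f \<in> carrier (free_algebra X)" and g: "g \<in> carrier (free_algebra X)"
  shows "poly_act (f * g) v = poly_act f (poly_act g v)"
  using f
proof (induction rule: ncpoly_induct)
  case (monomial L c)
  note L = monomial
  show ?case using g
  proof (induction rule: ncpoly_induct)
    case (monomial L' c')
    then show ?case using L by (simp add: mult_single plus_word_def word_act_linear)
  next
    case (add g g')
    then show ?case using L by (simp add: distrib_left poly_act_add word_act_linear scale_right_distrib)
  qed
next
  case (add f f')
  then show ?case by (simp add: distrib_right poly_act_add)
qed

definition annihilator :: "'a ncpoly set" where
  "annihilator = {f \<in> carrier (free_algebra X). \<forall>v. poly_act f v = 0}"

text \<open>This makes it sufficient to check the generators when an action is to factor through a quotient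
  of the free algebra.\<close>

lemma annihilator_ideal: "ideal annihilator (free_algebra X)"
proof (rule idealI[OF ring_free_algebra])
  have sub: "f \<in> carrier (free_algebra X)" and zero: "poly_act f v = 0" if "f \<in> annihilator" for f v
    using that by (simp_all add: annihilator_def)
  have I: "f \<in> annihilator" if "f \<in> carrier (free_algebra X)" "\<And>v. poly_act f v = 0" for f
    using that by (simp add: annihilator_def)
  have "abelian_group (free_algebra X)" using ring_free_algebra by (rule ring.is_abelian_group)
  then show "subgroup annihilator (add_monoid (free_algebra X))"
  proof (intro group.subgroupI abelian_group.a_group)
    fix a assume a: "a \<in> annihilator"
    have "inv\<^bsub>add_monoid (free_algebra X)\<^esub> a = - a"
      using \<open>abelian_group (free_algebra X)\<close> sub[OF a]
      by (intro group.inv_equality abelian_group.a_group) (auto simp: free_algebra_simps(3,5))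
    moreover have "- a \<in> annihilator"
      using sub[OF a] zero[OF a] poly_act_diff[of 0 a] by (intro I) simp_all
    ultimately show "inv\<^bsub>add_monoid (free_algebra X)\<^esub> a \<in> annihilator" by simp
    fix b assume b: "b \<in> annihilator"
    have "a + b \<in> annihilator"
      using sub[OF a] zero[OF a] sub[OF b] zero[OF b] by (intro I) (simp_all add: poly_act_add)
    then show "a \<otimes>\<^bsub>add_monoid (free_algebra X)\<^esub> b \<in> annihilator"
      by (simp add: free_algebra_simps(3))
  next
    have "0 \<in> annihilator" by (intro I) simp_all
    then show "annihilator \<noteq> {}" by blast
  qed (auto simp: sub)
  fix a x assume a: "a \<in> annihilator" and x: "x \<in> carrier (free_algebra X)"
  show "x \<otimes>\<^bsub>free_algebra X\<^esub> a \<in> annihilator" "a \<otimes>\<^bsub>free_algebra X\<^esub> x \<in> annihilator"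
    unfolding free_algebra_simps(2) using sub[OF a] zero[OF a] x by (auto intro!: I simp: poly_act_mult)
qed

end

section \<open>The action of the enveloping algebra\<close>

lemma ncconst_mult_single: "ncconst c * Poly_Mapping.single w d = Poly_Mapping.single w (c * d)"
  "Poly_Mapping.single w d * ncconst c = Poly_Mapping.single w (c * d)"
  by (simp_all add: ncconst_def mult_single mult.commute)

lemma ncconst_central: "f * ncconst c = ncconst c * f"
proof -
  have "f \<in> carrier (free_algebra UNIV)" by (simp add: free_algebra_simps(1))
  then show ?thesis
    by (induction rule: ncpoly_induct) (simp_all add: ncconst_mult_single distrib_left distrib_right)
qed

lemma ncconst_simps [simp]: "ncconst 1 = 1" "ncconst (- c) = - ncconst c" "ncconst c + ncconst d = ncconst (c + d)"
  by (simp_all add: ncconst_def single_uminus single_add)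

lemma gl_nonneg_free: "f \<in> carrier (free_algebra (gl_nonneg m n)) \<Longrightarrow> f \<in> carrier (free_algebra (gl m n))"
  unfolding free_algebra_simps(1) using graded_in_gl(4) by blast

lemma sbracket_in_gl: "x \<in> gl m n \<Longrightarrow> y \<in> gl m n \<Longrightarrow> sbracket p q x y \<in> gl m n"
  by (simp add: sbracket_def)

lemma env_rels_cases:
  assumes "r \<in> env_rels m n"
  obtains (add) x y where "r = ncvar (x + y) - ncvar x - ncvar y" "x \<in> gl m n" "y \<in> gl m n"
    | (smult) c x where "r = ncvar (c \<cdot>\<^sub>m x) - ncconst c * ncvar x" "x \<in> gl m n"
    | (bracket) p q x y where "r = ncvar x * ncvar y - ncconst (if p \<and> q then -1 else 1) * (ncvar y * ncvar x)
        - ncvar (sbracket p q x y)" "x \<in> gl_par m n p" "y \<in> gl_par m n q"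
  using assms unfolding env_rels_def by blast

lemma env_rels_closed: "env_rels m n \<subseteq> carrier (free_algebra (gl m n))"
proof
  fix r assume "r \<in> env_rels m n"
  then show "r \<in> carrier (free_algebra (gl m n))"
  proof (cases rule: env_rels_cases)
    case add
    then show ?thesis by (auto intro!: free_algebra_closed)
  next
    case smult
    then show ?thesis by (auto intro!: free_algebra_closed)
  next
    case bracket
    then show ?thesis
      by (auto intro!: free_algebra_closed(5,6,7,8) sbracket_in_gl intro: graded_in_gl simp del: ncconst_simps)
  qed
qed

lemma env_ideal_ideal: "ideal (env_ideal m n) (free_algebra (gl m n))"
  unfolding env_ideal_def using ring_free_algebra env_rels_closed by (rule ring.genideal_ideal)

lemma env_rels_in_ideal: "env_rels m n \<subseteq> env_ideal m n"
  unfolding env_ideal_def using ring_free_algebra env_rels_closed by (rule ring.genideal_self)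

context
  fixes m n :: nat
begin

interpretation I: ideal "env_ideal m n" "free_algebra (gl m n)" by (rule env_ideal_ideal)

lemma env_ideal_closed:
  "0 \<in> env_ideal m n"
  "f \<in> env_ideal m n \<Longrightarrow> g \<in> env_ideal m n \<Longrightarrow> f + g \<in> env_ideal m n"
  "f \<in> env_ideal m n \<Longrightarrow> - f \<in> env_ideal m n"
  "f \<in> env_ideal m n \<Longrightarrow> g \<in> env_ideal m n \<Longrightarrow> f - g \<in> env_ideal m n"
  "f \<in> env_ideal m n \<Longrightarrow> g \<in> carrier (free_algebra (gl m n)) \<Longrightarrow> g * f \<in> env_ideal m n"
  "f \<in> env_ideal m n \<Longrightarrow> g \<in> carrier (free_algebra (gl m n)) \<Longrightarrow> f * g \<in> env_ideal m n"
proof -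
  show "0 \<in> env_ideal m n" using additive_subgroup.zero_closed[OF ideal.axioms(1)[OF env_ideal_ideal]] by (simp add: free_algebra_simps(5))
  show plus: "f \<in> env_ideal m n \<Longrightarrow> g \<in> env_ideal m n \<Longrightarrow> f + g \<in> env_ideal m n" for f g
    using additive_subgroup.a_closed[OF ideal.axioms(1)[OF env_ideal_ideal], of f m n g] by (simp add: free_algebra_simps(3))
  show left: "f \<in> env_ideal m n \<Longrightarrow> g \<in> carrier (free_algebra (gl m n)) \<Longrightarrow> g * f \<in> env_ideal m n" for f g
    using I.I_l_closed[of f g] by (simp add: free_algebra_simps(2))
  show "f \<in> env_ideal m n \<Longrightarrow> g \<in> carrier (free_algebra (gl m n)) \<Longrightarrow> f * g \<in> env_ideal m n"
    using I.I_r_closed[of f g] by (simp add: free_algebra_simps(2))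
  show neg: "f \<in> env_ideal m n \<Longrightarrow> - f \<in> env_ideal m n" for f
    using left[of f "ncconst (-1)"] by simp
  show "f \<in> env_ideal m n \<Longrightarrow> g \<in> env_ideal m n \<Longrightarrow> f - g \<in> env_ideal m n"
    using plus[of f "- g"] neg[of g] by simp
qed

lemma env_class_eq: "env_class m n f = (\<lambda>h. h + f) ` env_ideal m n"
  by (auto simp: env_class_def a_r_coset_def' free_algebra_simps(3))

lemma env_class_self: "f \<in> env_class m n f"
  unfolding env_class_eq using env_ideal_closed(1) by force

lemma env_class_memD: "g \<in> env_class m n f \<Longrightarrow> g - f \<in> env_ideal m n"
  by (auto simp: env_class_eq)

lemma env_class_eqI:
  assumes "f - g \<in> env_ideal m n"
  shows "env_class m n f = env_class m n g"
proof -
  have "env_class m n f \<subseteq> env_class m n g" if "f - g \<in> env_ideal m n" for f g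
  proof
    fix k assume "k \<in> env_class m n f"
    then obtain h where "h \<in> env_ideal m n" "k = h + f" by (auto simp: env_class_eq)
    then have "h + (f - g) \<in> env_ideal m n" "k = h + (f - g) + g" using that env_ideal_closed(2) by auto
    then show "k \<in> env_class m n g" unfolding env_class_eq by blast
  qed
  from this[of f g] this[of g f] show ?thesis
    using assms env_ideal_closed(3)[OF assms] by auto
qed

lemma env_algebra_carrier: "carrier (env_algebra m n) = env_class m n ` carrier (free_algebra (gl m n))"
  by (auto simp: env_algebra_def FactRing_def A_RCOSETS_def' env_class_def)

lemma env_class_in [simp]: "f \<in> carrier (free_algebra (gl m n)) \<Longrightarrow> env_class m n f \<in> carrier (env_algebra m n)"
  by (simp add: env_algebra_carrier)

lemma env_class_mult:
  "f \<in> carrier (free_algebra (gl m n)) \<Longrightarrow> g \<in> carrier (free_algebra (gl m n)) \<Longrightarrow>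
    env_class m n f \<otimes>\<^bsub>env_algebra m n\<^esub> env_class m n g = env_class m n (f * g)"
  using I.rcoset_mult_add[of f g] by (simp add: env_algebra_def FactRing_def env_class_def free_algebra_simps(2))

lemma env_class_add:
  "f \<in> carrier (free_algebra (gl m n)) \<Longrightarrow> g \<in> carrier (free_algebra (gl m n)) \<Longrightarrow>
    env_class m n f \<oplus>\<^bsub>env_algebra m n\<^esub> env_class m n g = env_class m n (f + g)"
  using I.a_rcos_sum[of f g] by (simp add: env_algebra_def FactRing_def env_class_def free_algebra_simps(3))

lemma env_rel_add:
  "x \<in> gl m n \<Longrightarrow> y \<in> gl m n \<Longrightarrow> ncvar (x + y) - (ncvar x + ncvar y) \<in> env_ideal m n"
  unfolding diff_diff_eq[symmetric]
  by (rule subsetD[OF env_rels_in_ideal]) (auto simp: env_rels_def)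

lemma env_rel_smult:
  "x \<in> gl m n \<Longrightarrow> ncvar (c \<cdot>\<^sub>m x) - ncconst c * ncvar x \<in> env_ideal m n"
  by (rule subsetD[OF env_rels_in_ideal]) (auto simp: env_rels_def)

lemma env_rel_bracket:
  assumes "x \<in> gl_par m n p" "y \<in> gl_par m n q"
  shows "ncvar x * ncvar y - ncconst (if p \<and> q then -1 else 1) * (ncvar y * ncvar x) - ncvar (sbracket p q x y) \<in> env_ideal m n"
  by (rule subsetD[OF env_rels_in_ideal]) (use assms in \<open>unfold env_rels_def, blast\<close>)

lemma odd_of_graded: "x \<in> gl_up m n \<Longrightarrow> x \<in> gl_par m n True" "x \<in> gl_low m n \<Longrightarrow> x \<in> gl_par m n True"
  unfolding gl_par_def using graded_nonzero[of x _ _ m n] graded_in_gl(2,3)[of x m n] by blast+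

lemma env_rel_even:
  "x \<in> gl_zero m n \<Longrightarrow> f \<in> gl_low m n \<Longrightarrow>
    ncvar x * ncvar f - (ncvar f * ncvar x + ncvar (commutator x f)) \<in> env_ideal m n"
  using env_rel_bracket[of x False f True] by (simp add: sbracket_def odd_of_graded diff_diff_eq)

lemma env_rel_odd:
  "e \<in> gl_par m n True \<Longrightarrow> f \<in> gl_par m n True \<Longrightarrow>
    ncvar e * ncvar f - (ncvar (anticommutator e f) - ncvar f * ncvar e) \<in> env_ideal m n"
  using env_rel_bracket[of e True f True] by (simp add: sbracket_def algebra_simps)

lemma env_rel_zero: "ncvar (0\<^sub>m (m + n) (m + n)) \<in> env_ideal m n"
  using env_ideal_closed(3)[OF env_rel_add[of "0\<^sub>m (m + n) (m + n)" "0\<^sub>m (m + n) (m + n)"]] by simp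

lemma env_rel_low_low:
  assumes "f \<in> gl_low m n" "g \<in> gl_low m n"
  shows "ncvar f * ncvar g + ncvar g * ncvar f \<in> env_ideal m n"
proof -
  have "anticommutator f g = 0\<^sub>m (m + n) (m + n)" by (rule bracket_vanish(2)[OF assms])
  then have "ncvar f * ncvar g - (ncvar (0\<^sub>m (m + n) (m + n)) - ncvar g * ncvar f) \<in> env_ideal m n"
    using env_rel_odd[of f g] assms odd_of_graded by metis
  from env_ideal_closed(2)[OF this env_rel_zero] show ?thesis by (simp add: algebra_simps)
qed

end

context gl_zero_irrep
begin

sublocale fock_act: letter_action fscale "gl m n" gl_op
  by standard (simp_all add: gl_op_linear)

sublocale base_act: letter_action scale "gl_nonneg m n" "\<lambda>x. \<rho> (zero_part m n x)"
  by standard (simp_all add: rep_linear)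

abbreviation fock_poly :: "complex mat ncpoly \<Rightarrow> (nat set \<Rightarrow> 'v) \<Rightarrow> nat set \<Rightarrow> 'v" where
  "fock_poly \<equiv> ncpoly_act fscale gl_op"

text \<open>The noncommutative polynomials that annihilate the Fock space form an ideal, and it contains the
  defining relations.\<close>

lemma env_ideal_annihilates:
  assumes "f \<in> env_ideal m n"
  shows "fock_poly f F = 0"
proof -
  have "env_rels m n \<subseteq> fock_act.annihilator"
  proof
    fix r assume r: "r \<in> env_rels m n"
    then have "fock_poly r F = 0" for F
    proof (cases rule: env_rels_cases)
      case add
      then show ?thesis by (simp add: fock_act.poly_act_diff gl_op_matrix)
    next
      case smult
      then show ?thesis by (simp add: fock_act.poly_act_diff fock_act.poly_act_mult gl_op_matrix)
    next
      case (bracket p q x y)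
      then have "x \<in> gl m n" "y \<in> gl m n" by (auto intro: graded_in_gl)
      then show ?thesis using gl_op_bracket[OF bracket(2,3), of F] bracket(1)
        by (simp add: fock_act.poly_act_diff fock_act.poly_act_mult del: ncconst_simps)
    qed
    then show "r \<in> fock_act.annihilator"
      using r env_rels_closed by (auto simp: fock_act.annihilator_def)
  qed
  then have "env_ideal m n \<subseteq> fock_act.annihilator"
    unfolding env_ideal_def by (rule ring.genideal_minimal[OF ring_free_algebra fock_act.annihilator_ideal])
  then show ?thesis using assms by (auto simp: fock_act.annihilator_def)
qed

lemma fock_poly_in_fock: "f \<in> carrier (free_algebra (gl m n)) \<Longrightarrow> F \<in> fock N \<Longrightarrow> fock_poly f F \<in> fock N"
proof (induction rule: ncpoly_induct)
  case (monomial L c)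
  then have "foldr gl_op L F \<in> fock N" by (cases L) simp_all
  then show ?case by simp
qed (simp add: fock_act.poly_act_add)

text \<open>The choice of the representative does not matter because the ideal annihilates the Fock space.\<close>

definition env_act :: "complex mat ncpoly set \<Rightarrow> (nat set \<Rightarrow> 'v) \<Rightarrow> nat set \<Rightarrow> 'v" where
  "env_act b F = fock_poly (SOME f. f \<in> b) F"

lemma env_act_class: "env_act (env_class m n f) F = fock_poly f F"
proof -
  have "(SOME g. g \<in> env_class m n f) \<in> env_class m n f"
    by (rule someI[of _ f]) (rule env_class_self)
  then have "(SOME g. g \<in> env_class m n f) - f \<in> env_ideal m n" by (rule env_class_memD)
  from env_ideal_annihilates[OF this, of F] show ?thesis
    by (simp add: env_act_def fock_act.poly_act_diff)
qed

end

section \<open>Computing in the tensor product\<close>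

context gl_zero_irrep
begin

abbreviation base_act_poly :: "complex mat ncpoly \<Rightarrow> 'v \<Rightarrow> 'v" where
  "base_act_poly \<equiv> ncpoly_act scale (\<lambda>x. \<rho> (zero_part m n x))"

abbreviation env_free :: "complex mat ncpoly set" where
  "env_free \<equiv> carrier (free_algebra (gl m n))"

text \<open>The tensor product is the quotient of the group of pairs by the span of the balancing relations.
  Calculations take place in the group of pairs, modulo this span.\<close>

definition pair_group :: "(complex mat ncpoly set \<times> 'v \<Rightarrow>\<^sub>0 int) monoid" where
  "pair_group = free_Abelian_group (carrier (env_algebra m n) \<times> UNIV)"

definition balanced_rels :: "(complex mat ncpoly set \<times> 'v \<Rightarrow>\<^sub>0 int) set" where
  "balanced_rels = tensor_rels (env_algebra m n) (carrier (free_algebra (gl_nonneg m n))) (env_class m n) base_act_poly"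

definition balanced_span :: "(complex mat ncpoly set \<times> 'v \<Rightarrow>\<^sub>0 int) set" where
  "balanced_span = generate pair_group balanced_rels"

definition left_mult :: "complex mat ncpoly set \<Rightarrow> (complex mat ncpoly set \<times> 'v \<Rightarrow>\<^sub>0 int)
    \<Rightarrow> complex mat ncpoly set \<times> 'v \<Rightarrow>\<^sub>0 int" where
  "left_mult a = frag_extend (\<lambda>(b, v). frag_of (a \<otimes>\<^bsub>env_algebra m n\<^esub> b, v))"

definition pure_tensor :: "complex mat ncpoly \<Rightarrow> 'v \<Rightarrow> complex mat ncpoly set \<times> 'v \<Rightarrow>\<^sub>0 int" where
  "pure_tensor f v = frag_of (env_class m n f, v)"

definition tensor_eq :: "(complex mat ncpoly set \<times> 'v \<Rightarrow>\<^sub>0 int) \<Rightarrow> (complex mat ncpoly set \<times> 'v \<Rightarrow>\<^sub>0 int) \<Rightarrow> bool"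
    (infix \<open>\<doteq>\<close> 50) where
  "X \<doteq> Y \<longleftrightarrow> X - Y \<in> balanced_span"

lemma pair_group_simps [simp]:
  "group pair_group"
  "\<one>\<^bsub>pair_group\<^esub> = 0"
  "X \<otimes>\<^bsub>pair_group\<^esub> Y = X + Y"
  by (simp_all add: pair_group_def)

lemma pair_group_carrier:
  "X \<in> carrier pair_group \<longleftrightarrow> Poly_Mapping.keys X \<subseteq> carrier (env_algebra m n) \<times> UNIV"
  by (simp add: pair_group_def)

abbreviation pairs :: "(complex mat ncpoly set \<times> 'v \<Rightarrow>\<^sub>0 int) set" where
  "pairs \<equiv> carrier pair_group"

lemma pairs_closed:
  "0 \<in> pairs"
  "X \<in> pairs \<Longrightarrow> Y \<in> pairs \<Longrightarrow> X + Y \<in> pairs"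
  "X \<in> pairs \<Longrightarrow> Y \<in> pairs \<Longrightarrow> X - Y \<in> pairs"
  "X \<in> pairs \<Longrightarrow> - X \<in> pairs"
  "f \<in> env_free \<Longrightarrow> pure_tensor f v \<in> pairs"
  using keys_add[of X Y] keys_diff[of X Y] by (auto simp: pair_group_carrier pure_tensor_def)

lemma pairs_sum: "(\<And>a. a \<in> A \<Longrightarrow> X a \<in> pairs) \<Longrightarrow> sum X A \<in> pairs"
  by (induction A rule: infinite_finite_induct) (auto intro: pairs_closed)

lemma pairs_induct [consumes 1, case_names zero pure diff]:
  assumes "X \<in> pairs" "P 0" "\<And>f v. f \<in> env_free \<Longrightarrow> P (pure_tensor f v)"
    "\<And>X Y. X \<in> pairs \<Longrightarrow> Y \<in> pairs \<Longrightarrow> P X \<Longrightarrow> P Y \<Longrightarrow> P (X - Y)"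
  shows "P X"
proof (rule free_Abelian_group_induct[of X "carrier (env_algebra m n) \<times> UNIV" P])
  show "Poly_Mapping.keys X \<subseteq> carrier (env_algebra m n) \<times> UNIV" using assms(1) by (simp add: pair_group_carrier)
  fix a :: "complex mat ncpoly set \<times> 'v"
  assume "a \<in> carrier (env_algebra m n) \<times> UNIV"
  then obtain f v where "a = (env_class m n f, v)" "f \<in> env_free"
    by (auto simp: env_algebra_carrier)
  then show "P (frag_of a)" using assms(3)[of f v] by (simp add: pure_tensor_def)
qed (use assms in \<open>auto simp: pair_group_carrier\<close>)

lemma balanced_rels_cases:
  assumes "r \<in> balanced_rels"
  obtains (left) f g v where "f \<in> env_free" "g \<in> env_free"
      "r = pure_tensor (f + g) v - pure_tensor f v - pure_tensor g v"
    | (right) f v w where "f \<in> env_free" "r = pure_tensor f (v + w) - pure_tensor f v - pure_tensor f w"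
    | (middle) f s v where "f \<in> env_free" "s \<in> carrier (free_algebra (gl_nonneg m n))"
      "r = pure_tensor (f * s) v - pure_tensor f (base_act_poly s v)"
proof -
  from assms consider
      (1) a b v where "a \<in> carrier (env_algebra m n)" "b \<in> carrier (env_algebra m n)"
        "r = frag_of (a \<oplus>\<^bsub>env_algebra m n\<^esub> b, v) - frag_of (a, v) - frag_of (b, v)"
    | (2) a v w where "a \<in> carrier (env_algebra m n)"
        "r = frag_of (a, v + w) - frag_of (a, v) - frag_of (a, w)"
    | (3) a s v where "a \<in> carrier (env_algebra m n)" "s \<in> carrier (free_algebra (gl_nonneg m n))"
        "r = frag_of (a \<otimes>\<^bsub>env_algebra m n\<^esub> env_class m n s, v) - frag_of (a, base_act_poly s v)"
    unfolding balanced_rels_def tensor_rels_def by blast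
  then show thesis
  proof cases
    case 1
    then obtain f g where "f \<in> env_free" "g \<in> env_free" "a = env_class m n f" "b = env_class m n g"
      by (auto simp: env_algebra_carrier)
    then show thesis using 1 left[of f g v] by (simp add: env_class_add pure_tensor_def)
  next
    case 2
    then obtain f where "f \<in> env_free" "a = env_class m n f"
      by (auto simp: env_algebra_carrier)
    then show thesis using 2 right[of f v w] by (simp add: pure_tensor_def)
  next
    case 3
    then obtain f where "f \<in> env_free" "a = env_class m n f"
      by (auto simp: env_algebra_carrier)
    then show thesis using 3 middle[of f s v] gl_nonneg_free[OF 3(2)] by (simp add: env_class_mult pure_tensor_def)
  qed
qed

lemma balanced_relsI:
  "f \<in> env_free \<Longrightarrow> g \<in> env_free \<Longrightarrow> pure_tensor (f + g) v - pure_tensor f v - pure_tensor g v \<in> balanced_rels"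
  "f \<in> env_free \<Longrightarrow> pure_tensor f (v + w) - pure_tensor f v - pure_tensor f w \<in> balanced_rels"
  "f \<in> env_free \<Longrightarrow> s \<in> carrier (free_algebra (gl_nonneg m n)) \<Longrightarrow>
    pure_tensor (f * s) v - pure_tensor f (base_act_poly s v) \<in> balanced_rels"
proof -
  assume f: "f \<in> env_free"
  show "pure_tensor f (v + w) - pure_tensor f v - pure_tensor f w \<in> balanced_rels"
    using env_class_in[OF f] unfolding balanced_rels_def tensor_rels_def pure_tensor_def by blast
  show "g \<in> env_free \<Longrightarrow> pure_tensor (f + g) v - pure_tensor f v - pure_tensor g v \<in> balanced_rels"
    using env_class_in[OF f] env_class_in[of g] unfolding balanced_rels_def tensor_rels_def pure_tensor_def
    by (subst env_class_add[OF f, symmetric]) blast+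
  assume s: "s \<in> carrier (free_algebra (gl_nonneg m n))"
  show "pure_tensor (f * s) v - pure_tensor f (base_act_poly s v) \<in> balanced_rels"
    using env_class_in[OF f] s unfolding balanced_rels_def tensor_rels_def pure_tensor_def
    by (subst env_class_mult[OF f gl_nonneg_free[OF s], symmetric]) blast
qed

lemma balanced_rels_subset: "balanced_rels \<subseteq> pairs"
proof
  fix r assume "r \<in> balanced_rels"
  then show "r \<in> pairs"
    by (cases rule: balanced_rels_cases)
       (auto intro!: pairs_closed free_algebra_closed(3,6) dest: gl_nonneg_free)
qed

lemma balanced_span_subgroup: "subgroup balanced_span pair_group"
  unfolding balanced_span_def using balanced_rels_subset
  by (intro group.generate_is_subgroup) auto

lemma balanced_span_subset: "X \<in> balanced_span \<Longrightarrow> X \<in> pairs"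
  using subgroup.subset[OF balanced_span_subgroup] by blast

lemma pair_group_inv: "X \<in> pairs \<Longrightarrow> inv\<^bsub>pair_group\<^esub> X = - X"
  by (simp add: pair_group_def)

lemma balanced_span_closed:
  "0 \<in> balanced_span"
  "X \<in> balanced_span \<Longrightarrow> Y \<in> balanced_span \<Longrightarrow> X + Y \<in> balanced_span"
  "X \<in> balanced_span \<Longrightarrow> - X \<in> balanced_span"
  "X \<in> balanced_span \<Longrightarrow> Y \<in> balanced_span \<Longrightarrow> X - Y \<in> balanced_span"
  "r \<in> balanced_rels \<Longrightarrow> r \<in> balanced_span"
proof -
  show "0 \<in> balanced_span" using subgroup.one_closed[OF balanced_span_subgroup] by simp
  show plus: "X \<in> balanced_span \<Longrightarrow> Y \<in> balanced_span \<Longrightarrow> X + Y \<in> balanced_span" for X Y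
    using subgroup.m_closed[OF balanced_span_subgroup, of X Y] by simp
  show neg: "X \<in> balanced_span \<Longrightarrow> - X \<in> balanced_span" for X
    using subgroup.m_inv_closed[OF balanced_span_subgroup, of X] balanced_span_subset[of X]
    by (simp only: pair_group_inv)
  show "X \<in> balanced_span \<Longrightarrow> Y \<in> balanced_span \<Longrightarrow> X - Y \<in> balanced_span"
    using plus[of X "- Y"] neg[of Y] by simp
  show "r \<in> balanced_rels \<Longrightarrow> r \<in> balanced_span"
    unfolding balanced_span_def by (rule generate.incl)
qed

lemma balanced_span_induct [consumes 1, case_names rels zero add minus]:
  assumes "X \<in> balanced_span" "\<And>r. r \<in> balanced_rels \<Longrightarrow> P r" "P 0"
    "\<And>X Y. P X \<Longrightarrow> P Y \<Longrightarrow> P (X + Y)" "\<And>X. P X \<Longrightarrow> P (- X)"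
  shows "P X"
  using assms(1) unfolding balanced_span_def
proof (induction rule: generate.induct)
  case (inv r)
  then have "r \<in> pairs" using balanced_rels_subset by blast
  then show ?case using inv assms pair_group_inv by metis
qed (use assms in auto)

lemma tensor_eq_refl [simp]: "X \<doteq> X"
  by (simp add: tensor_eq_def balanced_span_closed)

lemma tensor_eq_sym: "X \<doteq> Y \<Longrightarrow> Y \<doteq> X"
  using balanced_span_closed(3)[of "X - Y"] by (simp add: tensor_eq_def)

lemma tensor_eq_trans [trans]: "X \<doteq> Y \<Longrightarrow> Y \<doteq> Z \<Longrightarrow> X \<doteq> Z"
  using balanced_span_closed(2)[of "X - Y" "Y - Z"] by (simp add: tensor_eq_def)

lemma tensor_eq_add: "X \<doteq> X' \<Longrightarrow> Y \<doteq> Y' \<Longrightarrow> X + Y \<doteq> X' + Y'"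
  using balanced_span_closed(2)[of "X - X'" "Y - Y'"] by (simp add: tensor_eq_def algebra_simps)

lemma tensor_eq_diff: "X \<doteq> X' \<Longrightarrow> Y \<doteq> Y' \<Longrightarrow> X - Y \<doteq> X' - Y'"
  using balanced_span_closed(4)[of "X - X'" "Y - Y'"] by (simp add: tensor_eq_def algebra_simps)

lemma tensor_eq_minus: "X \<doteq> Y \<Longrightarrow> - X \<doteq> - Y"
  using tensor_eq_diff[of 0 0 X Y] by simp

lemma tensor_eq_sum: "(\<And>a. a \<in> A \<Longrightarrow> X a \<doteq> Y a) \<Longrightarrow> sum X A \<doteq> sum Y A"
  by (induction A rule: infinite_finite_induct) (auto intro: tensor_eq_add)

lemma pure_tensor_rels:
  assumes "f \<in> env_free"
  shows "g \<in> env_free \<Longrightarrow> pure_tensor (f + g) v \<doteq> pure_tensor f v + pure_tensor g v"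
    "pure_tensor f (v + w) \<doteq> pure_tensor f v + pure_tensor f w"
    "s \<in> carrier (free_algebra (gl_nonneg m n)) \<Longrightarrow> pure_tensor (f * s) v \<doteq> pure_tensor f (base_act_poly s v)"
  using assms balanced_relsI[OF assms] unfolding tensor_eq_def
  by (auto intro!: balanced_span_closed(5) simp flip: diff_diff_eq)

lemma pure_tensor_cong: "f - g \<in> env_ideal m n \<Longrightarrow> pure_tensor f v = pure_tensor g v"
  unfolding pure_tensor_def by (simp add: env_class_eqI)

lemma pure_tensor_zero:
  assumes "f \<in> env_free"
  shows "pure_tensor f 0 \<doteq> 0"
  using balanced_span_closed(3)[OF balanced_span_closed(5)[OF balanced_relsI(2)[OF assms, of 0 0]]]
  by (simp add: tensor_eq_def)

lemma pure_tensor_ideal: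
  assumes "f \<in> env_ideal m n"
  shows "pure_tensor f v \<doteq> 0"
proof -
  have "pure_tensor f v = pure_tensor 0 v" using assms by (intro pure_tensor_cong) simp
  then show ?thesis
    using balanced_span_closed(3)[OF balanced_span_closed(5)[OF balanced_relsI(1)[of 0 0 v]]]
    by (simp add: tensor_eq_def)
qed

lemma pure_tensor_minus:
  assumes "f \<in> env_free"
  shows "pure_tensor f (- v) \<doteq> - pure_tensor f v"
proof -
  have "0 \<doteq> pure_tensor f v + pure_tensor f (- v)"
    using tensor_eq_trans[OF tensor_eq_sym[OF pure_tensor_zero[OF assms]]] pure_tensor_rels(2)[OF assms, of v "- v"]
    by simp
  from tensor_eq_diff[OF tensor_eq_sym[OF this] tensor_eq_refl[of "pure_tensor f v"]] show ?thesis
    by simp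
qed

lemma pure_tensor_minus_left:
  assumes "f \<in> env_free" "g \<in> env_free" "f + g \<in> env_ideal m n"
  shows "pure_tensor f v \<doteq> - pure_tensor g v"
proof -
  have "pure_tensor f v + pure_tensor g v \<doteq> 0"
    using tensor_eq_trans[OF tensor_eq_sym[OF pure_tensor_rels(1)[OF assms(1,2)]] pure_tensor_ideal[OF assms(3)]] .
  from tensor_eq_diff[OF this tensor_eq_refl[of "pure_tensor g v"]] show ?thesis by simp
qed

lemma pure_tensor_scale:
  assumes "f \<in> env_free"
  shows "pure_tensor (ncconst c * f) v \<doteq> pure_tensor f (scale c v)"
  using pure_tensor_rels(3)[OF assms, of "ncconst c" v] by (simp add: ncconst_central)

definition poly_mult :: "complex mat ncpoly \<Rightarrow> (complex mat ncpoly set \<times> 'v \<Rightarrow>\<^sub>0 int)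
    \<Rightarrow> complex mat ncpoly set \<times> 'v \<Rightarrow>\<^sub>0 int" where
  "poly_mult f = left_mult (env_class m n f)"

lemma poly_mult_pure [simp]:
  "f \<in> env_free \<Longrightarrow> g \<in> env_free \<Longrightarrow> poly_mult f (pure_tensor g v) = pure_tensor (f * g) v"
  by (simp add: poly_mult_def left_mult_def pure_tensor_def env_class_mult)

lemma poly_mult_additive [simp]:
  "poly_mult f 0 = 0" "poly_mult f (X + Y) = poly_mult f X + poly_mult f Y"
  "poly_mult f (X - Y) = poly_mult f X - poly_mult f Y" "poly_mult f (- X) = - poly_mult f X"
  by (simp_all add: poly_mult_def left_mult_def frag_extend_add frag_extend_diff frag_extend_minus)

lemma poly_mult_in_pairs:
  assumes "f \<in> env_free" "X \<in> pairs"
  shows "poly_mult f X \<in> pairs"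
  using assms(2)
proof (induction rule: pairs_induct)
  case (diff X Y)
  then show ?case unfolding poly_mult_additive by (intro pairs_closed(3))
qed (use assms in \<open>auto intro!: pairs_closed\<close>)

text \<open>Left multiplication maps each of the three families of tensor relations into itself.\<close>

lemma poly_mult_eq:
  assumes f: "f \<in> env_free" and XY: "X \<doteq> Y"
  shows "poly_mult f X \<doteq> poly_mult f Y"
proof -
  have span: "poly_mult f Z \<in> balanced_span" if "Z \<in> balanced_span" for Z
    using that
  proof (induction rule: balanced_span_induct)
    case (rels r)
    then show ?case
    proof (cases rule: balanced_rels_cases)
      case (left g h v)
      then have "poly_mult f r = pure_tensor (f * g + f * h) v - pure_tensor (f * g) v - pure_tensor (f * h) v"
        using f by (simp add: distrib_left)
      then show ?thesis using f left by (auto intro!: balanced_span_closed(5) balanced_relsI free_algebra_closed(6))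
    next
      case (right g v w)
      then show ?thesis using f by (auto intro!: balanced_span_closed(5) balanced_relsI free_algebra_closed(6))
    next
      case (middle g s v)
      then have "poly_mult f r = pure_tensor (f * g * s) v - pure_tensor (f * g) (base_act_poly s v)"
        using f gl_nonneg_free[OF middle(2)] by (simp add: mult.assoc)
      then show ?thesis using f middle by (auto intro!: balanced_span_closed(5) balanced_relsI free_algebra_closed(6))
    qed
  qed (simp_all add: balanced_span_closed)
  show ?thesis using span[of "X - Y"] XY unfolding tensor_eq_def poly_mult_additive .
qed

lemma poly_mult_mult:
  assumes "f \<in> env_free" "g \<in> env_free" "X \<in> pairs"
  shows "poly_mult f (poly_mult g X) = poly_mult (f * g) X"
  using assms(3) by (induction rule: pairs_induct) (use assms in \<open>auto simp: mult.assoc\<close>)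

lemma poly_mult_add:
  assumes "f \<in> env_free" "g \<in> env_free" "X \<in> pairs"
  shows "poly_mult (f + g) X \<doteq> poly_mult f X + poly_mult g X"
  using assms(3)
proof (induction rule: pairs_induct)
  case (pure h v)
  then show ?case using assms pure_tensor_rels(1)[of "f * h" "g * h" v] by (simp add: distrib_right)
next
  case (diff X Y)
  then show ?case using tensor_eq_diff[OF diff(3,4)] by (simp add: algebra_simps)
qed simp

lemma poly_mult_cong: "f - g \<in> env_ideal m n \<Longrightarrow> poly_mult f X = poly_mult g X"
  by (simp add: poly_mult_def env_class_eqI)

lemma poly_mult_diff:
  assumes "f \<in> env_free" "g \<in> env_free" "X \<in> pairs"
  shows "poly_mult (f - g) X \<doteq> poly_mult f X - poly_mult g X"
proof -
  have "poly_mult (f - g + g) X \<doteq> poly_mult (f - g) X + poly_mult g X"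
    using assms by (intro poly_mult_add) auto
  then have "poly_mult f X \<doteq> poly_mult (f - g) X + poly_mult g X" by simp
  from tensor_eq_diff[OF tensor_eq_sym[OF this] tensor_eq_refl[of "poly_mult g X"]] show ?thesis by simp
qed

lemma poly_mult_ideal: "f \<in> env_ideal m n \<Longrightarrow> X \<in> pairs \<Longrightarrow> poly_mult f X \<doteq> 0"
  using poly_mult_diff[of 0 0 X] poly_mult_cong[of f 0 X] by simp

end

section \<open>The map from the Fock space to the Kac module\<close>

context gl_zero_irrep
begin

text \<open>For an increasing list this is the Poincare-Birkhoff-Witt monomial of its elements.\<close>

definition lowering_monomial :: "nat list \<Rightarrow> complex mat ncpoly" where
  "lowering_monomial L = Poly_Mapping.single (Word (map f_vec L)) 1"

lemma lowering_monomial_Nil [simp]: "lowering_monomial [] = 1"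
  by (simp add: lowering_monomial_def flip: zero_word_def)

lemma lowering_monomial_Cons: "lowering_monomial (p # L) = ncvar (f_vec p) * lowering_monomial L"
  by (simp add: lowering_monomial_def ncvar_def mult_single plus_word_def)

lemma lowering_monomial_in [simp]: "set L \<subseteq> {..<N} \<Longrightarrow> lowering_monomial L \<in> env_free"
  unfolding lowering_monomial_def by (intro free_algebra_closed(9)) auto

lemma ncvar_f_vec [simp]: "p < N \<Longrightarrow> ncvar (f_vec p) \<in> env_free"
  by simp

lemma lowering_swap:
  assumes "p < N" "q < N" "set L \<subseteq> {..<N}"
  shows "lowering_monomial (p # q # L) + lowering_monomial (q # p # L) \<in> env_ideal m n"
proof -
  have "(ncvar (f_vec p) * ncvar (f_vec q) + ncvar (f_vec q) * ncvar (f_vec p)) * lowering_monomial L \<in> env_ideal m n"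
    using assms by (intro env_ideal_closed(6) env_rel_low_low) simp_all
  then show ?thesis by (simp add: lowering_monomial_Cons distrib_right mult.assoc)
qed

lemma lowering_square:
  assumes "p < N" "set L \<subseteq> {..<N}"
  shows "lowering_monomial (p # p # L) \<in> env_ideal m n"
proof -
  have "ncconst (1/2) * (lowering_monomial (p # p # L) + lowering_monomial (p # p # L)) \<in> env_ideal m n"
    using assms by (intro env_ideal_closed(5) lowering_swap) simp_all
  also have "ncconst (1/2) * (lowering_monomial (p # p # L) + lowering_monomial (p # p # L)) = lowering_monomial (p # p # L)"
    by (simp add: distrib_left flip: distrib_right)
  finally show ?thesis .
qed

lemma sorted_list_insert_least:
  "finite S \<Longrightarrow> (\<And>q. q \<in> S \<Longrightarrow> p < q) \<Longrightarrow> sorted_list_of_set (insert p S) = p # sorted_list_of_set S"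
proof -
  assume S: "finite S" and p: "\<And>q. q \<in> S \<Longrightarrow> p < q"
  then have "p \<notin> S" by blast
  moreover have "insort p (sorted_list_of_set S) = p # sorted_list_of_set S"
    using S p by (intro insort_is_Cons) (auto simp: less_imp_le)
  ultimately show ?thesis using S by simp
qed

lemma subset_sorted [simp]: "S \<subseteq> {..<N} \<Longrightarrow> set (sorted_list_of_set S) \<subseteq> {..<N}"
  using finite_subset[of S "{..<N}"] by simp

text \<open>The generator \<open>p\<close> is moved to the right until it is in place.  Each exchange costs a sign, and
  meeting its own copy gives zero because odd elements of degree \<open>-1\<close> square to zero.  So reordering
  in the enveloping algebra produces the signs of the creation operator.\<close>

lemma lowering_insert:
  assumes "finite S" "S \<subseteq> {..<N}" "p < N"
  shows "pure_tensor (lowering_monomial (p # sorted_list_of_set S)) v \<doteq>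
    (if p \<in> S then 0 else pure_tensor (lowering_monomial (sorted_list_of_set (insert p S))) (order_sign p S v))"
  using assms(1,2)
proof (induction S rule: finite_linorder_min_induct)
  case empty
  then show ?case by (simp add: order_sign_def)
next
  case (insert b A)
  have A: "A \<subseteq> {..<N}" "b < N" "finite A" "\<And>q. q \<in> A \<Longrightarrow> b < q" and bA: "b \<notin> A"
    using insert by auto
  let ?s = "sorted_list_of_set"
  have sl: "?s (insert b A) = b # ?s A" using A by (intro sorted_list_insert_least) auto
  have setA: "set (?s A) \<subseteq> {..<N}" using A by simp
  consider "p < b" | "p = b" | "b < p" by linarith
  then show ?case
  proof cases
    case 1
    then have "p \<notin> insert b A" "\<And>q. q \<in> insert b A \<Longrightarrow> p < q" using A by force+
    then have "?s (insert p (insert b A)) = p # ?s (insert b A)" "order_sign p (insert b A) v = v"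
      using A by (blast intro!: sorted_list_insert_least order_sign_least less_imp_le)+
    with \<open>p \<notin> insert b A\<close> show ?thesis by (simp del: sorted_list_of_set_insert_remove)
  next
    case 2
    then show ?thesis unfolding sl using lowering_square[OF A(2) setA] by (simp add: pure_tensor_ideal)
  next
    case 3
    have "pure_tensor (lowering_monomial (p # b # ?s A)) v \<doteq> - pure_tensor (lowering_monomial (b # p # ?s A)) v"
      using A setA assms(3) by (intro pure_tensor_minus_left lowering_swap) auto
    also have "pure_tensor (lowering_monomial (b # p # ?s A)) v
        = poly_mult (ncvar (f_vec b)) (pure_tensor (lowering_monomial (p # ?s A)) v)"
      using A setA assms(3) by (simp add: lowering_monomial_Cons[of b])
    also have "- \<dots> \<doteq> - poly_mult (ncvar (f_vec b))
        (if p \<in> A then 0 else pure_tensor (lowering_monomial (?s (insert p A))) (order_sign p A v))"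
      using A insert.IH by (intro tensor_eq_minus poly_mult_eq) simp_all
    also have "\<dots> \<doteq> (if p \<in> insert b A then 0
        else pure_tensor (lowering_monomial (?s (insert p (insert b A)))) (order_sign p (insert b A) v))"
    proof (cases "p \<in> A")
      case True
      then show ?thesis by simp
    next
      case False
      have "insert p (insert b A) = insert b (insert p A)" by auto
      then have eq: "?s (insert p (insert b A)) = b # ?s (insert p A)"
        using A 3 by (simp only:) (intro sorted_list_insert_least, auto)
      have "set (?s (insert p A)) \<subseteq> {..<N}" using A assms(3) by (intro subset_sorted) auto
      then have mem: "lowering_monomial (?s (insert p A)) \<in> env_free" by (rule lowering_monomial_in)
      then have mult: "poly_mult (ncvar (f_vec b)) (pure_tensor (lowering_monomial (?s (insert p A))) w)
          = pure_tensor (lowering_monomial (b # ?s (insert p A))) w" for w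
        using A(2) unfolding lowering_monomial_Cons by (intro poly_mult_pure) auto
      have "pure_tensor (lowering_monomial (b # ?s (insert p A))) (- order_sign p A v)
          \<doteq> - poly_mult (ncvar (f_vec b)) (pure_tensor (lowering_monomial (?s (insert p A))) (order_sign p A v))"
        unfolding mult using A(2) mem unfolding lowering_monomial_Cons
        by (intro pure_tensor_minus free_algebra_closed(6) ncvar_f_vec)
      then show ?thesis using False 3 bA unfolding eq
        by (auto simp: order_sign_insert simp del: sorted_list_of_set_insert_remove dest: tensor_eq_sym)
    qed
    finally show ?thesis unfolding sl .
  qed
qed

text \<open>The inverse of the isomorphism from the Kac module to the Fock space, on representatives.\<close>

definition fock_tensor :: "(nat set \<Rightarrow> 'v) \<Rightarrow> complex mat ncpoly set \<times> 'v \<Rightarrow>\<^sub>0 int" where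
  "fock_tensor F = (\<Sum>S\<in>Pow {..<N}. pure_tensor (lowering_monomial (sorted_list_of_set S)) (F S))"

lemma fock_tensor_in_pairs [simp]: "fock_tensor F \<in> pairs"
  unfolding fock_tensor_def by (intro pairs_sum pairs_closed) simp

lemma fock_tensor_add: "fock_tensor (F + G) \<doteq> fock_tensor F + fock_tensor G"
  unfolding fock_tensor_def sum.distrib[symmetric] pointwise
  by (intro tensor_eq_sum pure_tensor_rels) simp

lemma fock_tensor_basis:
  assumes "S \<subseteq> {..<N}"
  shows "fock_tensor (basis_vec S v) \<doteq> pure_tensor (lowering_monomial (sorted_list_of_set S)) v"
proof -
  have "fock_tensor (basis_vec S v) \<doteq> (\<Sum>T\<in>Pow {..<N}. if T = S then pure_tensor (lowering_monomial (sorted_list_of_set S)) v else 0)"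
    unfolding fock_tensor_def by (intro tensor_eq_sum) (auto simp: pure_tensor_zero)
  then show ?thesis using assms by simp
qed

lemma fock_tensor_zero: "fock_tensor 0 \<doteq> 0"
proof -
  have "fock_tensor 0 \<doteq> pure_tensor 1 0" using fock_tensor_basis[of "{}" 0] by simp
  also have "\<dots> \<doteq> 0" by (rule pure_tensor_zero) simp
  finally show ?thesis .
qed

lemma fock_tensor_minus: "fock_tensor (- F) \<doteq> - fock_tensor F"
  unfolding fock_tensor_def sum_negf[symmetric] pointwise
  by (intro tensor_eq_sum pure_tensor_minus) simp

lemma fock_tensor_diff: "fock_tensor (F - G) \<doteq> fock_tensor F - fock_tensor G"
proof -
  have "fock_tensor (F + - G) \<doteq> fock_tensor F + - fock_tensor G"
    by (rule tensor_eq_trans[OF fock_tensor_add tensor_eq_add[OF tensor_eq_refl fock_tensor_minus]])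
  then show ?thesis by simp
qed

lemma poly_mult_sum: "poly_mult f (sum X A) = (\<Sum>a\<in>A. poly_mult f (X a))"
  by (induction A rule: infinite_finite_induct) simp_all

lemma fock_tensor_scale: "fock_tensor (fscale c F) \<doteq> poly_mult (ncconst c) (fock_tensor F)"
  unfolding fock_tensor_def poly_mult_sum fock_scale_def
  by (intro tensor_eq_sum) (auto intro!: tensor_eq_sym[OF pure_tensor_scale])

lemma fock_tensor_creation:
  assumes "F \<in> fock N" "p < N"
  shows "fock_tensor (creation p F) \<doteq> poly_mult (ncvar (f_vec p)) (fock_tensor F)"
  using assms(1)
proof (induction rule: fock_basis_induct)
  case (basis S v)
  have S: "finite S" using basis finite_subset by blast
  have "fock_tensor (creation p (basis_vec S v)) \<doteq>
     (if p \<in> S then 0 else pure_tensor (lowering_monomial (sorted_list_of_set (insert p S))) (order_sign p S v))"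
    using basis assms(2) fock_tensor_basis[of "insert p S"]
    by (auto simp: creation_basis_vec fock_tensor_zero simp del: sorted_list_of_set_insert_remove)
  also have "\<dots> \<doteq> pure_tensor (lowering_monomial (p # sorted_list_of_set S)) v"
    using lowering_insert[OF S basis assms(2)] by (rule tensor_eq_sym)
  also have "pure_tensor (lowering_monomial (p # sorted_list_of_set S)) v
      = poly_mult (ncvar (f_vec p)) (pure_tensor (lowering_monomial (sorted_list_of_set S)) v)"
    using assms(2) basis by (simp add: lowering_monomial_Cons)
  also have "\<dots> \<doteq> poly_mult (ncvar (f_vec p)) (fock_tensor (basis_vec S v))"
    using assms(2) by (intro poly_mult_eq tensor_eq_sym[OF fock_tensor_basis] basis) simp
  finally show ?case .
next
  case (add F G)
  have "fock_tensor (creation p (F + G)) \<doteq> fock_tensor (creation p F) + fock_tensor (creation p G)"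
    by (simp add: fock_tensor_add)
  also have "\<dots> \<doteq> poly_mult (ncvar (f_vec p)) (fock_tensor F) + poly_mult (ncvar (f_vec p)) (fock_tensor G)"
    using add by (intro tensor_eq_add)
  also have "\<dots> = poly_mult (ncvar (f_vec p)) (fock_tensor F + fock_tensor G)" by simp
  also have "\<dots> \<doteq> poly_mult (ncvar (f_vec p)) (fock_tensor (F + G))"
    using assms(2) by (intro poly_mult_eq tensor_eq_sym[OF fock_tensor_add]) simp
  finally show ?case .
qed

lemma fock_tensor_low_op:
  assumes "y \<in> gl_low m n" "F \<in> fock N"
  shows "fock_tensor (low_op y F) \<doteq> poly_mult (ncvar y) (fock_tensor F)"
  using assms(1)
proof (induction rule: low_induct)
  case zero
  have "poly_mult (ncvar (0\<^sub>m (m + n) (m + n))) (fock_tensor F) \<doteq> 0"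
    by (intro poly_mult_ideal env_rel_zero) simp
  from tensor_eq_trans[OF fock_tensor_zero tensor_eq_sym[OF this]] show ?case by simp
next
  case (lowering k)
  then show ?case using assms(2) by (simp add: fock_tensor_creation)
next
  case (add y z)
  then have g: "y \<in> gl m n" "z \<in> gl m n" by (auto intro: graded_in_gl)
  have "fock_tensor (low_op (y + z) F) \<doteq> fock_tensor (low_op y F) + fock_tensor (low_op z F)"
    using g by (simp add: low_op_matrix fock_tensor_add)
  also have "\<dots> \<doteq> poly_mult (ncvar y) (fock_tensor F) + poly_mult (ncvar z) (fock_tensor F)"
    using add by (intro tensor_eq_add)
  also have "\<dots> \<doteq> poly_mult (ncvar y + ncvar z) (fock_tensor F)"
    using g by (intro tensor_eq_sym[OF poly_mult_add]) simp_all
  also have "\<dots> = poly_mult (ncvar (y + z)) (fock_tensor F)"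
    using g by (intro poly_mult_cong[symmetric] env_rel_add)
  finally show ?case .
next
  case (smult c y)
  then have g: "y \<in> gl m n" by (auto intro: graded_in_gl)
  have "fock_tensor (low_op (c \<cdot>\<^sub>m y) F) \<doteq> poly_mult (ncconst c) (fock_tensor (low_op y F))"
    using g by (simp add: low_op_matrix fock_tensor_scale)
  also have "\<dots> \<doteq> poly_mult (ncconst c) (poly_mult (ncvar y) (fock_tensor F))"
    using smult by (intro poly_mult_eq) simp_all
  also have "\<dots> = poly_mult (ncconst c * ncvar y) (fock_tensor F)"
    using g by (intro poly_mult_mult) simp_all
  also have "\<dots> = poly_mult (ncvar (c \<cdot>\<^sub>m y)) (fock_tensor F)"
    using g by (intro poly_mult_cong[symmetric] env_rel_smult)
  finally show ?case .
qed

lemma fock_tensor_vacuum: "fock_tensor (basis_vec {} v) \<doteq> pure_tensor 1 v"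
  using fock_tensor_basis[of "{}" v] by simp

lemma nonneg_of_graded:
  "x \<in> gl_zero m n \<Longrightarrow> x \<in> gl_nonneg m n"
  "x \<in> gl_up m n \<Longrightarrow> x \<in> gl_nonneg m n"
proof -
  assume x: "x \<in> gl_zero m n"
  show "x \<in> gl_nonneg m n"
    unfolding gl_nonneg_def using graded_entry(1)[OF _ _ x] graded_in_gl(1)[OF x] by (simp add: not_less)
next
  assume x: "x \<in> gl_up m n"
  show "x \<in> gl_nonneg m n"
    unfolding gl_nonneg_def using graded_entry(3)[OF _ _ x] graded_in_gl(2)[OF x] by (simp add: not_less)
qed

text \<open>An element of \<open>g\<^sub>0 + g\<^sub>1\<close> can be moved across the tensor sign.\<close>

lemma nonneg_on_vacuum:
  assumes "x \<in> gl_nonneg m n"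
  shows "poly_mult (ncvar x) (fock_tensor (basis_vec {} v)) \<doteq> pure_tensor 1 (\<rho> (zero_part m n x) v)"
proof -
  have x: "x \<in> gl m n" using assms by (rule graded_in_gl)
  have "poly_mult (ncvar x) (fock_tensor (basis_vec {} v)) \<doteq> poly_mult (ncvar x) (pure_tensor 1 v)"
    using x by (intro poly_mult_eq fock_tensor_vacuum) simp
  also have "\<dots> = pure_tensor (1 * ncvar x) v" using x by simp
  also have "\<dots> \<doteq> pure_tensor 1 (base_act_poly (ncvar x) v)"
    using assms by (intro pure_tensor_rels(3)) simp_all
  also have "base_act_poly (ncvar x) v = \<rho> (zero_part m n x) v" by simp
  finally show ?thesis .
qed

lemma fock_tensor_additive_step:
  assumes "fock_tensor (t F) \<doteq> poly_mult f (fock_tensor F)" "fock_tensor (t G) \<doteq> poly_mult f (fock_tensor G)"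
    and "t (F + G) = t F + t G" "f \<in> env_free"
  shows "fock_tensor (t (F + G)) \<doteq> poly_mult f (fock_tensor (F + G))"
proof -
  have "fock_tensor (t (F + G)) \<doteq> fock_tensor (t F) + fock_tensor (t G)"
    using assms by (simp add: fock_tensor_add)
  also have "\<dots> \<doteq> poly_mult f (fock_tensor F) + poly_mult f (fock_tensor G)"
    using assms by (intro tensor_eq_add)
  also have "\<dots> = poly_mult f (fock_tensor F + fock_tensor G)" by simp
  also have "\<dots> \<doteq> poly_mult f (fock_tensor (F + G))"
    using assms by (intro poly_mult_eq tensor_eq_sym[OF fock_tensor_add]) simp
  finally show ?thesis .
qed

text \<open>As for the bracket relations, the claim is clear on the vacuum and propagates along creation
  operators, which by \<open>fock_tensor_creation\<close> become left multiplications: commuting \<open>x\<close> past \<open>f\<^sub>p\<close> is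
  the same computation in the enveloping algebra and on the Fock space.\<close>

lemma fock_tensor_zero_op:
  assumes x: "x \<in> gl_zero m n" and F: "F \<in> fock N"
  shows "fock_tensor (zero_op x F) \<doteq> poly_mult (ncvar x) (fock_tensor F)"
  using F
proof (induction rule: fock_induct)
  case (vacuum v)
  have "fock_tensor (zero_op x (basis_vec {} v)) \<doteq> pure_tensor 1 (\<rho> x v)"
    using x by (simp add: zero_op_vacuum fock_tensor_vacuum)
  also have "\<dots> \<doteq> poly_mult (ncvar x) (fock_tensor (basis_vec {} v))"
    using nonneg_on_vacuum[OF nonneg_of_graded(1)[OF x], of v] x by (simp add: zero_part_of tensor_eq_sym)
  finally show ?case .
next
  case (add F G)
  then show ?case using x by (intro fock_tensor_additive_step) (simp_all add: zero_op_linear graded_in_gl)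
next
  case (creation p F)
  let ?f = "f_vec p" and ?X = "fock_tensor F"
  have g: "ncvar x \<in> env_free" "ncvar ?f \<in> env_free" "ncvar (commutator x ?f) \<in> env_free"
    using graded_in_gl(1)[OF x] f_vec_in[OF creation(2)] by simp_all
  have "fock_tensor (zero_op x (creation p F)) \<doteq> fock_tensor (creation p (zero_op x F)) + fock_tensor (low_op (commutator x ?f) F)"
    using x creation by (simp add: zero_op_creation fock_tensor_add)
  also have "\<dots> \<doteq> poly_mult (ncvar ?f) (fock_tensor (zero_op x F)) + poly_mult (ncvar (commutator x ?f)) ?X"
    using x creation by (intro tensor_eq_add fock_tensor_creation fock_tensor_low_op) simp_all
  also have "\<dots> \<doteq> poly_mult (ncvar ?f) (poly_mult (ncvar x) ?X) + poly_mult (ncvar (commutator x ?f)) ?X"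
    using g creation by (intro tensor_eq_add poly_mult_eq) simp_all
  also have "\<dots> = poly_mult (ncvar ?f * ncvar x) ?X + poly_mult (ncvar (commutator x ?f)) ?X"
    using g by (simp add: poly_mult_mult)
  also have "\<dots> \<doteq> poly_mult (ncvar ?f * ncvar x + ncvar (commutator x ?f)) ?X"
    using g by (intro tensor_eq_sym[OF poly_mult_add] free_algebra_closed(6) fock_tensor_in_pairs)
  also have "\<dots> = poly_mult (ncvar x * ncvar ?f) ?X"
    using x creation by (intro poly_mult_cong[symmetric] env_rel_even) simp_all
  also have "\<dots> = poly_mult (ncvar x) (poly_mult (ncvar ?f) ?X)"
    using g by (simp add: poly_mult_mult)
  also have "\<dots> \<doteq> poly_mult (ncvar x) (fock_tensor (creation p F))"
    by (rule poly_mult_eq[OF g(1) tensor_eq_sym[OF fock_tensor_creation[OF creation(1,2)]]])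
  finally show ?case .
qed

lemma fock_tensor_up_op:
  assumes e: "e \<in> gl_up m n" and F: "F \<in> fock N"
  shows "fock_tensor (up_op e F) \<doteq> poly_mult (ncvar e) (fock_tensor F)"
  using F
proof (induction rule: fock_induct)
  case (vacuum v)
  have "poly_mult (ncvar e) (fock_tensor (basis_vec {} v)) \<doteq> pure_tensor 1 (\<rho> (zero_part m n e) v)"
    by (rule nonneg_on_vacuum[OF nonneg_of_graded(2)[OF e]])
  also have "\<rho> (zero_part m n e) v = 0" using e by (simp add: zero_part_of rep_zero)
  also have "pure_tensor 1 0 \<doteq> 0" by (rule pure_tensor_zero) simp
  also have "0 \<doteq> fock_tensor (up_op e (basis_vec {} v))"
    using e fock_tensor_zero by (simp add: up_op_vacuum tensor_eq_sym)
  finally show ?case by (rule tensor_eq_sym)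
next
  case (add F G)
  then show ?case using e by (intro fock_tensor_additive_step) (simp_all add: up_op_linear graded_in_gl)
next
  case (creation p F)
  let ?f = "f_vec p" and ?X = "fock_tensor F"
  have g: "ncvar e \<in> env_free" "ncvar ?f \<in> env_free" "ncvar (anticommutator e ?f) \<in> env_free"
    using graded_in_gl(2)[OF e] f_vec_in[OF creation(2)] by simp_all
  have "fock_tensor (up_op e (creation p F)) \<doteq> fock_tensor (zero_op (anticommutator e ?f) F) - fock_tensor (creation p (up_op e F))"
    using e creation by (simp add: up_op_creation fock_tensor_diff)
  also have "\<dots> \<doteq> poly_mult (ncvar (anticommutator e ?f)) ?X - poly_mult (ncvar ?f) (fock_tensor (up_op e F))"
    using e creation by (intro tensor_eq_diff fock_tensor_creation fock_tensor_zero_op) simp_all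
  also have "\<dots> \<doteq> poly_mult (ncvar (anticommutator e ?f)) ?X - poly_mult (ncvar ?f) (poly_mult (ncvar e) ?X)"
    using g creation by (intro tensor_eq_diff poly_mult_eq) simp_all
  also have "\<dots> = poly_mult (ncvar (anticommutator e ?f)) ?X - poly_mult (ncvar ?f * ncvar e) ?X"
    using g by (simp add: poly_mult_mult)
  also have "\<dots> \<doteq> poly_mult (ncvar (anticommutator e ?f) - ncvar ?f * ncvar e) ?X"
    using g by (intro tensor_eq_sym[OF poly_mult_diff] free_algebra_closed(6) fock_tensor_in_pairs)
  also have "\<dots> = poly_mult (ncvar e * ncvar ?f) ?X"
    using e creation by (intro poly_mult_cong[symmetric] env_rel_odd) (simp_all add: odd_of_graded)
  also have "\<dots> = poly_mult (ncvar e) (poly_mult (ncvar ?f) ?X)"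
    using g by (simp add: poly_mult_mult)
  also have "\<dots> \<doteq> poly_mult (ncvar e) (fock_tensor (creation p F))"
    by (rule poly_mult_eq[OF g(1) tensor_eq_sym[OF fock_tensor_creation[OF creation(1,2)]]])
  finally show ?case .
qed

text \<open>Every matrix is the sum of its parts of degree \<open>0\<close>, \<open>1\<close> and \<open>-1\<close>.\<close>

theorem fock_tensor_gl_op:
  assumes x: "x \<in> gl m n" and F: "F \<in> fock N"
  shows "fock_tensor (gl_op x F) \<doteq> poly_mult (ncvar x) (fock_tensor F)"
proof -
  let ?X = "fock_tensor F"
  let ?z = "zero_part m n x" and ?u = "up_part m n x" and ?l = "low_part m n x"
  have g: "ncvar ?z \<in> env_free" "ncvar ?u \<in> env_free" "ncvar ?l \<in> env_free" "ncvar (?z + ?u) \<in> env_free"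
    by (intro free_algebra_closed(8) gl_closed parts_in_gl)+
  have "fock_tensor (gl_op x F) \<doteq> fock_tensor (zero_op ?z F) + fock_tensor (up_op ?u F) + fock_tensor (low_op ?l F)"
    unfolding gl_op_def fock_restrict(2)[OF F]
    by (rule tensor_eq_trans[OF fock_tensor_add tensor_eq_add[OF fock_tensor_add tensor_eq_refl]])
  also have "\<dots> \<doteq> poly_mult (ncvar ?z) ?X + poly_mult (ncvar ?u) ?X + poly_mult (ncvar ?l) ?X"
    using F by (intro tensor_eq_add fock_tensor_zero_op fock_tensor_up_op fock_tensor_low_op) simp_all
  also have "\<dots> \<doteq> poly_mult (ncvar ?z + ncvar ?u) ?X + poly_mult (ncvar ?l) ?X"
    using g by (intro tensor_eq_add tensor_eq_refl tensor_eq_sym[OF poly_mult_add]) simp_all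
  also have "poly_mult (ncvar ?z + ncvar ?u) ?X = poly_mult (ncvar (?z + ?u)) ?X"
    by (intro poly_mult_cong[symmetric] env_rel_add) simp_all
  also have "poly_mult (ncvar (?z + ?u)) ?X + poly_mult (ncvar ?l) ?X \<doteq> poly_mult (ncvar (?z + ?u) + ncvar ?l) ?X"
    using g by (intro tensor_eq_sym[OF poly_mult_add]) simp_all
  also have "\<dots> = poly_mult (ncvar (?z + ?u + ?l)) ?X"
    by (intro poly_mult_cong[symmetric] env_rel_add) simp_all
  also have "\<dots> = poly_mult (ncvar x) ?X" unfolding parts_decomposition[OF x] ..
  finally show ?thesis .
qed

end

section \<open>Highest weight vectors and odd roots\<close>

context gl_zero_irrep
begin

lemma raising_lowering_entry:
  assumes "k < N" "p < N" "r < m + n" "s < m + n"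
  shows "(e_vec k * f_vec p) $$ (r, s)
    = (if root_row m n k = root_row m n p \<and> r = root_col n k \<and> s = root_col n p then 1 else 0)"
proof -
  have "(e_vec k * f_vec p) $$ (r, s) = (\<Sum>t<m+n. e_vec k $$ (r, t) * f_vec p $$ (t, s))"
    using assms by (intro gl_mult_entry) (auto intro: graded_in_gl(2)[OF root_vectors_in(2)])
  also have "\<dots> = (\<Sum>t<m+n. if t = root_row m n k then
      (if root_row m n k = root_row m n p \<and> r = root_col n k \<and> s = root_col n p then 1 else 0) else 0)"
    using assms by (intro sum.cong) (auto simp: root_vectors_entry)
  also have "\<dots> = (if root_row m n k = root_row m n p \<and> r = root_col n k \<and> s = root_col n p then 1 else 0)"
    using assms by simp
  finally show ?thesis .
qed

lemma lowering_raising_entry: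
  assumes "k < N" "p < N" "r < m + n" "s < m + n"
  shows "(f_vec p * e_vec k) $$ (r, s)
    = (if root_col n k = root_col n p \<and> r = root_row m n p \<and> s = root_row m n k then 1 else 0)"
proof -
  have "(f_vec p * e_vec k) $$ (r, s) = (\<Sum>t<m+n. f_vec p $$ (r, t) * e_vec k $$ (t, s))"
    using assms by (intro gl_mult_entry) (auto intro: graded_in_gl(2)[OF root_vectors_in(2)])
  also have "\<dots> = (\<Sum>t<m+n. if t = root_col n k then
      (if root_col n k = root_col n p \<and> r = root_row m n p \<and> s = root_row m n k then 1 else 0) else 0)"
    using assms by (intro sum.cong) (auto simp: root_vectors_entry)
  also have "\<dots> = (if root_col n k = root_col n p \<and> r = root_row m n p \<and> s = root_row m n k then 1 else 0)"
    using assms by simp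
  finally show ?thesis .
qed

lemma bracket_entry:
  assumes "k < N" "p < N" "r < m + n" "s < m + n"
  shows "anticommutator (e_vec k) (f_vec p) $$ (r, s)
    = (if root_row m n k = root_row m n p \<and> r = root_col n k \<and> s = root_col n p then 1 else 0)
    + (if root_col n k = root_col n p \<and> r = root_row m n p \<and> s = root_row m n k then 1 else 0)"
proof -
  have "e_vec k \<in> gl m n" "f_vec p \<in> gl m n" using assms by (auto intro: graded_in_gl(2)[OF root_vectors_in(2)])
  then show ?thesis
    using assms by (simp add: gl_entry[where m = m and n = n] raising_lowering_entry lowering_raising_entry)
qed

lemma zero_lowering_commutator_entry:
  assumes x: "x \<in> gl_zero m n" and p: "p < N" and r: "r < N"
  shows "commutator x (f_vec p) $$ (root_row m n r, root_col n r)
    = (if root_col n p = root_col n r then x $$ (root_row m n r, root_row m n p) else 0)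
      - (if root_row m n p = root_row m n r then x $$ (root_col n p, root_col n r) else 0)"
proof -
  have g: "x \<in> gl m n" "f_vec p \<in> gl m n" using x p by (auto intro: graded_in_gl)
  have "(x * f_vec p) $$ (root_row m n r, root_col n r)
      = (\<Sum>t<m+n. x $$ (root_row m n r, t) * f_vec p $$ (t, root_col n r))"
    using g r by (intro gl_mult_entry) auto
  also have "\<dots> = (\<Sum>t<m+n. if t = root_row m n p then
       (if root_col n p = root_col n r then x $$ (root_row m n r, root_row m n p) else 0) else 0)"
    using r by (intro sum.cong) (auto simp: root_vectors_entry)
  also have "\<dots> = (if root_col n p = root_col n r then x $$ (root_row m n r, root_row m n p) else 0)"
    using p by simp
  finally have 1: "(x * f_vec p) $$ (root_row m n r, root_col n r)
     = (if root_col n p = root_col n r then x $$ (root_row m n r, root_row m n p) else 0)" .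
  have "(f_vec p * x) $$ (root_row m n r, root_col n r)
      = (\<Sum>t<m+n. f_vec p $$ (root_row m n r, t) * x $$ (t, root_col n r))"
    using g r by (intro gl_mult_entry) auto
  also have "\<dots> = (\<Sum>t<m+n. if t = root_col n p then
       (if root_row m n p = root_row m n r then x $$ (root_col n p, root_col n r) else 0) else 0)"
    using r by (intro sum.cong) (auto simp: root_vectors_entry)
  also have "\<dots> = (if root_row m n p = root_row m n r then x $$ (root_col n p, root_col n r) else 0)"
    using p by simp
  finally have 2: "(f_vec p * x) $$ (root_row m n r, root_col n r)
     = (if root_row m n p = root_row m n r then x $$ (root_col n p, root_col n r) else 0)" .
  show ?thesis
    using g r by (simp add: gl_entry[where m = m and n = n] 1 2)
qed

lemma root_order:
  assumes "k < p" "p < N"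
  shows "root_col n k < root_col n p \<or> root_col n k = root_col n p \<and> root_row m n p < root_row m n k"
proof -
  have n: "n > 0" using assms by (cases n) auto
  have le: "root_col n k \<le> root_col n p" using assms by (simp add: root_col_def div_le_mono)
  have "root_row m n p < root_row m n k" if "k div n = p div n"
  proof -
    have "k mod n < p mod n"
      using that assms by (metis div_mult_mod_eq nat_add_left_cancel_less)
    moreover have "p mod n < n" using n by simp
    ultimately show ?thesis unfolding root_row_def by linarith
  qed
  then show ?thesis using le by (auto simp: root_col_def)
qed

lemma root_order_col:
  assumes "root_col n k < root_col n r"
  shows "k < r"
  using assms unfolding root_col_def by (meson div_le_mono leD leI)

lemma low_op_basis:
  "low_op y (basis_vec U w) = (\<Sum>r<N. fscale (y $$ (root_row m n r, root_col n r)) (creation r (basis_vec U w)))"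
  by (simp add: low_op_def)

lemma low_op_basis_vanish:
  assumes "\<And>r. r < N \<Longrightarrow> y $$ (root_row m n r, root_col n r) \<noteq> 0 \<Longrightarrow> r \<in> U"
  shows "low_op y (basis_vec U w) = 0"
  unfolding low_op_basis
proof (intro sum.neutral ballI)
  fix r assume "r \<in> {..<N}"
  then show "fscale (y $$ (root_row m n r, root_col n r)) (creation r (basis_vec U w)) = 0"
    using assms[of r] by (cases "y $$ (root_row m n r, root_col n r) = 0") (auto simp: creation_basis_vec)
qed

definition highest :: "'v \<Rightarrow> bool" where
  "highest v \<longleftrightarrow> v \<noteq> 0 \<and>
     (\<forall>x \<in> gl_zero m n. (\<forall>i < m + n. \<forall>j \<le> i. x $$ (i, j) = 0) \<longrightarrow> \<rho> x v = 0) \<and>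
     (\<forall>h \<in> gl_zero m n. diagonal_mat h \<longrightarrow> \<rho> h v = scale (\<Sum>i < m + n. of_int (\<Lambda> $ i) * h $$ (i, i)) v)"

text \<open>The pairing of \<open>\<Lambda> + \<rho>\<close> with the positive odd root opposite to the root vector \<open>k\<close>: the first two
  summands come from \<open>\<Lambda>\<close>, the other two from \<open>\<rho>\<close>.\<close>

definition root_value :: "nat \<Rightarrow> int" where
  "root_value k = \<Lambda> $ root_col n k + \<Lambda> $ root_row m n k
     + (int m - 1 - int (root_col n k)) - (int (root_row m n k) - int m)"

text \<open>For \<open>p > k\<close> the bracket of \<open>e\<^sub>k\<close> with \<open>f\<^sub>p\<close> is strictly upper triangular, so it kills \<open>v\<close>.  Bracketing
  it further with some \<open>f\<^sub>q\<close>, \<open>q > k\<close>, gives a combination of vectors \<open>f\<^sub>r\<close>, where \<open>r > k\<close> differs from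
  \<open>p\<close> and \<open>q\<close>.  The exterior monomial still contains these \<open>f\<^sub>r\<close>, so multiplying by them gives zero.\<close>

lemma up_op_tail_vanish:
  assumes v: "highest v" and k: "k < N"
  shows "up_op (e_vec k) (basis_vec {Suc k..<N} v) = 0"
proof -
  let ?T = "{Suc k..<N}"
  have e: "e_vec k \<in> gl_up m n" using k by simp
  have "fock_lift (\<rho> (anticommutator (e_vec k) (f_vec p))) (annihilation p (basis_vec ?T v)) = 0" if p: "p < N" for p
  proof (cases "p \<in> ?T")
    case True
    let ?x = "anticommutator (e_vec k) (f_vec p)"
    have x: "?x \<in> gl_zero m n" using e p by simp
    have "?x $$ (i, j) = 0" if "i < m + n" "j \<le> i" for i j
    proof -
      have "j < m + n" using that by simp
      from bracket_entry[OF k p that(1) this] show ?thesis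
        using root_order[of k p] True that p k
        by (auto split: if_splits dest: arg_cong)
    qed
    then have "\<rho> ?x v = 0" using v x unfolding highest_def by blast
    then show ?thesis using x True
      by (simp add: annihilation_basis_vec basis_vec_lift order_sign_def rep_linear)
  next
    case False
    then show ?thesis using e p by (simp add: annihilation_basis_vec fock_lift_additive)
  qed
  moreover have "low_op (commutator (anticommutator (e_vec k) (f_vec q)) (f_vec p)) (annihilation p (annihilation q (basis_vec ?T v))) = 0"
    if p: "p < N" and q: "q < N" for p q
  proof (cases "p \<in> ?T \<and> q \<in> ?T \<and> p \<noteq> q")
    case True
    have x: "anticommutator (e_vec k) (f_vec q) \<in> gl_zero m n" using e q by simp
    have "r \<in> ?T - {q} - {p}" if r: "r < N" and
      nz: "commutator (anticommutator (e_vec k) (f_vec q)) (f_vec p) $$ (root_row m n r, root_col n r) \<noteq> 0" for r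
    proof -
      have bounds: "root_row m n t < m + n" "root_col n t < m + n" "\<not> root_row m n t < m" "root_col n t < m" if "t < N" for t
        using that by auto
      have kp: "root_col n k < root_col n p \<or> root_col n k = root_col n p \<and> root_row m n p < root_row m n k"
        and kq: "root_col n k < root_col n q \<or> root_col n k = root_col n q \<and> root_row m n q < root_row m n k"
        using root_order True by auto
      have ne: "root_row m n t \<noteq> root_col n u" if "t < N" "u < N" for t u
        using bounds[OF that(1)] bounds[OF that(2)] by metis
      have diff_if: "P \<and> a \<noteq> 0 \<or> Q \<and> b \<noteq> 0"
        if "(if P then a else 0) - (if Q then b else 0) \<noteq> 0" for P Q and a b :: complex
        using that by (auto split: if_splits)
      have row: "root_col n k = root_col n q \<and> root_row m n r = root_row m n q \<and> root_row m n p = root_row m n k"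
        if "anticommutator (e_vec k) (f_vec q) $$ (root_row m n r, root_row m n p) \<noteq> 0"
        using that ne[OF r k] unfolding bracket_entry[OF k q bounds(1)[OF r] bounds(1)[OF p]]
        by (simp split: if_splits)
      have col: "root_row m n k = root_row m n q \<and> root_col n p = root_col n k \<and> root_col n r = root_col n q"
        if "anticommutator (e_vec k) (f_vec q) $$ (root_col n p, root_col n r) \<noteq> 0"
        using that ne[OF q p, symmetric] unfolding bracket_entry[OF k q bounds(2)[OF p] bounds(2)[OF r]]
        by (simp split: if_splits)
      have "root_col n p = root_col n r \<and> anticommutator (e_vec k) (f_vec q) $$ (root_row m n r, root_row m n p) \<noteq> 0
          \<or> root_row m n p = root_row m n r \<and> anticommutator (e_vec k) (f_vec q) $$ (root_col n p, root_col n r) \<noteq> 0"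
        using nz unfolding zero_lowering_commutator_entry[OF x p r] by (rule diff_if)
      then consider
          "root_col n p = root_col n r" "root_col n k = root_col n q" "root_row m n r = root_row m n q" "root_row m n p = root_row m n k"
        | "root_row m n p = root_row m n r" "root_row m n k = root_row m n q" "root_col n p = root_col n k" "root_col n r = root_col n q"
        using row col by blast
      then show ?thesis
      proof cases
        case 1
        have "root_col n k < root_col n r" using kp kq 1 by (metis less_irrefl)
        moreover from this have "r \<noteq> p" "r \<noteq> q" using kp kq 1 by (metis less_irrefl)+
        ultimately show ?thesis using root_order_col[of k r] r by simp
      next
        case 2
        have "root_col n k < root_col n r" using kp kq 2 by (metis less_irrefl)
        moreover from this have "r \<noteq> p" "r \<noteq> q" using kp kq 2 by (metis less_irrefl)+
        ultimately show ?thesis using root_order_col[of k r] r by simp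
      qed
    qed
    then have "low_op (commutator (anticommutator (e_vec k) (f_vec q)) (f_vec p)) (basis_vec (?T - {q} - {p}) w) = 0" for w
      by (rule low_op_basis_vanish)
    then show ?thesis using True by (simp add: annihilation_basis_vec)
  next
    case False
    then show ?thesis by (auto simp: annihilation_basis_vec)
  qed
  ultimately show ?thesis by (simp add: up_op_def)
qed

lemma diagonal_commutator:
  assumes h: "h \<in> gl_zero m n" "diagonal_mat h" and p: "p < N"
  shows "low_op (commutator h (f_vec p)) F
    = fscale (h $$ (root_row m n p, root_row m n p) - h $$ (root_col n p, root_col n p)) (creation p F)"
proof -
  have "commutator h (f_vec p) $$ (root_row m n r, root_col n r)
     = (if r = p then h $$ (root_row m n p, root_row m n p) - h $$ (root_col n p, root_col n p) else 0)" if r: "r < N" for r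
  proof -
    have hz: "h $$ (i, j) = 0" if "i < m + n" "j < m + n" "i \<noteq> j" for i j
      using h that graded_in_gl(1)[OF h(1)] by (auto simp: diagonal_mat_def gl_def)
    show ?thesis
      unfolding zero_lowering_commutator_entry[OF h(1) p r]
      using root_eq_iff[OF p r] hz[of "root_row m n r" "root_row m n p"] hz[of "root_col n p" "root_col n r"] p r
      by auto
  qed
  then have "low_op (commutator h (f_vec p)) F = (\<Sum>r<N. if r = p then
     fscale (h $$ (root_row m n p, root_row m n p) - h $$ (root_col n p, root_col n p)) (creation p F) else 0)"
    unfolding low_op_def by (intro sum.cong) auto
  then show ?thesis using p by simp
qed

lemma card_root_row:
  assumes k: "k < N"
  shows "card {p \<in> {Suc k..<N}. root_row m n p = root_row m n k} = m - 1 - root_col n k"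
proof -
  have n: "n > 0" using k by (cases n) auto
  have "{p \<in> {Suc k..<N}. root_row m n p = root_row m n k} = (\<lambda>t. t * n + k mod n) ` {Suc (k div n)..<m}"
  proof (rule Set.set_eqI, rule iffI)
    fix p assume "p \<in> {p \<in> {Suc k..<N}. root_row m n p = root_row m n k}"
    then have p: "k < p" "p < N" "root_row m n p = root_row m n k" by auto
    have "root_col n k < root_col n p" using root_order[OF p(1,2)] p(3) by auto
    moreover have "root_col n p < m" using p by simp
    moreover have "p mod n = k mod n"
    proof -
      have "p mod n < n" "k mod n < n" using n by auto
      then show ?thesis using p(3) unfolding root_row_def by linarith
    qed
    moreover have "p = p div n * n + p mod n" by simp
    ultimately show "p \<in> (\<lambda>t. t * n + k mod n) ` {Suc (k div n)..<m}"
      unfolding root_col_def by (intro image_eqI[of _ _ "p div n"]) auto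
  next
    fix p assume "p \<in> (\<lambda>t. t * n + k mod n) ` {Suc (k div n)..<m}"
    then obtain t where "p = t * n + k mod n" "t \<in> {Suc (k div n)..<m}" by blast
    then have t: "p = t * n + k mod n" "k div n < t" "t < m" by auto
    have kn: "k mod n < n" using n by simp
    have "p < N"
    proof -
      have "p < t * n + n" using t kn by simp
      also have "\<dots> = Suc t * n" by simp
      also have "\<dots> \<le> m * n" using t by (intro mult_right_mono) auto
      finally show ?thesis .
    qed
    moreover have "p div n = t" "p mod n = k mod n" using t kn by auto
    moreover have "k < p" using root_order_col[of k p] t calculation by (simp add: root_col_def)
    ultimately show "p \<in> {p \<in> {Suc k..<N}. root_row m n p = root_row m n k}"
      by (simp add: root_row_def)
  qed
  moreover have "inj_on (\<lambda>t. t * n + k mod n) {Suc (k div n)..<m}"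
    using n by (auto simp: inj_on_def)
  ultimately show ?thesis by (simp add: card_image root_col_def)
qed

lemma card_root_col:
  assumes k: "k < N"
  shows "card {p \<in> {Suc k..<N}. root_col n p = root_col n k} = root_row m n k - m"
proof -
  have n: "n > 0" using k by (cases n) auto
  have kn: "k mod n < n" using n by simp
  have top: "k div n * n + n \<le> N"
  proof -
    have "Suc (k div n) \<le> m" using k by (simp add: less_mult_imp_div_less Suc_le_eq)
    from mult_right_mono[OF this, of n] show ?thesis by simp
  qed
  have "{p \<in> {Suc k..<N}. root_col n p = root_col n k} = {Suc k..<k div n * n + n}"
  proof (rule Set.set_eqI, rule iffI)
    fix p assume "p \<in> {p \<in> {Suc k..<N}. root_col n p = root_col n k}"
    then have "k < p" "p div n = k div n" by (auto simp: root_col_def)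
    moreover have "p = p div n * n + p mod n" "p mod n < n" using n by simp_all
    ultimately show "p \<in> {Suc k..<k div n * n + n}" by auto
  next
    fix p assume p: "p \<in> {Suc k..<k div n * n + n}"
    then have "k div n \<le> p div n" by (intro div_le_mono) auto
    moreover have "p div n < Suc (k div n)"
      using p n by (simp add: less_mult_imp_div_less)
    ultimately have "p div n = k div n" by simp
    then show "p \<in> {p \<in> {Suc k..<N}. root_col n p = root_col n k}"
      using p top by (auto simp: root_col_def)
  qed
  moreover have "k div n * n + n - Suc k = n - Suc (k mod n)"
    using kn div_mult_mod_eq[of k n] by linarith
  moreover have "root_row m n k - m = n - Suc (k mod n)"
    using kn unfolding root_row_def by linarith
  ultimately show ?thesis by (metis card_atLeastLessThan)
qed

text \<open>The operator \<open>e\<^sub>k\<close> kills the product of the later \<open>f\<^sub>p\<close> applied to \<open>v\<close>, so only the bracket of \<open>e\<^sub>k\<close> with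
  \<open>f\<^sub>k\<close> contributes.  It is a diagonal matrix, and acts by the value of the weight, which is \<open>\<Lambda>\<close> minus
  the sum of the odd roots that have been subtracted.  The numbers of those in the same row and
  in the same column as \<open>k\<close> give the two summands of \<open>root_value\<close> that come from \<open>\<rho>\<close>.\<close>

lemma raising_tail:
  assumes v: "highest v" and k: "k < N"
  shows "up_op (e_vec k) (basis_vec {k..<N} v) = fscale (of_int (root_value k)) (basis_vec {Suc k..<N} v)"
proof -
  let ?T = "{Suc k..<N}" and ?i = "root_col n k" and ?a = "root_row m n k"
  let ?h = "anticommutator (e_vec k) (f_vec k)"
  have e: "e_vec k \<in> gl_up m n" using k by simp
  have h: "?h \<in> gl_zero m n" using k by simp
  have hentry: "?h $$ (r, s) = (if r = ?i \<and> s = ?i then 1 else 0) + (if r = ?a \<and> s = ?a then 1 else 0)"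
    if "r < m + n" "s < m + n" for r s
    using bracket_entry[OF k k that] by simp
  have diag: "diagonal_mat ?h"
    using graded_in_gl(1)[OF h] k unfolding diagonal_mat_def by (auto simp: gl_def hentry simp del: index_add_mat)
  have ia: "?i \<noteq> ?a" using root_bounds[OF k] by linarith
  have "\<rho> ?h v = scale (\<Sum>r<m+n. of_int (\<Lambda> $ r) * ?h $$ (r, r)) v"
    using v h diag unfolding highest_def by blast
  also have "(\<Sum>r<m+n. of_int (\<Lambda> $ r) * ?h $$ (r, r))
      = (\<Sum>r<m+n. (if r = ?i then of_int (\<Lambda> $ ?i) else 0) + (if r = ?a then of_int (\<Lambda> $ ?a) else 0))"
    by (intro sum.cong) (auto simp: hentry simp del: index_add_mat)
  also have "\<dots> = of_int (\<Lambda> $ ?i + \<Lambda> $ ?a)"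
    using k by (simp add: sum.distrib)
  finally have rho: "\<rho> ?h v = scale (of_int (\<Lambda> $ ?i + \<Lambda> $ ?a)) v" .
  have "{k..<N} = insert k ?T" using k by auto
  then have "basis_vec {k..<N} v = creation k (basis_vec ?T v)"
    using creation_basis_vec_least[of ?T k v] by simp
  then have "up_op (e_vec k) (basis_vec {k..<N} v) = zero_op ?h (basis_vec ?T v)"
    using up_op_creation[OF e k, of "basis_vec ?T v"] up_op_tail_vanish[OF v k] by simp
  also have "\<dots> = basis_vec ?T (\<rho> ?h v)
      + (\<Sum>p<N. fscale (?h $$ (root_row m n p, root_row m n p) - ?h $$ (root_col n p, root_col n p))
          (creation p (annihilation p (basis_vec ?T v))))"
    unfolding zero_op_def basis_vec_lift(1)[OF h] by (simp add: diagonal_commutator[OF h diag])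
  also have "(\<Sum>p<N. fscale (?h $$ (root_row m n p, root_row m n p) - ?h $$ (root_col n p, root_col n p))
          (creation p (annihilation p (basis_vec ?T v))))
      = (\<Sum>p<N. fscale (if p \<in> ?T then (if root_row m n p = ?a then 1 else 0) - (if root_col n p = ?i then 1 else 0) else 0)
           (basis_vec ?T v))"
  proof (intro sum.cong refl)
    fix p assume "p \<in> {..<N}"
    then have p: "p < N" by simp
    have ne: "root_row m n p \<noteq> ?i" "root_col n p \<noteq> ?a" using root_bounds[OF p] root_bounds[OF k] by linarith+
    show "fscale (?h $$ (root_row m n p, root_row m n p) - ?h $$ (root_col n p, root_col n p))
          (creation p (annihilation p (basis_vec ?T v)))
       = fscale (if p \<in> ?T then (if root_row m n p = ?a then 1 else 0) - (if root_col n p = ?i then 1 else 0) else 0)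
           (basis_vec ?T v)"
    proof (cases "p \<in> ?T")
      case True
      then show ?thesis using p ne by (simp add: creation_annihilation_basis hentry del: index_add_mat)
    next
      case False
      then show ?thesis by (auto simp: annihilation_basis_vec)
    qed
  qed
  also have "\<dots> = fscale (\<Sum>p<N. if p \<in> ?T then (if root_row m n p = ?a then 1 else 0) - (if root_col n p = ?i then 1 else 0) else 0)
           (basis_vec ?T v)"
    by (rule fock.scale_sum_left[symmetric])
  also have "(\<Sum>p<N. if p \<in> ?T then (if root_row m n p = ?a then 1 else 0) - (if root_col n p = ?i then 1 else 0) else 0)
     = (\<Sum>p\<in>?T. (if root_row m n p = ?a then 1 else 0) - (if root_col n p = ?i then 1 else (0::complex)))"
    by (intro sum.mono_neutral_cong_right) auto
  also have "\<dots> = of_nat (card {p \<in> ?T. root_row m n p = ?a}) - of_nat (card {p \<in> ?T. root_col n p = ?i})"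
    by (simp add: sum_subtractf sum.If_cases Int_def conj_commute)
  also have "\<dots> = of_int ((int m - 1 - int ?i) - (int ?a - int m))"
    unfolding card_root_row[OF k] card_root_col[OF k] using root_bounds[OF k] by (simp add: of_nat_diff)
  finally have "up_op (e_vec k) (basis_vec {k..<N} v) = basis_vec ?T (\<rho> ?h v)
      + fscale (of_int ((int m - 1 - int ?i) - (int ?a - int m))) (basis_vec ?T v)" .
  also have "\<dots> = fscale (of_int (\<Lambda> $ ?i + \<Lambda> $ ?a) + of_int ((int m - 1 - int ?i) - (int ?a - int m))) (basis_vec ?T v)"
    unfolding rho basis_vec_lift(2)[symmetric] fock.scale_left_distrib[symmetric] ..
  also have "of_int (\<Lambda> $ ?i + \<Lambda> $ ?a) + of_int ((int m - 1 - int ?i) - (int ?a - int m)) = (of_int (root_value k) :: complex)"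
    unfolding root_value_def of_int_add[symmetric] by (rule arg_cong[where f = of_int]) simp
  finally show ?thesis .
qed

end

section \<open>Irreducibility of the Fock space\<close>

context gl_zero_irrep
begin

definition fock_submodule :: "(nat set \<Rightarrow> 'v) set \<Rightarrow> bool" where
  "fock_submodule W \<longleftrightarrow> W \<subseteq> fock N \<and> 0 \<in> W \<and> (\<forall>F\<in>W. \<forall>G\<in>W. F + G \<in> W) \<and>
     (\<forall>c. \<forall>F\<in>W. fscale c F \<in> W) \<and> (\<forall>x\<in>gl m n. \<forall>F\<in>W. gl_op x F \<in> W)"

definition fock_irreducible :: bool where
  "fock_irreducible \<longleftrightarrow> fock N \<noteq> {0 :: nat set \<Rightarrow> 'v} \<and> (\<forall>W. fock_submodule W \<longrightarrow> W = {0} \<or> W = fock N)"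

lemma highest_exists: obtains v where "highest v"
  using highest_weight unfolding highest_def by blast

lemma fock_submoduleD:
  assumes "fock_submodule W"
  shows "W \<subseteq> fock N" "0 \<in> W" "F \<in> W \<Longrightarrow> G \<in> W \<Longrightarrow> F + G \<in> W" "F \<in> W \<Longrightarrow> fscale c F \<in> W"
    "F \<in> W \<Longrightarrow> G \<in> W \<Longrightarrow> F - G \<in> W"
    "x \<in> gl_zero m n \<Longrightarrow> F \<in> W \<Longrightarrow> zero_op x F \<in> W"
    "e \<in> gl_up m n \<Longrightarrow> F \<in> W \<Longrightarrow> up_op e F \<in> W"
    "p < N \<Longrightarrow> F \<in> W \<Longrightarrow> creation p F \<in> W"
proof -
  note W = assms[unfolded fock_submodule_def]
  show sub: "W \<subseteq> fock N" and "0 \<in> W" using W by auto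
  show plus: "F \<in> W \<Longrightarrow> G \<in> W \<Longrightarrow> F + G \<in> W" for F G using W by blast
  show scale: "F \<in> W \<Longrightarrow> fscale c F \<in> W" for F c using W by blast
  show "F \<in> W \<Longrightarrow> G \<in> W \<Longrightarrow> F - G \<in> W"
    using plus[of F "- G"] scale[of G "-1"] by simp
  have op: "x \<in> gl m n \<Longrightarrow> F \<in> W \<Longrightarrow> gl_op x F \<in> W" for x F using W by blast
  show "x \<in> gl_zero m n \<Longrightarrow> F \<in> W \<Longrightarrow> zero_op x F \<in> W"
    using op[of x F] gl_op_homogeneous(1)[of F x] sub graded_in_gl(1)[of x m n False] by auto
  show "e \<in> gl_up m n \<Longrightarrow> F \<in> W \<Longrightarrow> up_op e F \<in> W"
    using op[of e F] gl_op_homogeneous(2)[of F e] sub graded_in_gl(2)[of e m n] by auto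
  show "p < N \<Longrightarrow> F \<in> W \<Longrightarrow> creation p F \<in> W"
    using op[of "f_vec p" F] gl_op_homogeneous(3)[of F "f_vec p"] sub by auto
qed

text \<open>The top exterior power is one-dimensional, so \<open>g\<^sub>0\<close> acts on it by a scalar \<open>t\<close>, the trace of the
  action on degree \<open>-1\<close>.\<close>

lemma zero_op_top:
  assumes x: "x \<in> gl_zero m n"
  obtains t where "\<And>u. zero_op x (basis_vec {..<N} u) = basis_vec {..<N} (\<rho> x u) + fscale t (basis_vec {..<N} u)"
proof
  fix u
  let ?c = "\<lambda>p. commutator x (f_vec p) $$ (root_row m n p, root_col n p)"
  have "low_op (commutator x (f_vec p)) (annihilation p (basis_vec {..<N} u)) = fscale (?c p) (basis_vec {..<N} u)"
    if p: "p < N" for p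
  proof -
    have "low_op (commutator x (f_vec p)) (annihilation p (basis_vec {..<N} u))
      = (\<Sum>r<N. if r = p then fscale (?c p) (basis_vec {..<N} u) else 0)"
      unfolding low_op_def
    proof (intro sum.cong refl)
      fix r assume "r \<in> {..<N}"
      then show "fscale (commutator x (f_vec p) $$ (root_row m n r, root_col n r)) (creation r (annihilation p (basis_vec {..<N} u)))
          = (if r = p then fscale (?c p) (basis_vec {..<N} u) else 0)"
        using p by (cases "r = p") (simp_all add: creation_annihilation_basis, simp add: annihilation_basis_vec creation_basis_vec)
    qed
    then show ?thesis using p by simp
  qed
  then show "zero_op x (basis_vec {..<N} u) = basis_vec {..<N} (\<rho> x u)
      + fscale (\<Sum>p<N. ?c p) (basis_vec {..<N} u)"
    unfolding zero_op_def basis_vec_lift(1)[OF x] fock.scale_sum_left by simp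
qed

text \<open>The vectors \<open>w\<close> whose basis vector at \<open>S\<close> lies in \<open>W\<close> form a submodule of the irreducible
  module \<open>L\<^sup>0(\<Lambda>)\<close>.\<close>

lemma component_contained:
  assumes W: "fock_submodule W" and u: "basis_vec S u \<in> W" "u \<noteq> 0"
    and stable: "\<And>x w. x \<in> gl_zero m n \<Longrightarrow> basis_vec S w \<in> W \<Longrightarrow> basis_vec S (\<rho> x w) \<in> W"
  shows "basis_vec S w \<in> W"
proof -
  have "subspace {w. basis_vec S w \<in> W}"
    using fock_submoduleD(2-4)[OF W] by (auto simp: subspace_def simp flip: basis_vec_lift(2))
  then have "{w. basis_vec S w \<in> W} = {0} \<or> {w. basis_vec S w \<in> W} = UNIV"
    by (rule irreducible) (use stable in auto)
  then show ?thesis using u by auto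
qed

text \<open>Multiply \<open>F\<close> by \<open>f\<^sub>0\<close>, \<open>f\<^sub>1\<close>, and so on, skipping every factor that would give zero.  The result is
  nonzero and killed by all \<open>f\<^sub>p\<close>, which leaves only the top degree.\<close>

lemma top_component:
  assumes W: "fock_submodule W" and F: "F \<in> W" "F \<noteq> 0"
  obtains u where "u \<noteq> 0" "basis_vec {..<N} u \<in> W"
proof -
  have "\<exists>G\<in>W. G \<noteq> 0 \<and> (\<forall>j<k. creation j G = 0)" if "k \<le> N" for k
    using that
  proof (induction k)
    case 0
    then show ?case using F by auto
  next
    case (Suc k)
    then obtain G where G: "G \<in> W" "G \<noteq> 0" "\<forall>j<k. creation j G = 0" by auto
    show ?case
    proof (cases "creation k G = 0")
      case True
      then show ?thesis using G less_Suc_eq by (intro bexI[of _ G]) auto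
    next
      case False
      have "creation j (creation k G) = 0" if "j < Suc k" for j
        using that G creation_creation[of j k G] by (cases "j = k") auto
      then show ?thesis using False fock_submoduleD(8)[OF W, of k G] G Suc.prems
        by (intro bexI[of _ "creation k G"]) auto
    qed
  qed
  then obtain G where G: "G \<in> W" "G \<noteq> 0" "\<And>j. j < N \<Longrightarrow> creation j G = 0" by blast
  have fock: "G \<in> fock N" using G fock_submoduleD(1)[OF W] by blast
  have top: "G S = basis_vec {..<N} (G {..<N}) S" for S
  proof (cases "S = {..<N}")
    case False
    have "G S = 0"
    proof (cases "S \<subseteq> {..<N}")
      case True
      then obtain j where j: "j < N" "j \<notin> S" using False by auto
      then have "creation j G (insert j S) = 0" using G by (simp add: zero_fun_apply)
      then show ?thesis using j by (simp add: creation_def)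
    qed (use fock in \<open>auto simp: fock_def\<close>)
    then show ?thesis using False by simp
  qed simp
  have G_eq: "G = basis_vec {..<N} (G {..<N})" by (rule ext) (rule top)
  have "G {..<N} \<noteq> 0"
  proof
    assume "G {..<N} = 0"
    then have "G = 0" using G_eq basis_vec_additive(1) by metis
    then show False using G(2) by simp
  qed
  moreover have "basis_vec {..<N} (G {..<N}) \<in> W" using G(1) G_eq by (rule back_subst)
  ultimately show thesis by (rule that)
qed

text \<open>A nonzero submodule contains the top degree.  From its vector belonging to \<open>v\<close>, the operators
  \<open>e\<^sub>0\<close>, \<open>e\<^sub>1\<close>, and so on remove one generator after the other, up to nonzero factors.  So the submodule
  contains the vacuum, from which everything is created.\<close>

theorem typical_irreducible:
  assumes typical: "\<And>k. k < N \<Longrightarrow> root_value k \<noteq> 0"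
  shows fock_irreducible
proof -
  obtain v where v: "highest v" by (rule highest_exists)
  then have "v \<noteq> 0" by (simp add: highest_def)
  have "W = fock N" if W: "fock_submodule W" and "W \<noteq> {0}" for W
  proof -
    note D = fock_submoduleD[OF W]
    obtain F where "F \<in> W" "F \<noteq> 0" using \<open>W \<noteq> {0}\<close> D(2) by blast
    then obtain u where u: "u \<noteq> 0" "basis_vec {..<N} u \<in> W" using top_component[OF W] by blast
    have top: "basis_vec {..<N} w \<in> W" for w
    proof (rule component_contained[OF W u(2,1)])
      fix x w assume x: "x \<in> gl_zero m n" and w: "basis_vec {..<N} w \<in> W"
      obtain t where "zero_op x (basis_vec {..<N} w) = basis_vec {..<N} (\<rho> x w) + fscale t (basis_vec {..<N} w)"
        using zero_op_top[OF x] by blast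
      then have "basis_vec {..<N} (\<rho> x w) = zero_op x (basis_vec {..<N} w) - fscale t (basis_vec {..<N} w)"
        by simp
      then show "basis_vec {..<N} (\<rho> x w) \<in> W" using D(4,5,6) x w by simp
    qed
    have tail: "basis_vec {k..<N} v \<in> W" if "k \<le> N" for k
      using that
    proof (induction k)
      case 0
      then show ?case using top[of v] by (simp add: lessThan_atLeast0)
    next
      case (Suc k)
      then have k: "k < N" and "basis_vec {k..<N} v \<in> W" by auto
      then have "fscale (of_int (root_value k)) (basis_vec {Suc k..<N} v) \<in> W"
        using D(7)[of "e_vec k" "basis_vec {k..<N} v"] by (simp add: raising_tail[OF v k])
      from D(4)[OF this, of "inverse (of_int (root_value k))"] show ?case
        using typical[OF k] by simp
    qed
    have vac: "basis_vec {} w \<in> W" for w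
    proof (rule component_contained[OF W _ \<open>v \<noteq> 0\<close>])
      show "basis_vec {} v \<in> W" using tail[of N] by simp
      show "basis_vec {} (\<rho> x w) \<in> W" if "x \<in> gl_zero m n" "basis_vec {} w \<in> W" for x w
        using D(6)[OF that] zero_op_vacuum[OF that(1)] by simp
    qed
    have "F \<in> W" if "F \<in> fock N" for F
      using that by (induction rule: fock_induct) (auto intro: vac D)
    then show ?thesis using D(1) by blast
  qed
  moreover have "fock N \<noteq> {0 :: nat set \<Rightarrow> 'v}"
  proof -
    have "basis_vec {} v \<in> fock N" "basis_vec {} v {} \<noteq> (0 :: nat set \<Rightarrow> 'v) {}"
      using \<open>v \<noteq> 0\<close> by (simp_all add: zero_fun_apply)
    then show ?thesis by force
  qed
  ultimately show ?thesis unfolding fock_irreducible_def by blast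
qed

text \<open>The condition at the empty set excludes the vacuum, which \<open>g\<^sub>1\<close> always kills.\<close>

definition singular :: "(nat set \<Rightarrow> 'v) set" where
  "singular = {F \<in> fock N. F {} = 0 \<and> (\<forall>e\<in>gl_up m n. up_op e F = 0)}"

text \<open>The submodule generated by the singular vectors.  Products of elements of degree \<open>-1\<close> suffice to
  generate it, because \<open>g\<^sub>0\<close> preserves singular vectors and \<open>g\<^sub>1\<close> kills them.\<close>

inductive_set singular_span :: "(nat set \<Rightarrow> 'v) set" where
  base: "F \<in> singular \<Longrightarrow> F \<in> singular_span"
| add: "F \<in> singular_span \<Longrightarrow> G \<in> singular_span \<Longrightarrow> F + G \<in> singular_span"
| low: "F \<in> singular_span \<Longrightarrow> y \<in> gl_low m n \<Longrightarrow> low_op y F \<in> singular_span"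

lemma low_op_empty: "low_op y F {} = 0"
  by (simp add: low_op_def sum_fun_apply fock_scale_def creation_def)

lemma singular_span_props: "F \<in> singular_span \<Longrightarrow> F \<in> fock N \<and> F {} = 0"
proof (induction rule: singular_span.induct)
  case (add F G)
  then have "F + G \<in> fock N" using fock_closed(2) by blast
  moreover have "(F + G) {} = 0" using add by (simp only: plus_fun_apply add_0)
  ultimately show ?case ..
qed (auto simp: singular_def low_op_empty)

lemma zero_op_empty: "zero_op x F {} = \<rho> x (F {})"
  by (simp add: zero_op_def fock_lift_def sum_fun_apply low_op_empty pointwise)

lemma singular_zero_op:
  assumes F: "F \<in> singular" and x: "x \<in> gl_zero m n"
  shows "zero_op x F \<in> singular"
proof -
  have fock: "F \<in> fock N" using F by (simp add: singular_def)
  have "up_op e (zero_op x F) = 0" if e: "e \<in> gl_up m n" for e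
  proof -
    have "up_op e F = 0" "up_op (commutator x e) F = 0"
      using F e bracket_in(2)[OF x e] unfolding singular_def by blast+
    then show ?thesis using zero_op_up_op[OF x e fock] x by (simp add: zero_op_linear)
  qed
  then show ?thesis using F x by (simp add: singular_def zero_op_empty rep_linear)
qed

text \<open>Elements of degree \<open>0\<close> and then \<open>1\<close> are moved to the right past the elements of degree \<open>-1\<close>.\<close>

lemma singular_span_submodule: "fock_submodule singular_span"
proof -
  have zero: "zero_op x F \<in> singular_span" if "F \<in> singular_span" "x \<in> gl_zero m n" for x F
    using that
  proof (induction rule: singular_span.induct)
    case (base F)
    then show ?case using singular_zero_op singular_span.base by blast
  next
    case (add F G)
    then show ?case by (simp add: zero_op_linear singular_span.add)
  next
    case (low F y)
    then show ?case using bracket_in(3)[OF low.prems low.hyps(2)]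
      by (simp add: zero_op_low_op singular_span.add singular_span.low)
  qed
  have scale: "fscale c F \<in> singular_span" if "F \<in> singular_span" for c F
    using that
  proof (induction rule: singular_span.induct)
    case (base F)
    then have "fscale c F \<in> singular" by (auto simp: singular_def up_op_linear) (simp add: fock_scale_def)
    then show ?case by (rule singular_span.base)
  next
    case (add F G)
    then show ?case by (simp add: fock.scale_right_distrib singular_span.add)
  next
    case (low F y)
    then show ?case using singular_span.low[of "fscale c F" y] by simp
  qed
  have "0 \<in> singular" by (auto simp: singular_def up_op_linear pointwise)
  then have null: "0 \<in> singular_span" by (rule singular_span.base)
  have up: "up_op e F \<in> singular_span" if "F \<in> singular_span" "e \<in> gl_up m n" for e F
    using that
  proof (induction rule: singular_span.induct)
    case (base F)
    then show ?case using null by (simp add: singular_def)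
  next
    case (add F G)
    then show ?case by (simp add: up_op_linear singular_span.add)
  next
    case (low F y)
    have "zero_op (anticommutator e y) F + fscale (-1) (low_op y (up_op e F)) \<in> singular_span"
      using low by (intro singular_span.add scale singular_span.low zero bracket_in(4))
    then show ?case using low by (simp add: up_op_low_op)
  qed
  have "gl_op x F \<in> singular_span" if "x \<in> gl m n" "F \<in> singular_span" for x F
    using that singular_span_props[of F] unfolding gl_op_def
    by (auto intro!: singular_span.add singular_span.low zero up)
  then show ?thesis
    using singular_span_props null scale singular_span.add unfolding fock_submodule_def by blast
qed

lemma up_op_square:
  assumes "e \<in> gl_up m n" "F \<in> fock N"
  shows "up_op e (up_op e F) = 0"
proof -
  have "fscale 2 (up_op e (up_op e F)) = up_op e (up_op e F) + up_op e (up_op e F)"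
    using fock.scale_left_distrib[of 1 1] by simp
  also have "\<dots> = 0" using up_op_up_op[OF assms(1,1,2)] by (simp add: eq_neg_iff_add_eq_0)
  finally show ?thesis by simp
qed

lemma up_op_lowers_degree:
  assumes e: "e \<in> gl_up m n" and F: "F \<in> fock N" and deg: "\<And>S. card S \<le> d \<Longrightarrow> F S = 0" and S: "card S < d"
  shows "up_op e F S = 0"
proof (cases "S \<subseteq> {..<N}")
  case True
  then have fin: "finite S" using finite_subset by blast
  have ann: "annihilation p F T = 0" if "card T < d" "finite T" for p T
    using that deg[of "insert p T"] by (auto simp: annihilation_def card_insert_if)
  have "fock_lift (\<rho> (anticommutator e (f_vec p))) (annihilation p F) S = 0" if "p < N" for p
    using ann[OF S fin] e that by (simp add: fock_lift_def rep_linear)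
  moreover have "creation r (annihilation p (annihilation q F)) S = 0" for p q r
  proof (cases "r \<in> S")
    case r: True
    have "annihilation p (annihilation q F) (S - {r}) = 0"
    proof (cases "p \<in> S - {r}")
      case False
      then have "card (insert p (S - {r})) = card S" using card.remove[OF fin r] fin by simp
      then show ?thesis using False ann[of "insert p (S - {r})" q] S fin by (simp add: annihilation_def)
    qed (simp add: annihilation_def)
    then show ?thesis using r by (simp add: creation_def)
  qed (simp add: creation_def)
  ultimately show ?thesis
    using e by (simp add: up_op_def low_op_def sum_fun_apply fock_scale_def pointwise)
next
  case False
  then show ?thesis using up_op_in_fock[OF e F] by (simp add: fock_def)
qed

text \<open>Apply \<open>e\<^sub>0\<close>, \<open>e\<^sub>1\<close>, and so on to the top vector belonging to \<open>v\<close>, skipping every factor that would give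
  zero.  The result is nonzero and killed by all \<open>e\<^sub>k\<close>, since these anticommute and square to
  zero.  Without skipping, the factor \<open>root_value k0 = 0\<close> would appear; so some factor has been skipped,
  and the result has positive degree.\<close>

lemma atypical_singular_vector:
  assumes k0: "k0 < N" "root_value k0 = 0"
  obtains w where "w \<in> singular" "w \<noteq> 0"
proof -
  obtain v where v: "highest v" by (rule highest_exists)
  then have "v \<noteq> 0" by (simp add: highest_def)
  have "\<exists>w \<in> fock N. w \<noteq> 0 \<and> (\<forall>j<k. up_op (e_vec j) w = 0) \<and>
      ((\<forall>S. card S \<le> N - k \<longrightarrow> w S = 0) \<or>
       (\<exists>c. w = fscale c (basis_vec {k..<N} v)) \<and> (\<forall>j<k. root_value j \<noteq> 0))" if "k \<le> N" for k
    using that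
  proof (induction k)
    case 0
    have "basis_vec {0..<N} v \<noteq> 0" using \<open>v \<noteq> 0\<close> by (metis basis_vec_apply(1) zero_fun_apply)
    moreover have "basis_vec {0..<N} v \<in> fock N" by (rule basis_vec_in_fock) auto
    moreover have "basis_vec {0..<N} v = fscale 1 (basis_vec {0..<N} v)" by simp
    ultimately show ?case by blast
  next
    case (Suc k)
    then have k: "k < N" and e: "e_vec k \<in> gl_up m n" by auto
    from Suc obtain w where w: "w \<in> fock N" "w \<noteq> 0" and kill: "\<And>j. j < k \<Longrightarrow> up_op (e_vec j) w = 0"
      and alt: "(\<forall>S. card S \<le> N - k \<longrightarrow> w S = 0) \<or>
       (\<exists>c. w = fscale c (basis_vec {k..<N} v)) \<and> (\<forall>j<k. root_value j \<noteq> 0)" by auto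
    show ?case
    proof (cases "up_op (e_vec k) w = 0")
      case True
      have "w S = 0" if "card S \<le> N - Suc k" for S
        using alt
      proof
        assume "\<forall>S. card S \<le> N - k \<longrightarrow> w S = 0"
        then show ?thesis using that by simp
      next
        assume "(\<exists>c. w = fscale c (basis_vec {k..<N} v)) \<and> (\<forall>j<k. root_value j \<noteq> 0)"
        then obtain c where "w = fscale c (basis_vec {k..<N} v)" by blast
        moreover have "S \<noteq> {k..<N}" using that k by auto
        ultimately show ?thesis by (simp add: fock_scale_def)
      qed
      then show ?thesis using w kill True by (intro bexI[of _ w]) (auto simp: less_Suc_eq)
    next
      case False
      have kill': "up_op (e_vec j) (up_op (e_vec k) w) = 0" if "j < Suc k" for j
      proof (cases "j = k")
        case True
        then show ?thesis using up_op_square[OF e w(1)] by simp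
      next
        case False
        then have "j < k" using that by simp
        then show ?thesis using up_op_up_op[OF _ e w(1), of "e_vec j"] kill k e by (simp add: up_op_linear)
      qed
      have "(\<forall>S. card S \<le> N - Suc k \<longrightarrow> up_op (e_vec k) w S = 0) \<or>
       (\<exists>c. up_op (e_vec k) w = fscale c (basis_vec {Suc k..<N} v)) \<and> (\<forall>j<Suc k. root_value j \<noteq> 0)"
        using alt
      proof
        assume "\<forall>S. card S \<le> N - k \<longrightarrow> w S = 0"
        then have "up_op (e_vec k) w S = 0" if "card S \<le> N - Suc k" for S
          using that k by (intro up_op_lowers_degree[OF e w(1), of "N - k"]) auto
        then show ?thesis by blast
      next
        assume tail: "(\<exists>c. w = fscale c (basis_vec {k..<N} v)) \<and> (\<forall>j<k. root_value j \<noteq> 0)"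
        then obtain c where "w = fscale c (basis_vec {k..<N} v)" by blast
        then have eq: "up_op (e_vec k) w = fscale (c * of_int (root_value k)) (basis_vec {Suc k..<N} v)"
          using e by (simp add: up_op_linear raising_tail[OF v k])
        then have "root_value k \<noteq> 0" using False by auto
        then show ?thesis using eq tail less_Suc_eq by auto
      qed
      then show ?thesis using False kill' up_op_in_fock[OF e w(1)]
        by (intro bexI[of _ "up_op (e_vec k) w"]) auto
    qed
  qed
  from this[of N] obtain w where w: "w \<in> fock N" "w \<noteq> 0" and kill: "\<And>j. j < N \<Longrightarrow> up_op (e_vec j) w = 0"
    and alt: "(\<forall>S. card S \<le> N - N \<longrightarrow> w S = 0) \<or>
       (\<exists>c. w = fscale c (basis_vec {N..<N} v)) \<and> (\<forall>j<N. root_value j \<noteq> 0)" by auto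
  have "w {} = 0" using alt k0 by auto
  moreover have "up_op e w = 0" if "e \<in> gl_up m n" for e
    using that by (induction rule: up_induct) (simp_all add: kill up_op_matrix)
  ultimately show thesis using that[of w] w by (simp add: singular_def)
qed

text \<open>The span of the singular vectors is a submodule that is nonzero but misses the vacuum.\<close>

theorem atypical_reducible:
  assumes "k0 < N" "root_value k0 = 0"
  shows "\<not> fock_irreducible"
proof
  assume irr: fock_irreducible
  obtain w where w: "w \<in> singular" "w \<noteq> 0" using atypical_singular_vector[OF assms] by blast
  obtain v where "highest v" by (rule highest_exists)
  then have "v \<noteq> 0" by (simp add: highest_def)
  have "singular_span = {0} \<or> singular_span = fock N"
    using irr singular_span_submodule unfolding fock_irreducible_def by blast
  moreover have "w \<in> singular_span" using w(1) by (rule singular_span.base)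
  ultimately have "singular_span = fock N" using w(2) by auto
  then have "basis_vec {} v \<in> singular_span" by simp
  then have "basis_vec {} v {} = 0" using singular_span_props by blast
  then show False using \<open>v \<noteq> 0\<close> by simp
qed

lemma fock_irreducible_iff: "fock_irreducible \<longleftrightarrow> (\<forall>k<N. root_value k \<noteq> 0)"
proof
  assume "fock_irreducible"
  then show "\<forall>k<N. root_value k \<noteq> 0" using atypical_reducible by auto
next
  assume "\<forall>k<N. root_value k \<noteq> 0"
  then show fock_irreducible by (intro typical_irreducible) simp
qed

end

section \<open>The Kac module and its irreducibility\<close>

context gl_zero_irrep
begin

text \<open>The map that the universal property of the tensor product provides: \<open>u \<otimes> v\<close> goes to \<open>u\<close> applied to
  the vacuum vector \<open>v\<close>.\<close>

definition to_fock :: "(complex mat ncpoly set \<times> 'v \<Rightarrow>\<^sub>0 int) \<Rightarrow> nat set \<Rightarrow> 'v" where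
  "to_fock X = (\<Sum>k\<in>Poly_Mapping.keys X. fscale (of_int (Poly_Mapping.lookup X k)) (env_act (fst k) (basis_vec {} (snd k))))"

lemma to_fock_superset:
  assumes "finite A" "Poly_Mapping.keys X \<subseteq> A"
  shows "to_fock X = (\<Sum>k\<in>A. fscale (of_int (Poly_Mapping.lookup X k)) (env_act (fst k) (basis_vec {} (snd k))))"
  unfolding to_fock_def
  by (rule sum.mono_neutral_left) (use assms in \<open>auto simp: in_keys_iff\<close>)

lemma to_fock_zero [simp]: "to_fock 0 = 0"
  unfolding to_fock_def keys_zero sum.empty ..

lemma to_fock_add: "to_fock (X + Y) = to_fock X + to_fock Y"
  by (simp add: to_fock_superset[of "Poly_Mapping.keys X \<union> Poly_Mapping.keys Y"] keys_add lookup_add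
      fock.scale_left_distrib sum.distrib)

lemma to_fock_diff: "to_fock (X - Y) = to_fock X - to_fock Y"
  using to_fock_add[of "X - Y" Y] by simp

lemma to_fock_minus: "to_fock (- X) = - to_fock X"
  using to_fock_diff[of 0 X] by simp

lemma to_fock_pure [simp]: "to_fock (pure_tensor f v) = fock_poly f (basis_vec {} v)"
  unfolding pure_tensor_def by (subst to_fock_superset[of "{(env_class m n f, v)}"]) (simp_all add: env_act_class)

lemma to_fock_in_fock: "X \<in> pairs \<Longrightarrow> to_fock X \<in> fock N"
  by (induction rule: pairs_induct) (auto simp: to_fock_diff fock_poly_in_fock)

lemma to_fock_poly_mult:
  assumes "f \<in> env_free" "X \<in> pairs"
  shows "to_fock (poly_mult f X) = fock_poly f (to_fock X)"
  using assms(2)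
proof (induction rule: pairs_induct)
  case zero
  then show ?case using assms by (simp add: fock_act.poly_act_zero_right)
next
  case (pure g v)
  then show ?case using assms by (simp add: fock_act.poly_act_mult)
next
  case (diff X Y)
  have "fock_poly f (to_fock X - to_fock Y) = fock_poly f (to_fock X) - fock_poly f (to_fock Y)"
    using fock_act.poly_act_linear(1)[OF assms(1), of "to_fock X - to_fock Y" "to_fock Y"]
    by (simp only: diff_add_cancel eq_diff_eq)
  then show ?case using diff by (simp add: to_fock_diff)
qed

text \<open>The vacuum is a copy of \<open>L\<^sup>0(\<Lambda>)\<close> as a module over \<open>g\<^sub>0 + g\<^sub>1\<close>; this is what makes \<open>to_fock\<close> balanced.\<close>

lemma fock_poly_vacuum:
  assumes "s \<in> carrier (free_algebra (gl_nonneg m n))"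
  shows "fock_poly s (basis_vec {} v) = basis_vec {} (base_act_poly s v)"
  using assms
proof (induction rule: ncpoly_induct)
  case (monomial L c)
  have "gl_op x (basis_vec {} w) = basis_vec {} (\<rho> (zero_part m n x) w)" if "x \<in> gl_nonneg m n" for x w
    using that unfolding gl_op_def
    by (simp add: zero_op_vacuum up_op_vacuum low_part_of)
  then have "foldr gl_op L (basis_vec {} v) = basis_vec {} (foldr (\<lambda>x. \<rho> (zero_part m n x)) L v)"
    using monomial by (induction L) auto
  then show ?case by (simp add: basis_vec_lift)
next
  case (add f g)
  then show ?case by (simp add: fock_act.poly_act_add base_act.poly_act_add)
qed

lemma to_fock_balanced:
  assumes "X \<in> balanced_span"
  shows "to_fock X = 0"
  using assms
proof (induction rule: balanced_span_induct)
  case (rels r)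
  then show ?case
  proof (cases rule: balanced_rels_cases)
    case (left f g v)
    then show ?thesis by (simp add: to_fock_diff fock_act.poly_act_add)
  next
    case (right f v w)
    then show ?thesis by (simp add: to_fock_diff fock_act.poly_act_linear)
  next
    case (middle f s v)
    then show ?thesis using gl_nonneg_free[OF middle(2)]
      by (simp add: to_fock_diff fock_act.poly_act_mult fock_poly_vacuum)
  qed
qed (simp_all add: to_fock_add to_fock_minus)

text \<open>On a word applied to a pure tensor with \<open>1\<close>, the letters are carried over one at a time by
  equivariance.  This says that the Kac module is spanned by the ordered products of lowering elements
  applied to \<open>L\<^sup>0(\<Lambda>)\<close>.\<close>

lemma fock_tensor_to_fock:
  assumes "X \<in> pairs"
  shows "fock_tensor (to_fock X) \<doteq> X"
  using assms
proof (induction rule: pairs_induct)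
  case zero
  then show ?case by (simp add: fock_tensor_zero)
next
  case (diff X Y)
  show ?case unfolding to_fock_diff
    by (rule tensor_eq_trans[OF fock_tensor_diff tensor_eq_diff[OF diff(3,4)]])
next
  case (pure f v)
  then show ?case
  proof (induction rule: ncpoly_induct)
    case (monomial L c)
    let ?v = "scale c v"
    have word: "fock_tensor (foldr gl_op L (basis_vec {} ?v)) \<doteq> pure_tensor (Poly_Mapping.single (Word L) 1) ?v
        \<and> foldr gl_op L (basis_vec {} ?v) \<in> fock N"
      using monomial
    proof (induction L)
      case Nil
      then show ?case using fock_tensor_vacuum[of ?v] by (simp flip: zero_word_def)
    next
      case (Cons x L)
      then have x: "x \<in> gl m n" and IH: "fock_tensor (foldr gl_op L (basis_vec {} ?v)) \<doteq> pure_tensor (Poly_Mapping.single (Word L) 1) ?v"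
        and fock: "foldr gl_op L (basis_vec {} ?v) \<in> fock N" and L: "set L \<subseteq> gl m n" by auto
      have "fock_tensor (gl_op x (foldr gl_op L (basis_vec {} ?v))) \<doteq> poly_mult (ncvar x) (fock_tensor (foldr gl_op L (basis_vec {} ?v)))"
        by (rule fock_tensor_gl_op[OF x fock])
      also have "\<dots> \<doteq> poly_mult (ncvar x) (pure_tensor (Poly_Mapping.single (Word L) 1) ?v)"
        using x by (intro poly_mult_eq IH) simp
      also have "\<dots> = pure_tensor (Poly_Mapping.single (Word (x # L)) 1) ?v"
        using x L by (simp add: ncvar_def mult_single plus_word_def flip: ncvar_def) (simp add: ncvar_def mult_single plus_word_def)
      finally show ?case by simp
    qed
    have free: "Poly_Mapping.single (Word L) 1 \<in> env_free" using monomial by simp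
    have "to_fock (pure_tensor (Poly_Mapping.single (Word L) c) v) = foldr gl_op L (basis_vec {} ?v)"
      using fock_act.word_act_linear(2)[OF monomial, of c] by (simp add: basis_vec_lift(2)[symmetric])
    then have "fock_tensor (to_fock (pure_tensor (Poly_Mapping.single (Word L) c) v)) \<doteq> pure_tensor (Poly_Mapping.single (Word L) 1) ?v"
      using word by simp
    also have "\<dots> \<doteq> pure_tensor (ncconst c * Poly_Mapping.single (Word L) 1) v"
      by (rule tensor_eq_sym[OF pure_tensor_scale[OF free]])
    also have "ncconst c * Poly_Mapping.single (Word L) 1 = Poly_Mapping.single (Word L) c"
      by (simp add: ncconst_mult_single)
    finally show ?case .
  next
    case (add f g)
    have "fock_tensor (to_fock (pure_tensor (f + g) v)) = fock_tensor (to_fock (pure_tensor f v) + to_fock (pure_tensor g v))"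
      by (simp add: fock_act.poly_act_add)
    also have "\<dots> \<doteq> fock_tensor (to_fock (pure_tensor f v)) + fock_tensor (to_fock (pure_tensor g v))"
      by (rule fock_tensor_add)
    also have "\<dots> \<doteq> pure_tensor f v + pure_tensor g v"
      using add by (intro tensor_eq_add)
    also have "\<dots> \<doteq> pure_tensor (f + g) v"
      using add by (intro tensor_eq_sym[OF pure_tensor_rels(1)])
    finally show ?case .
  qed
qed

lemma to_fock_eq_iff:
  assumes "X \<in> pairs" "Y \<in> pairs"
  shows "to_fock X = to_fock Y \<longleftrightarrow> X - Y \<in> balanced_span"
proof
  assume "to_fock X = to_fock Y"
  then have "X \<doteq> Y"
    using tensor_eq_trans[OF tensor_eq_sym[OF fock_tensor_to_fock[OF assms(1)]]] fock_tensor_to_fock[OF assms(2)] by simp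
  then show "X - Y \<in> balanced_span" by (simp add: tensor_eq_def)
next
  assume "X - Y \<in> balanced_span"
  from to_fock_balanced[OF this] show "to_fock X = to_fock Y" by (simp add: to_fock_diff)
qed

lemma to_fock_surj:
  assumes "F \<in> fock N"
  obtains X where "X \<in> pairs" "to_fock X = F"
proof -
  have "\<exists>X\<in>pairs. to_fock X = F"
    using assms
  proof (induction rule: fock_induct)
    case (vacuum v)
    show ?case by (intro bexI[of _ "pure_tensor 1 v"]) (auto intro: pairs_closed)
  next
    case (add F G)
    then obtain X Y where "X \<in> pairs" "to_fock X = F" "Y \<in> pairs" "to_fock Y = G" by blast
    then show ?case by (intro bexI[of _ "X + Y"]) (auto simp: to_fock_add intro: pairs_closed)
  next
    case (creation p F)
    then obtain X where X: "X \<in> pairs" "to_fock X = F" by blast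
    have "gl_op (f_vec p) F = creation p F"
      using creation by (simp add: gl_op_homogeneous(3))
    then have "to_fock (poly_mult (ncvar (f_vec p)) X) = creation p F"
      using X creation by (simp add: to_fock_poly_mult)
    then show ?case using X creation by (intro bexI[of _ "poly_mult (ncvar (f_vec p)) X"] poly_mult_in_pairs) simp_all
  qed
  then show thesis using that by blast
qed

abbreviation kac where "kac \<equiv> kac_module m n scale \<rho>"

definition kac_class :: "(complex mat ncpoly set \<times> 'v \<Rightarrow>\<^sub>0 int) \<Rightarrow> (complex mat ncpoly set \<times> 'v \<Rightarrow>\<^sub>0 int) set" where
  "kac_class X = balanced_span #>\<^bsub>pair_group\<^esub> X"

lemma kac_unfold:
  "kac = \<lparr>carrier = carrier (pair_group Mod balanced_span), mult = undefined, one = undefined,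
         ring.zero = \<one>\<^bsub>pair_group Mod balanced_span\<^esub>, ring.add = (\<otimes>\<^bsub>pair_group Mod balanced_span\<^esub>),
         smult = (\<lambda>a Q. \<Union>X\<in>Q. kac_class (left_mult a X))\<rparr>"
  by (simp add: kac_module_def extension_of_scalars_def Let_def pair_group_def balanced_span_def balanced_rels_def
      kac_class_def left_mult_def)

lemma kac_class_eq: "kac_class X = (\<lambda>h. h + X) ` balanced_span"
  by (auto simp: kac_class_def r_coset_def)

lemma kac_class_self: "X \<in> kac_class X"
  unfolding kac_class_eq using balanced_span_closed(1) by force

lemma kac_class_memD: "Y \<in> kac_class X \<Longrightarrow> Y - X \<in> balanced_span"
  by (auto simp: kac_class_eq)

lemma kac_class_eq_iff: "kac_class X = kac_class Y \<longleftrightarrow> X - Y \<in> balanced_span"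
proof
  assume "kac_class X = kac_class Y"
  then show "X - Y \<in> balanced_span" using kac_class_self[of X] kac_class_memD by blast
next
  have sub: "kac_class X \<subseteq> kac_class Y" if XY: "X - Y \<in> balanced_span" for X Y
  proof
    fix Z assume "Z \<in> kac_class X"
    then obtain h where "h \<in> balanced_span" "Z = h + X" by (auto simp: kac_class_eq)
    then have "h + (X - Y) \<in> balanced_span" "Z = h + (X - Y) + Y" using XY balanced_span_closed(2) by auto
    then show "Z \<in> kac_class Y" unfolding kac_class_eq by blast
  qed
  assume "X - Y \<in> balanced_span"
  then show "kac_class X = kac_class Y"
    using sub[of X Y] sub[of Y X] balanced_span_closed(3)[of "X - Y"] by auto
qed

lemma kac_carrier: "carrier kac = kac_class ` pairs"
  by (auto simp: kac_unfold FactGroup_def RCOSETS_def kac_class_def)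

lemma kac_zero: "\<zero>\<^bsub>kac\<^esub> = kac_class 0"
  by (simp add: kac_unfold FactGroup_def kac_class_eq)

lemma kac_add: "kac_class X \<oplus>\<^bsub>kac\<^esub> kac_class Y = kac_class (X + Y)"
proof -
  have "kac_class X <#>\<^bsub>pair_group\<^esub> kac_class Y = kac_class (X + Y)"
  proof (intro equalityI subsetI)
    fix Z assume "Z \<in> kac_class X <#>\<^bsub>pair_group\<^esub> kac_class Y"
    then obtain g h where "g \<in> balanced_span" "h \<in> balanced_span" "Z = (g + X) + (h + Y)"
      by (auto simp: set_mult_def kac_class_eq)
    then have "g + h \<in> balanced_span" "Z = (g + h) + (X + Y)" by (auto intro: balanced_span_closed)
    then show "Z \<in> kac_class (X + Y)" unfolding kac_class_eq by blast
  next
    fix Z assume "Z \<in> kac_class (X + Y)"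
    then obtain h where h: "h \<in> balanced_span" "Z = h + (X + Y)" by (auto simp: kac_class_eq)
    then have "h + X \<in> kac_class X" "Z = (h + X) + Y" by (auto simp: kac_class_eq)
    then show "Z \<in> kac_class X <#>\<^bsub>pair_group\<^esub> kac_class Y"
      using kac_class_self[of Y] by (force simp: set_mult_def)
  qed
  then show ?thesis by (simp add: kac_unfold FactGroup_def)
qed

lemma kac_smult:
  assumes f: "f \<in> env_free" and X: "X \<in> pairs"
  shows "env_class m n f \<odot>\<^bsub>kac\<^esub> kac_class X = kac_class (poly_mult f X)"
proof -
  have "kac_class (poly_mult f Y) = kac_class (poly_mult f X)" if "Y \<in> kac_class X" for Y
    using poly_mult_eq[OF f, of Y X] kac_class_memD[OF that] by (simp add: kac_class_eq_iff tensor_eq_def)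
  then have "(\<Union>Y\<in>kac_class X. kac_class (poly_mult f Y)) = kac_class (poly_mult f X)"
    by (intro UN_constant_eq[OF kac_class_self] ballI)
  then show ?thesis by (simp add: kac_unfold poly_mult_def)
qed

lemma kac_minus:
  assumes X: "X \<in> pairs"
  shows "inv\<^bsub>add_monoid kac\<^esub> (kac_class X) = kac_class (- X)"
  unfolding m_inv_def
proof (rule the_equality)
  show "kac_class (- X) \<in> carrier (add_monoid kac) \<and>
    kac_class X \<otimes>\<^bsub>add_monoid kac\<^esub> kac_class (- X) = \<one>\<^bsub>add_monoid kac\<^esub> \<and>
    kac_class (- X) \<otimes>\<^bsub>add_monoid kac\<^esub> kac_class X = \<one>\<^bsub>add_monoid kac\<^esub>"
    using pairs_closed(4)[OF X] by (simp add: kac_carrier kac_add kac_zero)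
next
  fix Q assume Q: "Q \<in> carrier (add_monoid kac) \<and>
    kac_class X \<otimes>\<^bsub>add_monoid kac\<^esub> Q = \<one>\<^bsub>add_monoid kac\<^esub> \<and>
    Q \<otimes>\<^bsub>add_monoid kac\<^esub> kac_class X = \<one>\<^bsub>add_monoid kac\<^esub>"
  then obtain Y where Y: "Q = kac_class Y" by (auto simp: kac_carrier)
  with Q have "kac_class (Y + X) = kac_class 0" by (simp add: kac_add kac_zero)
  then show "Q = kac_class (- X)" unfolding Y kac_class_eq_iff by simp
qed

lemma fock_submodule_poly:
  assumes W: "fock_submodule W" and f: "f \<in> env_free" and F: "F \<in> W"
  shows "fock_poly f F \<in> W"
  using f
proof (induction rule: ncpoly_induct)
  case (monomial L c)
  then have "foldr gl_op L F \<in> W"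
    using W F by (induction L) (auto simp: fock_submodule_def)
  then show ?case using fock_submoduleD(4)[OF W] by simp
next
  case (add f g)
  then show ?case using fock_submoduleD(3)[OF W] by (simp add: fock_act.poly_act_add)
qed

definition fock_image :: "(complex mat ncpoly set \<times> 'v \<Rightarrow>\<^sub>0 int) set set \<Rightarrow> (nat set \<Rightarrow> 'v) set" where
  "fock_image H = {to_fock X | X. X \<in> pairs \<and> kac_class X \<in> H}"

lemma fock_image_submodule:
  assumes "submodule H (env_algebra m n) kac"
  shows "fock_submodule (fock_image H)"
proof -
  interpret H: submodule H "env_algebra m n" kac by fact
  have poly: "fock_poly f F \<in> fock_image H" if f: "f \<in> env_free" and F: "F \<in> fock_image H" for f F
  proof -
    obtain X where X: "X \<in> pairs" "kac_class X \<in> H" "F = to_fock X" using F unfolding fock_image_def by blast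
    have "kac_class (poly_mult f X) \<in> H"
      using H.smult_closed[OF env_class_in[OF f] X(2)] unfolding kac_smult[OF f X(1)] .
    then show ?thesis
      using X poly_mult_in_pairs[OF f X(1)] to_fock_poly_mult[OF f X(1)] unfolding fock_image_def by force
  qed
  have "0 \<in> fock_image H"
    using H.one_closed pairs_closed(1) unfolding fock_image_def by (force simp: kac_zero)
  moreover have "F + G \<in> fock_image H" if F: "F \<in> fock_image H" and G: "G \<in> fock_image H" for F G
  proof -
    obtain X where X: "X \<in> pairs" "kac_class X \<in> H" "F = to_fock X" using F unfolding fock_image_def by blast
    obtain Y where Y: "Y \<in> pairs" "kac_class Y \<in> H" "G = to_fock Y" using G unfolding fock_image_def by blast
    have "kac_class (X + Y) \<in> H" using H.m_closed[OF X(2) Y(2)] by (simp add: kac_add)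
    then show ?thesis
      using X Y pairs_closed(2)[OF X(1) Y(1)] to_fock_add[of X Y] unfolding fock_image_def by force
  qed
  moreover have "fscale c F \<in> fock_image H" if "F \<in> fock_image H" for c F
    using poly[of "ncconst c" F] that by simp
  moreover have "gl_op x F \<in> fock_image H" if "x \<in> gl m n" "F \<in> fock_image H" for x F
    using poly[of "ncvar x" F] that by simp
  moreover have "fock_image H \<subseteq> fock N" unfolding fock_image_def using to_fock_in_fock by blast
  ultimately show ?thesis unfolding fock_submodule_def by blast
qed

lemma kac_preimage_submodule:
  assumes W: "fock_submodule W"
  shows "submodule (kac_class ` {X \<in> pairs. to_fock X \<in> W}) (env_algebra m n) kac" (is "submodule ?H _ _")
proof (intro submodule.intro submodule_axioms.intro subgroup.intro)
  show "?H \<subseteq> carrier (add_monoid kac)" by (auto simp: kac_carrier)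
  show "\<one>\<^bsub>add_monoid kac\<^esub> \<in> ?H"
    using fock_submoduleD(2)[OF W] pairs_closed(1) by (auto simp: kac_zero)
  fix P assume "P \<in> ?H"
  then obtain X where X: "X \<in> pairs" "to_fock X \<in> W" "P = kac_class X" by blast
  have "to_fock (- X) \<in> W"
    using fock_submoduleD(4)[OF W X(2), of "-1"] by (simp add: to_fock_minus)
  then show "inv\<^bsub>add_monoid kac\<^esub> P \<in> ?H"
    using pairs_closed(4)[OF X(1)] unfolding X(3) kac_minus[OF X(1)] by blast
  show "a \<odot>\<^bsub>kac\<^esub> P \<in> ?H" if a: "a \<in> carrier (env_algebra m n)" for a
  proof -
    obtain f where f: "f \<in> env_free" "a = env_class m n f" using a by (auto simp: env_algebra_carrier)
    have "to_fock (poly_mult f X) \<in> W"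
      unfolding to_fock_poly_mult[OF f(1) X(1)] by (rule fock_submodule_poly[OF W f(1) X(2)])
    then show ?thesis
      using poly_mult_in_pairs[OF f(1) X(1)] unfolding f(2) X(3) kac_smult[OF f(1) X(1)] by blast
  qed
  fix Q assume "Q \<in> ?H"
  then obtain Y where Y: "Y \<in> pairs" "to_fock Y \<in> W" "Q = kac_class Y" by blast
  have "to_fock (X + Y) \<in> W" using fock_submoduleD(3)[OF W X(2) Y(2)] by (simp add: to_fock_add)
  then show "P \<otimes>\<^bsub>add_monoid kac\<^esub> Q \<in> ?H"
    using pairs_closed(2)[OF X(1) Y(1)] unfolding X(3) Y(3) by (simp add: kac_add)
qed

lemma kac_class_zero_iff: "X \<in> pairs \<Longrightarrow> kac_class X = \<zero>\<^bsub>kac\<^esub> \<longleftrightarrow> to_fock X = 0"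
  using to_fock_eq_iff[of X 0] pairs_closed(1) by (simp add: kac_zero kac_class_eq_iff)

text \<open>Taking images and preimages under \<open>to_fock\<close> matches the submodules of the two modules.\<close>

theorem kac_irreducible_iff_fock: "irreducible_module (env_algebra m n) kac \<longleftrightarrow> fock_irreducible"
proof -
  have nonzero: "carrier kac \<noteq> {\<zero>\<^bsub>kac\<^esub>} \<longleftrightarrow> fock N \<noteq> {0 :: nat set \<Rightarrow> 'v}"
  proof -
    have "carrier kac = {\<zero>\<^bsub>kac\<^esub>} \<longleftrightarrow> (\<forall>X\<in>pairs. kac_class X = \<zero>\<^bsub>kac\<^esub>)"
      unfolding kac_carrier using pairs_closed(1) by (auto)
    also have "\<dots> \<longleftrightarrow> (\<forall>X\<in>pairs. to_fock X = 0)" using kac_class_zero_iff by blast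
    also have "\<dots> \<longleftrightarrow> (\<forall>F\<in>fock N. F = (0 :: nat set \<Rightarrow> 'v))"
      using to_fock_surj to_fock_in_fock by metis
    also have "\<dots> \<longleftrightarrow> fock N = {0 :: nat set \<Rightarrow> 'v}" using fock_closed(1) by blast
    finally show ?thesis by simp
  qed
  show ?thesis
  proof
    assume irr: "irreducible_module (env_algebra m n) kac"
    have "W = {0} \<or> W = fock N" if W: "fock_submodule W" for W
    proof -
      let ?H = "kac_class ` {X \<in> pairs. to_fock X \<in> W}"
      have "?H = {\<zero>\<^bsub>kac\<^esub>} \<or> ?H = carrier kac"
        using irr kac_preimage_submodule[OF W] unfolding irreducible_module_def by blast
      then show ?thesis
      proof
        assume H: "?H = {\<zero>\<^bsub>kac\<^esub>}"
        have "F = 0" if "F \<in> W" for F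
        proof -
          have "F \<in> fock N" using that fock_submoduleD(1)[OF W] by blast
          then obtain X where X: "X \<in> pairs" "to_fock X = F" by (rule to_fock_surj)
          then have "kac_class X = \<zero>\<^bsub>kac\<^esub>" using H that by blast
          then show ?thesis using X kac_class_zero_iff by simp
        qed
        then show ?thesis using fock_submoduleD(2)[OF W] by blast
      next
        assume H: "?H = carrier kac"
        have "F \<in> W" if F: "F \<in> fock N" for F
        proof -
          obtain X where X: "X \<in> pairs" "to_fock X = F" using F by (rule to_fock_surj)
          then have "kac_class X \<in> ?H" using H kac_carrier by blast
          then obtain Y where Y: "Y \<in> pairs" "to_fock Y \<in> W" "kac_class X = kac_class Y" by blast
          then show ?thesis using X to_fock_eq_iff[OF X(1) Y(1)] by (simp add: kac_class_eq_iff)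
        qed
        then show ?thesis using fock_submoduleD(1)[OF W] by blast
      qed
    qed
    then show fock_irreducible
      using irr nonzero unfolding irreducible_module_def fock_irreducible_def by blast
  next
    assume irr: fock_irreducible
    have "H = {\<zero>\<^bsub>kac\<^esub>} \<or> H = carrier kac" if H: "submodule H (env_algebra m n) kac" for H
    proof -
      interpret H: submodule H "env_algebra m n" kac by fact
      have sub: "H \<subseteq> carrier kac" using H.subset by simp
      have zero: "\<zero>\<^bsub>kac\<^esub> \<in> H" using H.one_closed by simp
      have "fock_image H = {0} \<or> fock_image H = fock N"
        using irr fock_image_submodule[OF H] unfolding fock_irreducible_def by blast
      then show ?thesis
      proof
        assume img: "fock_image H = {0}"
        have "P = \<zero>\<^bsub>kac\<^esub>" if P: "P \<in> H" for P
        proof -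
          obtain X where X: "X \<in> pairs" "P = kac_class X" using P sub kac_carrier by blast
          then have "to_fock X = 0" using img P unfolding fock_image_def by blast
          then show ?thesis using X kac_class_zero_iff by simp
        qed
        then show ?thesis using zero by blast
      next
        assume img: "fock_image H = fock N"
        have "P \<in> H" if P: "P \<in> carrier kac" for P
        proof -
          obtain X where X: "X \<in> pairs" "P = kac_class X" using P kac_carrier by blast
          then have "to_fock X \<in> fock_image H" using img to_fock_in_fock by blast
          then obtain Y where Y: "Y \<in> pairs" "kac_class Y \<in> H" "to_fock X = to_fock Y"
            unfolding fock_image_def by blast
          then have "kac_class X = kac_class Y" using to_fock_eq_iff[OF X(1) Y(1)] by (simp add: kac_class_eq_iff)
          then show ?thesis using X Y by simp
        qed
        then show ?thesis using sub by blast
      qed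
    qed
    then show "irreducible_module (env_algebra m n) kac"
      using irr nonzero unfolding irreducible_module_def fock_irreducible_def by blast
  qed
qed

theorem kac_irreducible_iff_typical:
  "irreducible_module (env_algebra m n) kac \<longleftrightarrow> (\<forall>k<N. root_value k \<noteq> 0)"
  unfolding kac_irreducible_iff_fock by (rule fock_irreducible_iff)

text \<open>Of the factors in the column of the index \<open>-1\<close>, the one in the row \<open>m + \<Lambda>\<^bsub>-1\<^esub>\<close> is equal to \<open>\<Lambda>\<close> at
  that row.  This value is zero when the row exists, that is when \<open>\<Lambda>\<^bsub>-1\<^esub> < n\<close>: otherwise the
  \<open>\<Lambda>\<^bsub>-1\<^esub> + 1\<close> rows from \<open>m\<close> on would all carry nonzero entries.\<close>

lemma polynomial_weight_typical_iff:
  assumes \<Lambda>: "\<Lambda> \<in> polynomial_weights m n"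
  shows "(\<forall>k<N. root_value k \<noteq> 0) \<longleftrightarrow> (m > 0 \<longrightarrow> \<Lambda> $ (m - 1) \<ge> int n)"
proof
  have even: "\<Lambda> $ j \<le> \<Lambda> $ i" if "i \<le> j" "j < m" for i j
    using \<Lambda> that unfolding polynomial_weights_def dominant_weights_def by blast
  have odd: "\<Lambda> $ j \<le> \<Lambda> $ i" if "m \<le> i" "i \<le> j" "j < m + n" for i j
    using \<Lambda> that unfolding polynomial_weights_def dominant_weights_def by blast
  have nonneg: "0 \<le> \<Lambda> $ k" if "k < m + n" for k
    using \<Lambda> that unfolding polynomial_weights_def by blast
  have length: "int (card {k. m \<le> k \<and> k < m + n \<and> \<Lambda> $ k \<noteq> 0}) \<le> \<Lambda> $ (m - 1)" if "m > 0"
    using \<Lambda> that unfolding polynomial_weights_def by blast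
  {
    assume typical: "\<forall>k<N. root_value k \<noteq> 0"
    show "m > 0 \<longrightarrow> \<Lambda> $ (m - 1) \<ge> int n"
    proof (intro impI, rule ccontr)
      assume m: "m > 0" and "\<not> \<Lambda> $ (m - 1) \<ge> int n"
      then have less: "\<Lambda> $ (m - 1) < int n" and ge: "0 \<le> \<Lambda> $ (m - 1)" using nonneg[of "m - 1"] by auto
      \<comment> \<open>The first odd index that the length condition forces to carry the entry zero.\<close>
      define a where "a = m + nat (\<Lambda> $ (m - 1))"
      have a: "m \<le> a" "a < m + n" using less ge by (auto simp: a_def)
      obtain k where k: "k < N" "root_row m n k = a" "root_col n k = m - 1"
        using root_surj[OF a, of "m - 1"] m by auto
      have "\<Lambda> $ a = 0"
      proof (rule ccontr)
        assume nz: "\<Lambda> $ a \<noteq> 0"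
        have "{m..a} \<subseteq> {k. m \<le> k \<and> k < m + n \<and> \<Lambda> $ k \<noteq> 0}"
        proof
          fix i assume "i \<in> {m..a}"
          then have "\<Lambda> $ a \<le> \<Lambda> $ i" using odd a by auto
          then show "i \<in> {k. m \<le> k \<and> k < m + n \<and> \<Lambda> $ k \<noteq> 0}"
            using nz nonneg[OF a(2)] \<open>i \<in> {m..a}\<close> a by auto
        qed
        then have "card {m..a} \<le> card {k. m \<le> k \<and> k < m + n \<and> \<Lambda> $ k \<noteq> 0}"
          by (intro card_mono) auto
        then show False using length[OF m] ge by (simp add: a_def)
      qed
      then have "root_value k = 0" using k m ge by (simp add: root_value_def a_def)
      then show False using typical k by blast
    qed
  next
    assume large: "m > 0 \<longrightarrow> \<Lambda> $ (m - 1) \<ge> int n"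
    show "\<forall>k<N. root_value k \<noteq> 0"
    proof (intro allI impI)
      fix k assume k: "k < N"
      then have "m > 0" by (cases m) auto
      have "int n \<le> \<Lambda> $ (m - 1)" using large \<open>m > 0\<close> by simp
      also have "\<dots> \<le> \<Lambda> $ root_col n k" using root_bounds(3)[OF k] by (intro even) auto
      finally have "int n \<le> \<Lambda> $ root_col n k" .
      moreover have "0 \<le> \<Lambda> $ root_row m n k" using k by (intro nonneg) simp
      ultimately have "0 < root_value k"
        unfolding root_value_def using root_bounds[OF k] by linarith
      then show "root_value k \<noteq> 0" by simp
    qed
  }
qed

end

theorem corollary4p2:
  fixes m n :: nat
    and \<Lambda> :: "int vec"
    and scale :: "complex \<Rightarrow> 'v::ab_group_add \<Rightarrow> 'v"
    and \<rho> :: "complex mat \<Rightarrow> 'v \<Rightarrow> 'v"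
  assumes "m + n > 0"
    and "\<Lambda> \<in> polynomial_weights m n"
    and "gl_zero_irrep scale m n \<Lambda> \<rho>"
  shows "irreducible_module (env_algebra m n) (kac_module m n scale \<rho>)
    \<longleftrightarrow> (m > 0 \<longrightarrow> \<Lambda> $ (m - 1) \<ge> int n)"
proof -
  interpret gl_zero_irrep scale m n \<Lambda> \<rho> by fact
  show ?thesis
    using kac_irreducible_iff_typical polynomial_weight_typical_iff[OF assms(2)] by simp
qed

end
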